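(* Let $\mathcal{Q}$ be a class of graphs. Then $$\limsup_{n\to\infty}\frac{\log_2|\mathcal{Q}_n|}{\binom n2}\le \max_{\Gamma\in\widehat{\mathcal{Q}}}\operatorname{Ent}(\Gamma).$$
   Context: All graphs are finite and simple; $|G|$ is the number of vertices of $G$. $\mathcal{U}$ is the set of unlabelled graphs (isomorphism classes), and $\mathcal{U}_n$ is the set of those with exactly $n\ge 1$ vertices. A graph class is a subset $\mathcal{Q}\subseteq\mathcal{U}$; $\mathcal{Q}_n:=\mathcal{Q}\cap\mathcal{U}_n$. For graphs $H,G$ with $|H|\le|G|$, $p(H;G)$ is the probability that a uniformly random injective map $\phi:V(H)\to V(G)$ satisfies $uv\in E(H)\iff\phi(u)\phi(v)\in E(G)$ for all $u\ne v$. A graphon is a symmetric measurable function $W:[0,1]^2\to[0,1]$ (functions equal a.e. are identified). For a graphon $W$ and a graph $H$, $$p(H;W):=\mathbb{E}\Big[\prod_{uv\in E(H)}W(X_u,X_v)\prod_{uv\in E(H)^c}(1-W(X_u,X_v))\Big],$$ where $(X_u)_{u\in V(H)}$ are i.i.d. uniform on $[0,1]$ and $E(H)^c=\{uv:u\ne v,\ uv\notin E(H)\}$. Two graphons $W,W'$ are equivalent if $p(H;W)=p(H;W')$ for all graphs $H$; a graph limit $\Gamma$ is an equivalence class of graphons, $p(H;\Gamma):=p(H;W)$ for any representing $W$, and $\widehat{\mathcal{U}}$ is the set of all graph limits. A sequence of graphs $G_i$ converges to $\Gamma$ if $|G_i|\to\infty$ and $p(H;G_i)\to p(H;\Gamma)$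 for every graph $H$. $\widehat{\mathcal{Q}}\subseteq\widehat{\mathcal{U}}$ is the set of graph limits that are limits of sequences of graphs in $\mathcal{Q}$. With $h(x)=-x\log_2x-(1-x)\log_2(1-x)$ on $[0,1]$ ($h(0)=h(1)=0$), the entropy of a graphon is $\operatorname{Ent}(W):=\int_0^1\int_0^1h(W(x,y))\,dx\,dy$. It depends only on the graph limit represented by $W$, so $\operatorname{Ent}(\Gamma)$ is defined as $\operatorname{Ent}(W)$ for any representing $W$. Conventions: $\log_20=-\infty$; if $\mathcal{Q}$ is finite then $\widehat{\mathcal{Q}}=\emptyset$ and the right-hand side is interpreted as $-\infty$. The statement includes that the maximum is attained when $\widehat{\mathcal Q}\neq\emptyset$. *)

theory Defs
  imports "HOL-Probability.Probability"
begin

section \<open>Unlabelled graphs\<close>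

text \<open>A labelled graph is a pair of a finite nonempty vertex set of naturals and a set of
  two-element subsets of it. Every finite graph is isomorphic to one of these, so isomorphism
  classes of finite graphs are classes of such pairs.\<close>

type_synonym lgraph = "nat set \<times> nat set set"

abbreviation verts :: "lgraph \<Rightarrow> nat set" where "verts \<equiv> fst"
abbreviation edges :: "lgraph \<Rightarrow> nat set set" where "edges \<equiv> snd"

definition vpairs :: "nat set \<Rightarrow> nat set set" where
  "vpairs V = {e. e \<subseteq> V \<and> card e = 2}"

definition is_graph :: "lgraph \<Rightarrow> bool" where
  "is_graph G \<longleftrightarrow> finite (verts G) \<and> verts G \<noteq> {} \<and> edges G \<subseteq> vpairs (verts G)"

definition preserves_adj :: "lgraph \<Rightarrow> lgraph \<Rightarrow> (nat \<Rightarrow> nat) \<Rightarrow> bool" where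
  "preserves_adj H G \<phi> \<longleftrightarrow>
     (\<forall>u\<in>verts H. \<forall>v\<in>verts H. u \<noteq> v \<longrightarrow> ({u, v} \<in> edges H \<longleftrightarrow> {\<phi> u, \<phi> v} \<in> edges G))"

definition isomorphic :: "lgraph \<Rightarrow> lgraph \<Rightarrow> bool" where
  "isomorphic H G \<longleftrightarrow> (\<exists>\<phi>. bij_betw \<phi> (verts H) (verts G) \<and> preserves_adj H G \<phi>)"

definition graph_equiv :: "lgraph \<Rightarrow> lgraph \<Rightarrow> bool" where
  "graph_equiv H G \<longleftrightarrow> is_graph H \<and> is_graph G \<and> isomorphic H G"

lemma isomorphic_refl: "isomorphic G G"
  unfolding isomorphic_def preserves_adj_def by (intro exI[of _ id]) auto

lemma isomorphic_sym:
  assumes "isomorphic H G" shows "isomorphic G H"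
proof -
  obtain \<phi> where b: "bij_betw \<phi> (verts H) (verts G)" and p: "preserves_adj H G \<phi>"
    using assms unfolding isomorphic_def by blast
  let ?\<psi> = "inv_into (verts H) \<phi>"
  have b': "bij_betw ?\<psi> (verts G) (verts H)" by (rule bij_betw_inv_into[OF b])
  have "preserves_adj G H ?\<psi>"
    unfolding preserves_adj_def
  proof (intro ballI impI)
    fix u v assume u: "u \<in> verts G" and v: "v \<in> verts G" and "u \<noteq> v"
    have "?\<psi> u \<in> verts H" "?\<psi> v \<in> verts H" using b' u v bij_betwE by blast+
    moreover have "\<phi> (?\<psi> u) = u" "\<phi> (?\<psi> v) = v"
      using b u v by (auto simp: bij_betw_inv_into_right)
    moreover from this have "?\<psi> u \<noteq> ?\<psi> v" using \<open>u \<noteq> v\<close> by metis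
    ultimately show "{u, v} \<in> edges G \<longleftrightarrow> {?\<psi> u, ?\<psi> v} \<in> edges H"
      using p unfolding preserves_adj_def by metis
  qed
  then show ?thesis using b' unfolding isomorphic_def by blast
qed

lemma isomorphic_trans:
  assumes "isomorphic F G" "isomorphic G H" shows "isomorphic F H"
proof -
  obtain \<phi> where \<phi>: "bij_betw \<phi> (verts F) (verts G)" "preserves_adj F G \<phi>"
    using assms unfolding isomorphic_def by blast
  obtain \<psi> where \<psi>: "bij_betw \<psi> (verts G) (verts H)" "preserves_adj G H \<psi>"
    using assms unfolding isomorphic_def by blast
  have "preserves_adj F H (\<psi> \<circ> \<phi>)"
    unfolding preserves_adj_def
  proof (intro ballI impI)
    fix u v assume u: "u \<in> verts F" and v: "v \<in> verts F" and n: "u \<noteq> v"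
    have "\<phi> u \<in> verts G" "\<phi> v \<in> verts G" using \<phi>(1) u v bij_betwE by blast+
    moreover have "\<phi> u \<noteq> \<phi> v"
      using \<phi>(1) u v n unfolding bij_betw_def inj_on_def by blast
    ultimately show "{u, v} \<in> edges F \<longleftrightarrow> {(\<psi> \<circ> \<phi>) u, (\<psi> \<circ> \<phi>) v} \<in> edges H"
      using \<phi>(2) \<psi>(2) u v n unfolding preserves_adj_def by simp
  qed
  moreover have "bij_betw (\<psi> \<circ> \<phi>) (verts F) (verts H)"
    using \<phi>(1) \<psi>(1) by (rule bij_betw_trans)
  ultimately show ?thesis unfolding isomorphic_def by blast
qed

quotient_type ugraph = lgraph / partial: graph_equiv
proof (rule part_equivpI)
  have "graph_equiv ({0}, {}) ({0}, {})"
    unfolding graph_equiv_def by (simp add: isomorphic_refl is_graph_def)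
  then show "\<exists>G. graph_equiv G G" by blast
  show "symp graph_equiv"
    by (rule sympI) (auto simp: graph_equiv_def intro: isomorphic_sym)
  show "transp graph_equiv"
    by (rule transpI) (auto simp: graph_equiv_def intro: isomorphic_trans)
qed

lift_definition graph_order :: "ugraph \<Rightarrow> nat" is "\<lambda>G. card (verts G)"
  by (auto simp: graph_equiv_def isomorphic_def intro: bij_betw_same_card)

text \<open>The section \<open>\<Q>\<^sub>n\<close> of a graph class.\<close>

definition class_of_order :: "ugraph set \<Rightarrow> nat \<Rightarrow> ugraph set" where
  "class_of_order Q n = {G \<in> Q. graph_order G = n}"

text \<open>The sections are finite, so \<open>card\<close> never takes its default value 0 on them.\<close>

lemma finite_order: "finite {G :: ugraph. graph_order G = n}"
proof -
  let ?S = "{G. verts G = {..<n} \<and> edges G \<subseteq> vpairs {..<n}}"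
  have "finite (vpairs {..<n})" by (rule finite_subset[of _ "Pow {..<n}"]) (auto simp: vpairs_def)
  then have "finite ({{..<n}} \<times> Pow (vpairs {..<n}))" by simp
  then have "finite ?S" by (rule finite_subset[rotated]) force
  then have "finite (abs_ugraph ` ?S)" by simp
  moreover have "{G. graph_order G = n} \<subseteq> abs_ugraph ` ?S"
  proof
    fix U assume U: "U \<in> {G. graph_order G = n}"
    obtain G where G: "is_graph G" and UG: "U = abs_ugraph G"
      using Quotient_abs_rep[OF Quotient_ugraph, of U] Quotient_rep_reflp[OF Quotient_ugraph, of U]
      by (metis graph_equiv_def)
    have eq: "graph_equiv G G" using G by (simp add: graph_equiv_def isomorphic_refl)
    have "card (verts G) = n" using U UG graph_order.abs_eq[OF eq] by simp
    then obtain f where f: "bij_betw f (verts G) {..<n}"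
      using G unfolding is_graph_def by (metis bij_betw_iff_card card_lessThan finite_lessThan)
    let ?G = "({..<n}, (`) f ` edges G)"
    have inj: "inj_on f (verts G)" and im: "f ` verts G = {..<n}" using f by (auto simp: bij_betw_def)
    have sub: "edges G \<subseteq> vpairs (verts G)" using G by (simp add: is_graph_def)
    have s: "(`) f ` edges G \<subseteq> vpairs {..<n}"
    proof
      fix e' assume "e' \<in> (`) f ` edges G"
      then obtain e where e: "e \<in> edges G" "e' = f ` e" by blast
      then have "e \<subseteq> verts G" "card e = 2" using sub by (auto simp: vpairs_def)
      moreover from this have "card (f ` e) = 2"
        using inj by (metis card_image inj_on_subset)
      ultimately show "e' \<in> vpairs {..<n}" using e(2) im by (auto simp: vpairs_def)
    qed
    have "preserves_adj G ?G f" unfolding preserves_adj_def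
    proof (intro ballI impI)
      fix u v assume uv: "u \<in> verts G" "v \<in> verts G"
      have "{u, v} \<in> edges G" if m: "{f u, f v} \<in> (`) f ` edges G"
      proof -
        obtain e where e: "{f u, f v} = f ` e" "e \<in> edges G" using m by (rule imageE)
        have "e \<subseteq> verts G" using e sub by (auto simp: vpairs_def)
        then have "{u, v} = e" using e(1) inj_on_image_eq_iff[OF inj, of "{u, v}" e] uv by auto
        then show ?thesis using e by simp
      qed
      moreover have "{f u, f v} \<in> (`) f ` edges G" if "{u, v} \<in> edges G"
        using imageI[OF that, of "(`) f"] by simp
      ultimately show "{u, v} \<in> edges G \<longleftrightarrow> {f u, f v} \<in> edges ?G" by auto
    qed
    then have "isomorphic G ?G" using f unfolding isomorphic_def by auto
    moreover have "is_graph ?G" using s G im by (auto simp: is_graph_def)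
    ultimately have "graph_equiv G ?G" using G by (simp add: graph_equiv_def)
    then have "U = abs_ugraph ?G" using UG Quotient_rel_abs[OF Quotient_ugraph] by blast
    then show "U \<in> abs_ugraph ` ?S" using s by auto
  qed
  ultimately show ?thesis by (rule finite_subset[rotated])
qed

section \<open>Induced subgraph densities in graphs\<close>

definition inj_maps :: "lgraph \<Rightarrow> lgraph \<Rightarrow> (nat \<Rightarrow> nat) set" where
  "inj_maps H G = {\<phi> \<in> verts H \<rightarrow>\<^sub>E verts G. inj_on \<phi> (verts H)}"

text \<open>The value 0 in the case \<open>|H| > |G|\<close>, where there are no injective maps, is arbitrary.\<close>

definition lgraph_density :: "lgraph \<Rightarrow> lgraph \<Rightarrow> real" where
  "lgraph_density H G =
     (if card (verts H) \<le> card (verts G)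
      then measure_pmf.prob (pmf_of_set (inj_maps H G)) {\<phi>. preserves_adj H G \<phi>} else 0)"

lemma finite_inj_maps: "is_graph H \<Longrightarrow> is_graph G \<Longrightarrow> finite (inj_maps H G)"
  unfolding inj_maps_def is_graph_def
  by (rule finite_subset[of _ "verts H \<rightarrow>\<^sub>E verts G"]) (auto intro: finite_PiE)

lemma inj_maps_nonempty:
  assumes "is_graph H" "is_graph G" "card (verts H) \<le> card (verts G)"
  shows "inj_maps H G \<noteq> {}"
proof -
  obtain f where "f ` verts H \<subseteq> verts G" "inj_on f (verts H)"
    using card_le_inj[of "verts H" "verts G"] assms by (auto simp: is_graph_def)
  then have "restrict f (verts H) \<in> inj_maps H G"
    by (auto simp: inj_maps_def inj_on_def)
  then show ?thesis by blast
qed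

lemma inj_maps_card_le:
  assumes g: "is_graph H" "is_graph G" "is_graph H'" "is_graph G'"
    and i: "isomorphic H' H" "isomorphic G G'"
  shows "card {\<phi> \<in> inj_maps H G. c \<longrightarrow> preserves_adj H G \<phi>}
       \<le> card {\<phi> \<in> inj_maps H' G'. c \<longrightarrow> preserves_adj H' G' \<phi>}"
proof -
  obtain a where a: "bij_betw a (verts H') (verts H)" and pa: "preserves_adj H' H a"
    using i unfolding isomorphic_def by blast
  obtain b where b: "bij_betw b (verts G) (verts G')" and pb: "preserves_adj G G' b"
    using i unfolding isomorphic_def by blast
  have ai: "inj_on a (verts H')" "a ` verts H' = verts H" using a by (auto simp: bij_betw_def)
  have bi: "inj_on b (verts G)" "b ` verts G = verts G'" using b by (auto simp: bij_betw_def)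
  define T where "T \<phi> = (\<lambda>x\<in>verts H'. b (\<phi> (a x)))" for \<phi> :: "nat \<Rightarrow> nat"
  have inj: "inj_on T (inj_maps H G)"
  proof (rule inj_onI)
    fix \<phi> \<psi> assume p: "\<phi> \<in> inj_maps H G" "\<psi> \<in> inj_maps H G" and t: "T \<phi> = T \<psi>"
    have "\<phi> y = \<psi> y" if y: "y \<in> verts H" for y
    proof -
      obtain x where x: "x \<in> verts H'" "y = a x" using y ai by blast
      have "b (\<phi> y) = b (\<psi> y)" using fun_cong[OF t, of x] x by (simp add: T_def)
      moreover have "\<phi> y \<in> verts G" "\<psi> y \<in> verts G" using p y by (auto simp: inj_maps_def)
      ultimately show ?thesis using bi by (auto dest: inj_onD)
    qed
    then show "\<phi> = \<psi>" using p by (auto simp: inj_maps_def intro: PiE_ext)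
  qed
  have maps: "T \<phi> \<in> inj_maps H' G'" if p: "\<phi> \<in> inj_maps H G" for \<phi>
  proof -
    have 1: "\<phi> (a x) \<in> verts G" if "x \<in> verts H'" for x
      using p that ai by (auto simp: inj_maps_def)
    then have "T \<phi> \<in> verts H' \<rightarrow>\<^sub>E verts G'" using bi by (auto simp: T_def)
    moreover have "inj_on (T \<phi>) (verts H')"
    proof (rule inj_onI)
      fix x y assume xy: "x \<in> verts H'" "y \<in> verts H'" and "T \<phi> x = T \<phi> y"
      then have "b (\<phi> (a x)) = b (\<phi> (a y))" by (simp add: T_def)
      then have "\<phi> (a x) = \<phi> (a y)" using bi 1 xy by (auto dest: inj_onD)
      moreover have "inj_on \<phi> (verts H)" "a x \<in> verts H" "a y \<in> verts H"
        using p ai xy by (auto simp: inj_maps_def)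
      ultimately have "a x = a y" by (auto dest: inj_onD)
      then show "x = y" using ai xy by (auto dest: inj_onD)
    qed
    ultimately show ?thesis by (simp add: inj_maps_def)
  qed
  have pres: "preserves_adj H' G' (T \<phi>)" if p: "\<phi> \<in> inj_maps H G" and q: "preserves_adj H G \<phi>" for \<phi>
    unfolding preserves_adj_def
  proof (intro ballI impI)
    fix u v assume uv: "u \<in> verts H'" "v \<in> verts H'" "u \<noteq> v"
    have A: "a u \<in> verts H" "a v \<in> verts H" "a u \<noteq> a v"
      using uv ai by (auto dest: inj_onD)
    have B: "\<phi> (a u) \<in> verts G" "\<phi> (a v) \<in> verts G" "\<phi> (a u) \<noteq> \<phi> (a v)"
      using p A by (auto simp: inj_maps_def dest: inj_onD)
    have "{u, v} \<in> edges H' \<longleftrightarrow> {a u, a v} \<in> edges H"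
      using pa uv by (auto simp: preserves_adj_def)
    also have "\<dots> \<longleftrightarrow> {\<phi> (a u), \<phi> (a v)} \<in> edges G"
      using q A by (auto simp: preserves_adj_def)
    also have "\<dots> \<longleftrightarrow> {b (\<phi> (a u)), b (\<phi> (a v))} \<in> edges G'"
      using pb B by (auto simp: preserves_adj_def)
    finally show "{u, v} \<in> edges H' \<longleftrightarrow> {T \<phi> u, T \<phi> v} \<in> edges G'"
      using uv by (simp add: T_def)
  qed
  show ?thesis
  proof (rule card_inj_on_le[where f = T])
    show "inj_on T {\<phi> \<in> inj_maps H G. c \<longrightarrow> preserves_adj H G \<phi>}"
      by (rule inj_on_subset[OF inj]) auto
    show "T ` {\<phi> \<in> inj_maps H G. c \<longrightarrow> preserves_adj H G \<phi>}
        \<subseteq> {\<phi> \<in> inj_maps H' G'. c \<longrightarrow> preserves_adj H' G' \<phi>}"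
      using maps pres by auto
    show "finite {\<phi> \<in> inj_maps H' G'. c \<longrightarrow> preserves_adj H' G' \<phi>}"
      using finite_inj_maps[OF g(3,4)] by auto
  qed
qed

lemma lgraph_density_cong:
  assumes e: "graph_equiv H H'" "graph_equiv G G'"
  shows "lgraph_density H G = lgraph_density H' G'"
proof -
  have g: "is_graph H" "is_graph G" "is_graph H'" "is_graph G'"
    and i: "isomorphic H H'" "isomorphic G G'" "isomorphic H' H" "isomorphic G' G"
    using e by (auto simp: graph_equiv_def intro: isomorphic_sym)
  have c: "card (verts H) = card (verts H')" "card (verts G) = card (verts G')"
    using i unfolding isomorphic_def using bij_betw_same_card by blast+
  have eq: "card {\<phi> \<in> inj_maps H G. c \<longrightarrow> preserves_adj H G \<phi>}
          = card {\<phi> \<in> inj_maps H' G'. c \<longrightarrow> preserves_adj H' G' \<phi>}" for c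
    by (intro antisym inj_maps_card_le g i)
  have "inj_maps H G \<inter> {\<phi>. preserves_adj H G \<phi>} = {\<phi> \<in> inj_maps H G. preserves_adj H G \<phi>}"
    for H G by auto
  then show ?thesis
    using eq[of True] eq[of False] c g
    by (simp add: lgraph_density_def measure_pmf_of_set inj_maps_nonempty finite_inj_maps)
qed

lift_definition ind_density :: "ugraph \<Rightarrow> ugraph \<Rightarrow> real" is lgraph_density
  by (rule lgraph_density_cong)

section \<open>Graphons and graph limits\<close>

definition unit_measure :: "real measure" where
  "unit_measure = restrict_space lborel {0..1}"

text \<open>Graphons are taken Borel measurable; as functions equal almost everywhere are identified, this
  is no restriction. Only the values on the unit square matter.\<close>

definition graphon :: "(real \<Rightarrow> real \<Rightarrow> real) \<Rightarrow> bool" where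
  "graphon W \<longleftrightarrow>
     case_prod W \<in> borel_measurable (unit_measure \<Otimes>\<^sub>M unit_measure) \<and>
     (\<forall>x\<in>{0..1}. \<forall>y\<in>{0..1}. W x y = W y x \<and> 0 \<le> W x y \<and> W x y \<le> 1)"

text \<open>For an edge \<open>e = {u, v}\<close> the value \<open>W(X\<^sub>u, X\<^sub>v)\<close> is written with
  \<open>u = Min e\<close> and \<open>v = Max e\<close>; by symmetry the order of the two ends is irrelevant.\<close>

definition lgraphon_density :: "lgraph \<Rightarrow> (real \<Rightarrow> real \<Rightarrow> real) \<Rightarrow> real" where
  "lgraphon_density H W =
     (\<integral>X. (\<Prod>e\<in>edges H. W (X (Min e)) (X (Max e))) *
          (\<Prod>e\<in>vpairs (verts H) - edges H. 1 - W (X (Min e)) (X (Max e)))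
       \<partial>(\<Pi>\<^sub>M u\<in>verts H. unit_measure))"

definition graphon_equiv :: "(real \<Rightarrow> real \<Rightarrow> real) \<Rightarrow> (real \<Rightarrow> real \<Rightarrow> real) \<Rightarrow> bool" where
  "graphon_equiv W W' \<longleftrightarrow> graphon W \<and> graphon W' \<and>
     (\<forall>H. is_graph H \<longrightarrow> lgraphon_density H W = lgraphon_density H W')"

quotient_type graph_limit = "real \<Rightarrow> real \<Rightarrow> real" / partial: graphon_equiv
proof (rule part_equivpI)
  have "graphon_equiv (\<lambda>_ _. 0) (\<lambda>_ _. 0)"
    by (simp add: graphon_equiv_def graphon_def case_prod_unfold)
  then show "\<exists>W. graphon_equiv W W" by blast
  show "symp graphon_equiv" by (rule sympI) (auto simp: graphon_equiv_def)
  show "transp graphon_equiv" by (rule transpI) (auto simp: graphon_equiv_def)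
qed

lemma space_unit_measure: "space unit_measure = {0..1}"
  by (simp add: unit_measure_def space_restrict_space)

lemma prob_space_unit_measure: "prob_space unit_measure"
  by (rule prob_spaceI)
    (simp add: space_unit_measure, simp add: unit_measure_def emeasure_restrict_space)

lemma vpairs_finite: "finite V \<Longrightarrow> finite (vpairs V)"
  by (rule finite_subset[of _ "Pow V"]) (auto simp: vpairs_def)

lemma vpairsE:
  assumes "e \<in> vpairs V"
  obtains u v where "u \<in> V" "v \<in> V" "u < v" "e = {u, v}" "Min e = u" "Max e = v"
proof -
  have "e \<subseteq> V" "card e = 2" using assms by (auto simp: vpairs_def)
  then obtain x y where xy: "e = {x, y}" "x \<noteq> y" "x \<in> V" "y \<in> V" by (auto simp: card_2_iff)
  show ?thesis
  proof (cases "x < y")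
    case True then show ?thesis using xy by (intro that[of x y]) auto
  next
    case False then show ?thesis using xy by (intro that[of y x]) (auto simp: insert_commute)
  qed
qed

lemma lgraphon_density_cong:
  assumes e: "graph_equiv H H'" and W: "graphon W"
  shows "lgraphon_density H W = lgraphon_density H' W"
proof -
  have g: "is_graph H" "is_graph H'" using e by (auto simp: graph_equiv_def)
  obtain f where f: "bij_betw f (verts H) (verts H')" and p: "preserves_adj H H' f"
    using e unfolding graph_equiv_def isomorphic_def by blast
  have fi: "inj_on f (verts H)" "f ` verts H = verts H'" using f by (auto simp: bij_betw_def)
  let ?V = "verts H" and ?V' = "verts H'" and ?M = unit_measure
  define F where "F K X = (\<Prod>e\<in>edges K. W (X (Min e)) (X (Max e))) *
      (\<Prod>e\<in>vpairs (verts K) - edges K. 1 - W (X (Min e)) (X (Max e)))"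
    for K :: lgraph and X :: "nat \<Rightarrow> real"
  have sub: "edges H \<subseteq> vpairs ?V" "edges H' \<subseteq> vpairs ?V'" using g by (auto simp: is_graph_def)
  have Wm: "case_prod W \<in> borel_measurable (?M \<Otimes>\<^sub>M ?M)" using W by (simp add: graphon_def)
  have comp: "(\<lambda>X. W (X (Min e)) (X (Max e))) \<in> borel_measurable (\<Pi>\<^sub>M u\<in>?V. ?M)"
    if "e \<in> vpairs ?V" for e
  proof -
    have "Min e \<in> ?V" "Max e \<in> ?V" using that by (auto elim: vpairsE)
    then have "(\<lambda>X. (X (Min e), X (Max e))) \<in> (\<Pi>\<^sub>M u\<in>?V. ?M) \<rightarrow>\<^sub>M ?M \<Otimes>\<^sub>M ?M"
      by (intro measurable_Pair measurable_component_singleton)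
    from measurable_compose[OF this Wm] show ?thesis by simp
  qed
  have Fm: "F H \<in> borel_measurable (\<Pi>\<^sub>M u\<in>?V. ?M)"
    unfolding F_def using sub comp
    by (intro borel_measurable_times borel_measurable_prod borel_measurable_diff) auto
  have fV: "f ` e \<in> vpairs ?V'" if "e \<in> vpairs ?V" for e
  proof -
    have "e \<subseteq> ?V" "card e = 2" using that by (auto simp: vpairs_def)
    moreover from this have "card (f ` e) = 2" using fi by (metis card_image inj_on_subset)
    ultimately show ?thesis using fi by (auto simp: vpairs_def)
  qed
  have iff: "f ` e \<in> edges H' \<longleftrightarrow> e \<in> edges H" if "e \<in> vpairs ?V" for e
    using that p by (elim vpairsE) (auto simp: preserves_adj_def)
  have injV: "inj_on ((`) f) (vpairs ?V)"
  proof (rule inj_onI)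
    fix x y assume "x \<in> vpairs ?V" "y \<in> vpairs ?V" "f ` x = f ` y"
    then show "x = y" using fi inj_on_image_eq_iff[OF fi(1), of x y] by (auto simp: vpairs_def)
  qed
  have imV: "(`) f ` vpairs ?V = vpairs ?V'"
  proof (intro equalityI subsetI)
    fix e' assume e': "e' \<in> vpairs ?V'"
    then obtain u' v' where uv': "u' \<in> ?V'" "v' \<in> ?V'" "u' < v'" "e' = {u', v'}" by (elim vpairsE)
    then obtain u v where uv: "u \<in> ?V" "v \<in> ?V" "u' = f u" "v' = f v" using fi by blast
    then have "{u, v} \<in> vpairs ?V" using uv' by (auto simp: vpairs_def card_2_iff)
    moreover have "e' = f ` {u, v}" using uv uv' by simp
    ultimately show "e' \<in> (`) f ` vpairs ?V" by blast
  qed (auto intro: fV)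
  have imE: "(`) f ` edges H = edges H'"
  proof (intro equalityI subsetI)
    fix e' assume e': "e' \<in> edges H'"
    then have "e' \<in> (`) f ` vpairs ?V" using sub imV by blast
    then obtain e where e: "e \<in> vpairs ?V" "e' = f ` e" by (rule imageE)
    then have "e \<in> edges H" using iff e' by blast
    then show "e' \<in> (`) f ` edges H" using e by blast
  next
    fix e' assume "e' \<in> (`) f ` edges H"
    then obtain e where e: "e \<in> edges H" "e' = f ` e" by blast
    then show "e' \<in> edges H'" using iff[of e] sub by blast
  qed
  have imC: "(`) f ` (vpairs ?V - edges H) = vpairs ?V' - edges H'"
    using inj_on_image_set_diff[OF injV _ sub(1), of "vpairs ?V"] imV imE by simp
  have val: "W (X (f (Min e))) (X (f (Max e))) = W (X (Min (f ` e))) (X (Max (f ` e)))"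
    if e: "e \<in> vpairs ?V" and X: "X \<in> space (\<Pi>\<^sub>M u\<in>?V'. ?M)" for e X
  proof -
    obtain u v where uv: "u \<in> ?V" "v \<in> ?V" "u < v" "e = {u, v}" "Min e = u" "Max e = v"
      using e by (rule vpairsE)
    have "f u \<in> ?V'" "f v \<in> ?V'" using uv fi by auto
    then have r: "X (f u) \<in> {0..1}" "X (f v) \<in> {0..1}"
      using X by (auto simp: space_PiM space_unit_measure PiE_iff)
    have "W (X (f u)) (X (f v)) = W (X (f v)) (X (f u))"
      using W r unfolding graphon_def by blast
    then show ?thesis using uv by (cases "f u \<le> f v") (auto simp: max_def min_def)
  qed
  have FF: "F H (\<lambda>n\<in>?V. X (f n)) = F H' X" if X: "X \<in> space (\<Pi>\<^sub>M u\<in>?V'. ?M)" for X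
  proof -
    have v1: "W ((\<lambda>n\<in>?V. X (f n)) (Min e)) ((\<lambda>n\<in>?V. X (f n)) (Max e))
        = W (X (Min (f ` e))) (X (Max (f ` e)))" if e: "e \<in> vpairs ?V" for e
    proof -
      have "Min e \<in> ?V" "Max e \<in> ?V" using e by (auto elim: vpairsE)
      then show ?thesis using val[OF e X] by simp
    qed
    have 1: "(\<Prod>e\<in>edges H. W ((\<lambda>n\<in>?V. X (f n)) (Min e)) ((\<lambda>n\<in>?V. X (f n)) (Max e)))
        = (\<Prod>e\<in>edges H'. W (X (Min e)) (X (Max e)))"
      unfolding imE[symmetric] using inj_on_subset[OF injV sub(1)] sub v1
      by (subst prod.reindex) (auto intro!: prod.cong)
    have 2: "(\<Prod>e\<in>vpairs ?V - edges H. 1 - W ((\<lambda>n\<in>?V. X (f n)) (Min e)) ((\<lambda>n\<in>?V. X (f n)) (Max e)))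
        = (\<Prod>e\<in>vpairs ?V' - edges H'. 1 - W (X (Min e)) (X (Max e)))"
      unfolding imC[symmetric] using inj_on_subset[OF injV, of "vpairs ?V - edges H"] v1
      by (subst prod.reindex) (auto intro!: prod.cong)
    show ?thesis unfolding F_def 1 2 ..
  qed
  let ?t = "\<lambda>X. \<lambda>n\<in>?V. X (f n)"
  have d: "distr (\<Pi>\<^sub>M u\<in>?V'. ?M) (\<Pi>\<^sub>M u\<in>?V. ?M) ?t = (\<Pi>\<^sub>M u\<in>?V. ?M)"
    using distr_PiM_reindex[of ?V' "\<lambda>_. ?M" f ?V] fi prob_space_unit_measure by auto
  have tm: "?t \<in> (\<Pi>\<^sub>M u\<in>?V'. ?M) \<rightarrow>\<^sub>M (\<Pi>\<^sub>M u\<in>?V. ?M)"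
    using fi by (intro measurable_restrict measurable_component_singleton) auto
  have "integral\<^sup>L (\<Pi>\<^sub>M u\<in>?V. ?M) (F H) = integral\<^sup>L (distr (\<Pi>\<^sub>M u\<in>?V'. ?M) (\<Pi>\<^sub>M u\<in>?V. ?M) ?t) (F H)"
    by (simp only: d)
  also have "\<dots> = (\<integral>X. F H (?t X) \<partial>(\<Pi>\<^sub>M u\<in>?V'. ?M))"
    by (rule integral_distr[OF tm Fm])
  also have "\<dots> = integral\<^sup>L (\<Pi>\<^sub>M u\<in>?V'. ?M) (F H')"
    by (rule Bochner_Integration.integral_cong[OF refl FF])
  finally show ?thesis unfolding lgraphon_density_def F_def .
qed

lift_definition limit_density :: "ugraph \<Rightarrow> graph_limit \<Rightarrow> real" is lgraphon_density
proof -
  fix H H' W W' assume H: "graph_equiv H H'" and W: "graphon_equiv W W'"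
  have "lgraphon_density H W = lgraphon_density H' W"
    using H W by (intro lgraphon_density_cong) (auto simp: graphon_equiv_def)
  also have "\<dots> = lgraphon_density H' W'"
    using H W unfolding graph_equiv_def graphon_equiv_def by blast
  finally show "lgraphon_density H W = lgraphon_density H' W'" .
qed

definition converges_to :: "(nat \<Rightarrow> ugraph) \<Rightarrow> graph_limit \<Rightarrow> bool" where
  "converges_to G \<Gamma> \<longleftrightarrow> filterlim (\<lambda>i. graph_order (G i)) at_top sequentially \<and>
     (\<forall>H. (\<lambda>i. ind_density H (G i)) \<longlonglongrightarrow> limit_density H \<Gamma>)"

definition class_limits :: "ugraph set \<Rightarrow> graph_limit set" where
  "class_limits Q = {\<Gamma>. \<exists>G. (\<forall>i. G i \<in> Q) \<and> converges_to G \<Gamma>}"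

section \<open>Entropy\<close>

text \<open>At 0 and 1 this is 0, because the library's \<open>log 2 0\<close> is a real number and its factor is 0.\<close>

definition binary_entropy :: "real \<Rightarrow> real" where
  "binary_entropy x = - x * log 2 x - (1 - x) * log 2 (1 - x)"

definition graphon_Ent :: "(real \<Rightarrow> real \<Rightarrow> real) \<Rightarrow> real" where
  "graphon_Ent W = (\<integral>x. (\<integral>y. binary_entropy (W x y) \<partial>unit_measure) \<partial>unit_measure)"

text \<open>The common value of the entropies of all graphons representing the graph limit.\<close>

definition Ent :: "graph_limit \<Rightarrow> real" where
  "Ent \<Gamma> = (THE c. \<forall>W. graphon W \<and> abs_graph_limit W = \<Gamma> \<longrightarrow> graphon_Ent W = c)"

text \<open>The library's real logarithm has a finite value at 0, here the value is \<open>-\<infinity>\<close>.\<close>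

definition elog2 :: "nat \<Rightarrow> ereal" where
  "elog2 m = (if m = 0 then -\<infinity> else ereal (log 2 (real m)))"

end

theory Submission
  imports Defs "HOL-Complex_Analysis.Great_Picard"
begin

text \<open>Let \<open>ent\<^sub>k\<close> be the entropy of the random labelled graph induced by \<open>k\<close> random vertices
  of a graph, respectively by \<open>k\<close> random points of a graphon. It is a function of the induced
  densities and therefore continuous under convergence of graphs.

  For a graphon \<open>W\<close>, \<open>Ent W\<close> is the infimum of \<open>ent\<^sub>k(W) / (k choose 2)\<close>: conditioning on the sampled
  points gives one inequality, comparison with a step function close to \<open>W\<close> the other. So the entropy
  depends only on the graph limit, and a limit of graphs with \<open>ent\<^sub>k \<ge> L (k choose 2)\<close> eventually, for
  every \<open>k\<close>, has entropy at least \<open>L\<close>.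

  For finite families, Shearer's inequality bounds \<open>log |Q\<^sub>n| / (n choose 2)\<close> by the entropy of the mean
  sample divided by \<open>k choose 2\<close>; restricting first to a large subfamily with almost constant sample
  densities turns the mean sample into the sample of a single graph of the class.

  What remains is the compactness of the space of graph limits. Every graph is refined greedily by the
  pairs of sets that maximise the cut difference; as the energy is at most 1, the cut differences are
  square summable. Along a subsequence all step densities converge, and the limits form a martingale
  of step graphons, whose almost sure limit is the graphon sought.\<close>

section \<open>Entropy of finite distributions\<close>

text \<open>Entropy is not continuous under graph convergence: 0/1-valued graphons of typical random
  graphs have entropy 0 and can converge to the constant 1/2, of entropy 1. What survives is upper
  semicontinuity, which an infimum of continuous functions always has; it is the direction that both
  the bound and the attainment of the maximum require. The sample of a family is harder to control
  than that of a graph: as \<open>eta\<close> is concave, a mixture of graphs with small sample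
  entropy may have large sample entropy. Nearly equal densities exclude this, and the number of
  cells needed is independent of \<open>n\<close>, so its logarithm is negligible against
  \<open>n choose 2\<close>. Isomorphism costs nothing: one labelled graph is chosen per class, and
  sampling by random injections does not see the labelling. The refinement is steered by the cut
  difference because that is what controls densities in the counting lemma. Each step multiplies the
  number of available colours by exactly 4, whatever the graph, and records the old colour in the
  new one. So graphs of all orders have parameters of the same shape, and their limits can be laid
  out as nested intervals.\<close>

definition eta :: "real \<Rightarrow> real" where
  "eta x = - x * log 2 x"

lemma eta_0 [simp]: "eta 0 = 0" and eta_1 [simp]: "eta 1 = 0"
  by (simp_all add: eta_def)

lemma binary_entropy_eq_eta: "binary_entropy x = eta x + eta (1 - x)"
  by (simp add: binary_entropy_def eta_def algebra_simps)

lemma log2_le: "log 2 x \<le> (x - 1) / ln 2" if "0 < x"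
  using ln_le_minus_one[OF that] by (simp add: log_def divide_right_mono)

text \<open>The right-hand side is the tangent at \<open>q\<close> of the concave function
  \<open>eta\<close>. Summed over two probability vectors the linear terms cancel, which gives
  Gibbs' inequality.\<close>

lemma eta_le_tangent:
  assumes "0 \<le> x" "0 < q"
  shows "eta x \<le> - x * log 2 q + (q - x) / ln 2"
proof (cases "x = 0")
  case False
  then have x: "0 < x" using assms by simp
  have "x * log 2 (q / x) \<le> x * ((q / x - 1) / ln 2)"
    using x assms by (intro mult_left_mono log2_le) auto
  also have "\<dots> = (q - x) / ln 2" using x by (simp add: field_simps)
  finally show ?thesis using x assms by (simp add: eta_def log_divide algebra_simps)
qed (use assms in simp)

text \<open>Integrating the tangent at the mean \<open>m\<close> gives the bound. There is no
  tangent at 0, so for \<open>m = 0\<close> the tangents at \<open>q\<close> with \<open>q\<close>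
  tending to 0 are used.\<close>

lemma (in prob_space) eta_jensen:
  assumes f: "integrable M f" "\<And>x. x \<in> space M \<Longrightarrow> 0 \<le> f x" and e: "integrable M (\<lambda>x. eta (f x))"
  shows "(\<integral>x. eta (f x) \<partial>M) \<le> eta (\<integral>x. f x \<partial>M)"
proof -
  define m where "m = (\<integral>x. f x \<partial>M)"
  have "0 \<le> m" unfolding m_def using f by (intro integral_nonneg_AE) auto
  have le: "(\<integral>x. eta (f x) \<partial>M) \<le> - m * log 2 q + (q - m) / ln 2" if "0 < q" for q
  proof -
    have "(\<integral>x. eta (f x) \<partial>M) \<le> (\<integral>x. - f x * log 2 q + (q - f x) / ln 2 \<partial>M)"
      using f e that by (intro integral_mono eta_le_tangent) auto
    also have "\<dots> = - m * log 2 q + (q - m) / ln 2" using f by (simp add: m_def prob_space)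
    finally show ?thesis .
  qed
  show ?thesis
  proof (cases "m = 0")
    case True
    have "(\<integral>x. eta (f x) \<partial>M) \<le> 0 + \<epsilon>" if "0 < \<epsilon>" for \<epsilon> using le[of "\<epsilon> * ln 2"] that True by simp
    then show ?thesis using True m_def by (metis field_le_epsilon eta_0)
  next
    case False
    then show ?thesis using le[of m] \<open>0 \<le> m\<close> by (simp add: eta_def m_def[symmetric])
  qed
qed

lemma eta_jensen_avg:
  assumes "finite A" "A \<noteq> {}" "\<And>x. 0 \<le> f x"
  shows "(\<Sum>x\<in>A. eta (f x)) / card A \<le> eta ((\<Sum>x\<in>A. f x) / card A)"
  using measure_pmf.eta_jensen[of "pmf_of_set A" f] assms
  by (simp add: integral_pmf_of_set integrable_measure_pmf_finite)

lemma eta_nonneg: "0 \<le> x \<Longrightarrow> x \<le> 1 \<Longrightarrow> 0 \<le> eta x"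
  by (cases "x = 0") (auto simp: eta_def mult_le_0_iff)

lemma eta_le: "0 \<le> x \<Longrightarrow> eta x \<le> 1 / ln 2"
  using eta_le_tangent[of x 1] divide_right_mono[of "1 - x" 1 "ln 2"] by simp

text \<open>The tangents at 1/2 for \<open>x\<close> and for \<open>1 - x\<close> add up to the
  constant 1.\<close>

lemma binary_entropy_le_1: "0 \<le> x \<Longrightarrow> x \<le> 1 \<Longrightarrow> binary_entropy x \<le> 1"
  using eta_le_tangent[of x "1/2"] eta_le_tangent[of "1 - x" "1/2"]
  by (simp add: binary_entropy_eq_eta log_divide algebra_simps add_divide_distrib diff_divide_distrib)

lemma binary_entropy_nonneg: "0 \<le> x \<Longrightarrow> x \<le> 1 \<Longrightarrow> 0 \<le> binary_entropy x"
  by (simp add: binary_entropy_eq_eta eta_nonneg)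

lemma eta_measurable [measurable]: "eta \<in> borel_measurable borel"
  unfolding eta_def by measurable

lemma continuous_on_eta: "continuous_on {0..} eta"
proof -
  have "isCont eta x" if "0 < x" for x unfolding eta_def using that by (auto intro!: continuous_intros)
  moreover have "(eta \<longlongrightarrow> eta 0) (at_right 0)" unfolding eta_def log_def by real_asymp
  ultimately show ?thesis unfolding continuous_on_def
    by (metis atLeast_iff order_le_less at_within_Ici_at_right isCont_def filterlim_at_within_If
        continuous_within continuous_at_imp_continuous_within)
qed

lemma tendsto_eta:
  assumes "(f \<longlongrightarrow> l) F" "\<And>x. 0 \<le> f x" "0 \<le> l"
  shows "((\<lambda>x. eta (f x)) \<longlongrightarrow> eta l) F"
  using assms by (intro continuous_on_tendsto_compose[OF continuous_on_eta]) auto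

section \<open>Shearer's inequality\<close>

text \<open>Telescoping along an enumeration of \<open>S\<close>: adding \<open>e\<close> to the trace of \<open>A i\<close> on an initial
  segment gains at least what adding \<open>e\<close> to the whole segment gains.\<close>

lemma shearer:
  fixes f :: "'a set \<Rightarrow> real"
  assumes sub: "\<And>A B e. A \<subseteq> B \<Longrightarrow> B \<subseteq> S \<Longrightarrow> e \<in> S \<Longrightarrow> e \<notin> B \<Longrightarrow>
      f (insert e B) - f B \<le> f (insert e A) - f A"
    and f0: "f {} = 0" and S: "finite S" and I: "finite I"
    and cover: "\<And>e. e \<in> S \<Longrightarrow> card {i\<in>I. e \<in> A i} = N" and A: "\<And>i. i \<in> I \<Longrightarrow> A i \<subseteq> S"
  shows "real N * f S \<le> (\<Sum>i\<in>I. f (A i))"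
proof -
  have "T \<subseteq> S \<Longrightarrow> real N * f T \<le> (\<Sum>i\<in>I. f (A i \<inter> T))" if "finite T" for T using that
  proof (induction T)
    case (insert e T)
    let ?J = "{i\<in>I. e \<in> A i}"
    have "real N * f (insert e T) = real N * f T + (\<Sum>i\<in>?J. f (insert e T) - f T)"
      using cover[of e] insert.prems by (simp add: algebra_simps)
    also have "\<dots> \<le> (\<Sum>i\<in>I. f (A i \<inter> T)) + (\<Sum>i\<in>?J. f (insert e (A i \<inter> T)) - f (A i \<inter> T))"
      using insert by (intro add_mono sum_mono sub) auto
    also have "(\<Sum>i\<in>?J. f (insert e (A i \<inter> T)) - f (A i \<inter> T))
        = (\<Sum>i\<in>I. f (A i \<inter> insert e T) - f (A i \<inter> T))" using I by (intro sum.mono_neutral_cong_left) auto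
    finally show ?case by (simp add: sum_subtractf)
  qed (simp add: f0)
  from this[OF S order_refl] show ?thesis using A by (simp add: Int_absorb2)
qed

definition tr_card :: "'a set set \<Rightarrow> 'a set \<Rightarrow> 'a set \<Rightarrow> real" where
  "tr_card \<F> A F = real (card {F'\<in>\<F>. F' \<inter> A = F \<inter> A})"

text \<open>The entropy of the trace on \<open>A\<close> of a uniformly random member of \<open>\<F>\<close>.\<close>

definition tr_ent :: "'a set set \<Rightarrow> 'a set \<Rightarrow> real" where
  "tr_ent \<F> A = (\<Sum>F\<in>\<F>. - log 2 (tr_card \<F> A F / card \<F>)) / card \<F>"

lemma tr_card_pos: "finite \<F> \<Longrightarrow> F \<in> \<F> \<Longrightarrow> 0 < tr_card \<F> A F"
  unfolding tr_card_def by (auto simp: card_gt_0_iff)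

lemma tr_ent_empty: "finite \<F> \<Longrightarrow> tr_ent \<F> {} = 0"
  by (simp add: tr_ent_def tr_card_def)

lemma tr_ent_all:
  assumes "finite \<F>" "\<F> \<noteq> {}" "\<And>F. F \<in> \<F> \<Longrightarrow> F \<subseteq> S"
  shows "tr_ent \<F> S = log 2 (card \<F>)"
proof -
  have "tr_card \<F> S F = 1" if "F \<in> \<F>" for F
  proof -
    have "{F'\<in>\<F>. F' \<inter> S = F \<inter> S} = {F}" using assms that by (auto dest: assms(3))
    then show ?thesis by (simp add: tr_card_def)
  qed
  then have "tr_ent \<F> S = (\<Sum>F\<in>\<F>. - log 2 (1 / card \<F>)) / card \<F>" by (simp add: tr_ent_def)
  also have "\<dots> = log 2 (card \<F>)" using assms by (simp add: log_divide card_gt_0_iff)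
  finally show ?thesis .
qed

text \<open>Conditioning on more coordinates decreases entropy. The difference of the two gains is a
  mean of logarithms of count ratios; by \<open>log2_le\<close> it is enough that these ratios sum
  to at most \<open>card \<F>\<close>.\<close>

lemma tr_ent_submodular:
  assumes fin: "finite \<F>" and AB: "A \<subseteq> B"
  shows "tr_ent \<F> (insert e B) - tr_ent \<F> B \<le> tr_ent \<F> (insert e A) - tr_ent \<F> A"
proof (cases "\<F> = {}")
  case True then show ?thesis by (simp add: tr_ent_def)
next
  case False
  let ?c = "tr_card \<F>"
  have split: "{F'\<in>\<F>. F' \<inter> insert e X = F \<inter> insert e X}
      = {F'\<in>\<F>. F' \<inter> X = F \<inter> X \<and> (e \<in> F' \<longleftrightarrow> e \<in> F)}" for X F by auto
  \<comment> \<open>On a fibre over \<open>B\<close> the ratio depends only on whether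
    \<open>e\<close> is present. Each of the two cases sums to the size of the matching part of the
    fibre over \<open>A\<close>, or to 0 when the case does not occur over \<open>B\<close>.\<close>
  have inner: "(\<Sum>F\<in>{F\<in>\<F>. F \<inter> B = F' \<inter> B}. ?c (insert e A) F / ?c (insert e B) F) \<le> ?c A F'"
    if F': "F' \<in> \<F>" for F'
  proof -
    define T where "T b = {F\<in>\<F>. F \<inter> B = F' \<inter> B \<and> (e \<in> F \<longleftrightarrow> b)}" for b
    define s where "s b = {F\<in>\<F>. F \<inter> A = F' \<inter> A \<and> (e \<in> F \<longleftrightarrow> b)}" for b
    have "(\<Sum>F\<in>T b. ?c (insert e A) F / ?c (insert e B) F) \<le> card (s b)" for b
    proof -
      have "?c (insert e A) F / ?c (insert e B) F = card (s b) / card (T b)" if "F \<in> T b" for F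
      proof -
        have BF: "F \<inter> B = F' \<inter> B" and AF: "F \<inter> A = F' \<inter> A" and "e \<in> F \<longleftrightarrow> b"
          using that AB by (auto simp: T_def)
        then show ?thesis by (simp add: tr_card_def split s_def T_def)
      qed
      then have "(\<Sum>F\<in>T b. ?c (insert e A) F / ?c (insert e B) F) = (\<Sum>F\<in>T b. card (s b) / card (T b))"
        by simp
      then show ?thesis by (cases "card (T b) = 0") auto
    qed
    then have "(\<Sum>F\<in>T True. ?c (insert e A) F / ?c (insert e B) F)
        + (\<Sum>F\<in>T False. ?c (insert e A) F / ?c (insert e B) F) \<le> card (s True) + card (s False)"
      by (simp add: add_mono)
    moreover have "{F\<in>\<F>. F \<inter> B = F' \<inter> B} = T True \<union> T False" by (auto simp: T_def)
    moreover have "{F\<in>\<F>. F \<inter> A = F' \<inter> A} = s True \<union> s False" by (auto simp: s_def)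
    moreover have "finite (T b)" "finite (s b)" for b using fin by (auto simp: T_def s_def)
    moreover have "T True \<inter> T False = {}" "s True \<inter> s False = {}" by (auto simp: T_def s_def)
    ultimately show ?thesis by (simp add: tr_card_def sum.union_disjoint card_Un_disjoint)
  qed
  \<comment> \<open>The factor \<open>?c B F\<close> is itself a count of members with the trace of
    \<open>F\<close> on \<open>B\<close>. Writing it as a sum and exchanging the two sums leaves the
    fibre sums bounded in \<open>inner\<close>.\<close>
  have "(\<Sum>F\<in>\<F>. ?c B F * ?c (insert e A) F / (?c (insert e B) F * ?c A F))
      = (\<Sum>F\<in>\<F>. \<Sum>F'\<in>\<F>. if F' \<inter> B = F \<inter> B then ?c (insert e A) F / (?c (insert e B) F * ?c A F) else 0)"
  proof (rule sum.cong[OF refl])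
    fix F assume "F \<in> \<F>"
    show "?c B F * ?c (insert e A) F / (?c (insert e B) F * ?c A F)
      = (\<Sum>F'\<in>\<F>. if F' \<inter> B = F \<inter> B then ?c (insert e A) F / (?c (insert e B) F * ?c A F) else 0)"
      by (subst sum.inter_filter[OF fin, symmetric]) (simp add: tr_card_def[of \<F> B])
  qed
  also have "\<dots> = (\<Sum>F'\<in>\<F>. \<Sum>F\<in>\<F>. if F' \<inter> B = F \<inter> B then ?c (insert e A) F / (?c (insert e B) F * ?c A F) else 0)"
    by (rule sum.swap)
  also have "\<dots> = (\<Sum>F'\<in>\<F>. (\<Sum>F\<in>{F\<in>\<F>. F \<inter> B = F' \<inter> B}. ?c (insert e A) F / ?c (insert e B) F) / ?c A F')"
  proof (rule sum.cong[OF refl])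
    fix F' assume "F' \<in> \<F>"
    have "?c A F = ?c A F'" if "F \<inter> B = F' \<inter> B" for F
    proof -
      have "F \<inter> A = F' \<inter> A" using that AB by auto
      then show ?thesis by (simp add: tr_card_def)
    qed
    note eqA = this
    show "(\<Sum>F\<in>\<F>. if F' \<inter> B = F \<inter> B then ?c (insert e A) F / (?c (insert e B) F * ?c A F) else 0)
       = (\<Sum>F\<in>{F\<in>\<F>. F \<inter> B = F' \<inter> B}. ?c (insert e A) F / ?c (insert e B) F) / ?c A F'"
      unfolding sum_divide_distrib
    proof (intro sum.mono_neutral_cong_right)
      fix F assume "F \<in> {F\<in>\<F>. F \<inter> B = F' \<inter> B}"
      then have "F \<inter> B = F' \<inter> B" by simp
      with eqA[OF this] show "(if F' \<inter> B = F \<inter> B then ?c (insert e A) F / (?c (insert e B) F * ?c A F) else 0)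
        = ?c (insert e A) F / ?c (insert e B) F / ?c A F'" by simp
    qed (use fin in auto)
  qed
  also have "\<dots> \<le> (\<Sum>F'\<in>\<F>. 1)"
    using inner tr_card_pos[OF fin] by (intro sum_mono) (simp add: divide_le_eq_1)
  finally have key: "(\<Sum>F\<in>\<F>. ?c B F * ?c (insert e A) F / (?c (insert e B) F * ?c A F)) \<le> card \<F>" by simp
  define g where "g X F = - log 2 (?c X F / card \<F>)" for X F
  have "(\<Sum>F\<in>\<F>. g (insert e B) F - g B F - (g (insert e A) F - g A F))
      \<le> (\<Sum>F\<in>\<F>. (?c B F * ?c (insert e A) F / (?c (insert e B) F * ?c A F) - 1) / ln 2)"
  proof (rule sum_mono)
    fix F assume F: "F \<in> \<F>"
    have p: "0 < ?c X F" for X using tr_card_pos[OF fin F] .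
    have "0 < card \<F>" using False fin by (simp add: card_gt_0_iff)
    then have "g (insert e B) F - g B F - (g (insert e A) F - g A F)
        = log 2 (?c B F * ?c (insert e A) F / (?c (insert e B) F * ?c A F))"
      using p by (simp add: g_def log_divide log_mult less_imp_neq[OF p, symmetric])
    also have "\<dots> \<le> (?c B F * ?c (insert e A) F / (?c (insert e B) F * ?c A F) - 1) / ln 2"
      using p by (intro log2_le) auto
    finally show "g (insert e B) F - g B F - (g (insert e A) F - g A F) \<le> \<dots>" .
  qed
  also have "\<dots> \<le> 0" using key by (simp add: sum_divide_distrib[symmetric] sum_subtractf divide_le_0_iff)
  finally have "(\<Sum>F\<in>\<F>. g (insert e B) F) - (\<Sum>F\<in>\<F>. g B F)
      \<le> (\<Sum>F\<in>\<F>. g (insert e A) F) - (\<Sum>F\<in>\<F>. g A F)" by (simp add: sum_subtractf)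
  from divide_right_mono[OF this, of "card \<F>"] show ?thesis
    by (simp add: tr_ent_def g_def diff_divide_distrib)
qed

section \<open>Counting graphs by the entropy of their samples\<close>

abbreviation pairs :: "nat \<Rightarrow> nat set set" where
  "pairs k \<equiv> vpairs {..<k}"

lemma finite_vpairs_lessThan [simp]: "finite (pairs k)"
  by (simp add: vpairs_finite)

lemma card_vpairs_lessThan: "card (pairs k) = k choose 2"
  using n_subsets[of "{..<k}" 2] by (simp add: vpairs_def)

lemma vpairs_mono: "A \<subseteq> B \<Longrightarrow> vpairs A \<subseteq> vpairs B"
  by (auto simp: vpairs_def)

abbreviation std_dens :: "nat \<Rightarrow> nat set set \<Rightarrow> nat \<Rightarrow> nat set set \<Rightarrow> real" where
  "std_dens k E n F \<equiv> lgraph_density ({..<k}, E) ({..<n}, F)"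

definition injs :: "nat \<Rightarrow> nat \<Rightarrow> (nat \<Rightarrow> nat) set" where
  "injs k n = {\<phi> \<in> {..<k} \<rightarrow>\<^sub>E {..<n}. inj_on \<phi> {..<k}}"

definition pull :: "nat \<Rightarrow> (nat \<Rightarrow> nat) \<Rightarrow> nat set set \<Rightarrow> nat set set" where
  "pull k \<phi> F = {e \<in> pairs k. \<phi> ` e \<in> F}"

lemma pull_subset: "pull k \<phi> F \<subseteq> pairs k"
  by (auto simp: pull_def)

lemma preserves_adj_iff_pull:
  assumes "E \<subseteq> pairs k"
  shows "preserves_adj ({..<k}, E) (V, F) \<phi> \<longleftrightarrow> pull k \<phi> F = E"
proof
  assume p: "preserves_adj ({..<k}, E) (V, F) \<phi>"
  have "e \<in> E \<longleftrightarrow> \<phi> ` e \<in> F" if "e \<in> pairs k" for e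
    using that p by (elim vpairsE) (auto simp: preserves_adj_def)
  then show "pull k \<phi> F = E" using assms by (auto simp: pull_def)
next
  assume p: "pull k \<phi> F = E"
  show "preserves_adj ({..<k}, E) (V, F) \<phi>" unfolding preserves_adj_def
  proof (intro ballI impI)
    fix u v assume "u \<in> verts ({..<k}, E)" "v \<in> verts ({..<k}, E)" "u \<noteq> v"
    then have "{u, v} \<in> pairs k" by (auto simp: vpairs_def)
    then show "{u, v} \<in> edges ({..<k}, E) \<longleftrightarrow> {\<phi> u, \<phi> v} \<in> edges (V, F)" using p by (auto simp: pull_def)
  qed
qed

lemma finite_injs: "finite (injs k n)"
  unfolding injs_def by (rule finite_subset[of _ "{..<k} \<rightarrow>\<^sub>E {..<n}"]) (auto intro: finite_PiE)

lemma injs_nonempty: "k \<le> n \<Longrightarrow> injs k n \<noteq> {}"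
proof -
  assume "k \<le> n"
  then have "restrict id {..<k} \<in> injs k n" by (auto simp: injs_def inj_on_def)
  then show ?thesis by blast
qed

lemma lgraph_density_eq:
  assumes E: "E \<subseteq> pairs k" and "k \<le> n"
  shows "std_dens k E n F = card {\<phi>\<in>injs k n. pull k \<phi> F = E} / card (injs k n)"
proof -
  have "inj_maps ({..<k}, E) ({..<n}, F) = injs k n" by (simp add: inj_maps_def injs_def)
  moreover have "injs k n \<inter> {\<phi>. preserves_adj ({..<k}, E) ({..<n}, F) \<phi>} = {\<phi>\<in>injs k n. pull k \<phi> F = E}"
    using preserves_adj_iff_pull[OF E] by auto
  ultimately show ?thesis
    using assms by (simp add: lgraph_density_def measure_pmf_of_set finite_injs injs_nonempty)
qed

lemma image_vpairs:
  assumes "\<phi> \<in> injs k n" "e \<in> pairs k"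
  shows "\<phi> ` e \<in> pairs n"
proof -
  have "inj_on \<phi> e" using assms by (auto simp: injs_def vpairs_def intro: inj_on_subset)
  then show ?thesis using assms by (auto simp: injs_def vpairs_def card_image)
qed

lemma inj_on_image_vpairs: "\<phi> \<in> injs k n \<Longrightarrow> inj_on ((`) \<phi>) (pairs k)"
  by (intro inj_onI) (auto simp: injs_def vpairs_def inj_on_image_eq_iff)

section \<open>Counting the injections that cover a given pair\<close>

definition pair_cover :: "nat \<Rightarrow> nat \<Rightarrow> nat set \<Rightarrow> nat" where
  "pair_cover k n e = card {\<phi>\<in>injs k n. e \<in> (`) \<phi> ` pairs k}"

text \<open>A permutation \<sigma> of \<open>{..<n}\<close> that carries \<open>e\<close> to
  \<open>e'\<close> acts injectively on injections by composition. Equality follows by exchanging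
  the two pairs.\<close>

lemma pair_cover_le:
  assumes e: "e \<in> pairs n" "e' \<in> pairs n"
  shows "pair_cover k n e \<le> pair_cover k n e'"
proof -
  have s: "e \<subseteq> {..<n}" "e' \<subseteq> {..<n}" and c: "card e = 2" "card e' = 2" using e by (auto simp: vpairs_def)
  have f: "finite e" "finite e'" using s finite_subset by auto
  obtain f where f1: "bij_betw f e e'" using finite_same_card_bij[OF f] c by auto
  obtain g where g1: "bij_betw g ({..<n} - e) ({..<n} - e')"
    using finite_same_card_bij[of "{..<n} - e" "{..<n} - e'"] s c f by (auto simp: card_Diff_subset)
  define \<sigma> where "\<sigma> x = (if x \<in> e then f x else g x)" for x
  have "bij_betw \<sigma> e e'" using f1 by (rule bij_betw_cong[THEN iffD1, rotated]) (simp add: \<sigma>_def)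
  moreover have "bij_betw \<sigma> ({..<n} - e) ({..<n} - e')"
    using g1 by (rule bij_betw_cong[THEN iffD1, rotated]) (simp add: \<sigma>_def)
  ultimately have "bij_betw \<sigma> (e \<union> ({..<n} - e)) (e' \<union> ({..<n} - e'))" by (rule bij_betw_combine) auto
  then have \<sigma>: "bij_betw \<sigma> {..<n} {..<n}" using s by (simp add: Un_absorb1)
  have \<sigma>e: "\<sigma> ` e = e'" using f1 by (auto simp: \<sigma>_def bij_betw_def)
  define T where "T \<phi> = (\<lambda>x\<in>{..<k}. \<sigma> (\<phi> x))" for \<phi> :: "nat \<Rightarrow> nat"
  show ?thesis unfolding pair_cover_def
  proof (rule card_inj_on_le[where f = T])
    show "inj_on T {\<phi>\<in>injs k n. e \<in> (`) \<phi> ` pairs k}"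
    proof (rule inj_onI)
      fix \<phi> \<psi> assume p: "\<phi> \<in> {\<phi>\<in>injs k n. e \<in> (`) \<phi> ` pairs k}"
        "\<psi> \<in> {\<phi>\<in>injs k n. e \<in> (`) \<phi> ` pairs k}" and t: "T \<phi> = T \<psi>"
      have "\<phi> x = \<psi> x" if "x < k" for x
      proof -
        have "\<sigma> (\<phi> x) = \<sigma> (\<psi> x)" using fun_cong[OF t, of x] that by (simp add: T_def)
        moreover have "\<phi> x \<in> {..<n}" "\<psi> x \<in> {..<n}" using p that by (auto simp: injs_def)
        ultimately show ?thesis using \<sigma> by (auto simp: bij_betw_def dest: inj_onD)
      qed
      then show "\<phi> = \<psi>" using p by (auto simp: injs_def intro: PiE_ext)
    qed
    show "T ` {\<phi>\<in>injs k n. e \<in> (`) \<phi> ` pairs k} \<subseteq> {\<phi>\<in>injs k n. e' \<in> (`) \<phi> ` pairs k}"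
    proof clarify
      fix \<phi> d assume p: "\<phi> \<in> injs k n" and d: "d \<in> pairs k" and ed: "e = \<phi> ` d"
      have m: "\<phi> x \<in> {..<n}" if "x < k" for x using p that by (auto simp: injs_def)
      have "\<phi> ` {..<k} \<subseteq> {..<n}" using m by auto
      with bij_betw_imp_inj_on[OF \<sigma>] have "inj_on \<sigma> (\<phi> ` {..<k})" by (rule inj_on_subset)
      then have "inj_on (\<sigma> \<circ> \<phi>) {..<k}" using p by (intro comp_inj_on) (auto simp: injs_def)
      then have "inj_on (T \<phi>) {..<k}" by (auto simp: T_def inj_on_def)
      moreover have "\<sigma> (\<phi> x) \<in> {..<n}" if "x < k" for x using m[OF that] \<sigma> bij_betwE by blast
      ultimately have "T \<phi> \<in> injs k n" by (auto simp: injs_def T_def)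
      moreover have "T \<phi> ` d = \<sigma> ` e"
        unfolding ed image_image using d by (intro image_cong refl) (auto simp: T_def vpairs_def)
      ultimately show "T \<phi> \<in> injs k n \<and> e' \<in> (`) (T \<phi>) ` pairs k" using d \<sigma>e by blast
    qed
  qed (simp add: finite_injs)
qed

text \<open>Double counting of injections together with the pairs they cover: each injection covers
  \<open>k choose 2\<close> pairs, and every pair is covered equally often.\<close>

lemma pair_cover:
  assumes e: "e \<in> pairs n"
  shows "pair_cover k n e * (n choose 2) = card (injs k n) * (k choose 2)"
proof -
  have "(\<Sum>e'\<in>pairs n. pair_cover k n e') = (\<Sum>e'\<in>pairs n. pair_cover k n e)"
    using e by (intro sum.cong refl antisym pair_cover_le)
  then have "pair_cover k n e * (n choose 2) = (\<Sum>e'\<in>pairs n. pair_cover k n e')"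
    by (simp add: card_vpairs_lessThan)
  also have "\<dots> = (\<Sum>e'\<in>pairs n. \<Sum>\<phi>\<in>injs k n. if e' \<in> (`) \<phi> ` pairs k then 1 else 0)"
    unfolding pair_cover_def by (simp add: finite_injs sum.If_cases Int_def)
  also have "\<dots> = (\<Sum>\<phi>\<in>injs k n. \<Sum>e'\<in>pairs n. if e' \<in> (`) \<phi> ` pairs k then 1 else 0)" by (rule sum.swap)
  also have "\<dots> = (\<Sum>\<phi>\<in>injs k n. k choose 2)"
  proof (rule sum.cong[OF refl])
    fix \<phi> assume p: "\<phi> \<in> injs k n"
    have "(\<Sum>e'\<in>pairs n. if e' \<in> (`) \<phi> ` pairs k then 1 else 0) = (\<Sum>e'\<in>(`) \<phi> ` pairs k. 1)"
      using image_vpairs[OF p] by (intro sum.mono_neutral_cong_right) auto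
    also have "\<dots> = card (pairs k)" using card_image[OF inj_on_image_vpairs[OF p]] by simp
    finally show "(\<Sum>e'\<in>pairs n. if e' \<in> (`) \<phi> ` pairs k then 1 else 0) = (k choose 2)"
      by (simp add: card_vpairs_lessThan)
  qed
  finally show ?thesis by simp
qed

text \<open>The trace on the image of the pairs and the pulled back graph determine each other, so
  the trace entropy is the entropy of the pulled back graph of a random member.\<close>

lemma tr_ent_pull:
  assumes fin: "finite \<F>" "\<F> \<noteq> {}"
  shows "tr_ent \<F> ((`) \<phi> ` pairs k)
    = (\<Sum>E\<in>Pow (pairs k). eta (card {F\<in>\<F>. pull k \<phi> F = E} / card \<F>))"
proof -
  have iff: "F' \<inter> (`) \<phi> ` pairs k = F \<inter> (`) \<phi> ` pairs k \<longleftrightarrow> pull k \<phi> F' = pull k \<phi> F" for F F'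
    by (auto simp: pull_def set_eq_iff)
  have "tr_ent \<F> ((`) \<phi> ` pairs k)
    = (\<Sum>F\<in>\<F>. - log 2 (card {F'\<in>\<F>. pull k \<phi> F' = pull k \<phi> F} / card \<F>)) / card \<F>"
    by (simp add: tr_ent_def tr_card_def iff)
  also have "(\<Sum>F\<in>\<F>. - log 2 (card {F'\<in>\<F>. pull k \<phi> F' = pull k \<phi> F} / card \<F>))
    = (\<Sum>E\<in>Pow (pairs k). \<Sum>F\<in>{F\<in>\<F>. pull k \<phi> F = E}. - log 2 (card {F'\<in>\<F>. pull k \<phi> F' = pull k \<phi> F} / card \<F>))"
    using fin pull_subset by (intro sum.group[symmetric]) auto
  also have "\<dots> = (\<Sum>E\<in>Pow (pairs k). card {F\<in>\<F>. pull k \<phi> F = E} * - log 2 (card {F\<in>\<F>. pull k \<phi> F = E} / card \<F>))"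
    by (intro sum.cong) auto
  finally show ?thesis by (simp add: sum_divide_distrib eta_def)
qed

text \<open>Shearer's inequality is applied to the traces on the images of the pairs of \<open>{..<k}\<close> under all
  injections, and the concavity of \<open>eta\<close> then moves the average over the injections inside.\<close>

lemma log_card_le_sample_entropy:
  assumes F: "\<F> \<subseteq> Pow (pairs n)" "\<F> \<noteq> {}" and k: "2 \<le> k" "k \<le> n"
  shows "real (k choose 2) * log 2 (card \<F>) \<le> real (n choose 2) *
    (\<Sum>E\<in>Pow (pairs k). eta ((\<Sum>F\<in>\<F>. std_dens k E n F) / card \<F>))"
proof -
  let ?A = "\<lambda>\<phi>. (`) \<phi> ` pairs k" and ?I = "injs k n"
  have fin: "finite \<F>" using F(1) by (rule finite_subset) simp
  have I0: "0 < card ?I" using injs_nonempty[OF k(2)] finite_injs by (simp add: card_gt_0_iff)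
  have "{0, 1} \<in> pairs n" using k by (auto simp: vpairs_def)
  then obtain e0 where e0: "e0 \<in> pairs n" by blast
  define N where "N = pair_cover k n e0"
  have N: "real N * real (n choose 2) = card ?I * real (k choose 2)"
    using pair_cover[OF e0] unfolding N_def by (metis of_nat_mult)
  have "real N * tr_ent \<F> (pairs n) \<le> (\<Sum>\<phi>\<in>?I. tr_ent \<F> (?A \<phi>))"
  proof (rule shearer)
    show "card {\<phi>\<in>?I. e \<in> ?A \<phi>} = N" if "e \<in> pairs n" for e
      using antisym[OF pair_cover_le[OF that e0] pair_cover_le[OF e0 that]]
      by (simp add: N_def pair_cover_def)
  qed (use fin image_vpairs tr_ent_submodular tr_ent_empty finite_injs in auto)
  also have "\<dots> = (\<Sum>E\<in>Pow (pairs k). \<Sum>\<phi>\<in>?I. eta (card {F\<in>\<F>. pull k \<phi> F = E} / card \<F>))"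
    by (subst sum.swap) (simp add: tr_ent_pull fin F)
  also have "\<dots> = card ?I * (\<Sum>E\<in>Pow (pairs k). (\<Sum>\<phi>\<in>?I. eta (card {F\<in>\<F>. pull k \<phi> F = E} / card \<F>)) / card ?I)"
    using I0 by (simp add: sum_divide_distrib[symmetric])
  also have "\<dots> \<le> card ?I * (\<Sum>E\<in>Pow (pairs k). eta ((\<Sum>\<phi>\<in>?I. card {F\<in>\<F>. pull k \<phi> F = E} / card \<F>) / card ?I))"
    using I0 by (intro mult_left_mono sum_mono eta_jensen_avg) (auto simp: finite_injs)
  also have "(\<Sum>E\<in>Pow (pairs k). eta ((\<Sum>\<phi>\<in>?I. card {F\<in>\<F>. pull k \<phi> F = E} / card \<F>) / card ?I))
    = (\<Sum>E\<in>Pow (pairs k). eta ((\<Sum>F\<in>\<F>. std_dens k E n F) / card \<F>))"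
  proof (intro sum.cong arg_cong[where f = eta] refl)
    fix E assume "E \<in> Pow (pairs k)"
    then have E: "E \<subseteq> pairs k" by simp
    \<comment> \<open>Choosing the injection or the family member as the inner variable counts the
      same pairs; so the mean over injections of the frequency of \<open>E\<close> is the mean over
      the family of its density.\<close>
    have "(\<Sum>\<phi>\<in>?I. real (card {F\<in>\<F>. pull k \<phi> F = E})) = (\<Sum>\<phi>\<in>?I. \<Sum>F\<in>\<F>. if pull k \<phi> F = E then 1 else 0)"
      using fin by (simp add: sum.If_cases Int_def)
    also have "\<dots> = (\<Sum>F\<in>\<F>. real (card {\<phi>\<in>?I. pull k \<phi> F = E}))"
      by (subst sum.swap) (simp add: sum.If_cases Int_def finite_injs)
    finally have "(\<Sum>\<phi>\<in>?I. real (card {F\<in>\<F>. pull k \<phi> F = E})) = (\<Sum>F\<in>\<F>. real (card {\<phi>\<in>?I. pull k \<phi> F = E}))" .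
    then show "(\<Sum>\<phi>\<in>?I. card {F\<in>\<F>. pull k \<phi> F = E} / card \<F>) / card ?I
      = (\<Sum>F\<in>\<F>. std_dens k E n F) / card \<F>"
      by (simp add: lgraph_density_eq[OF E k(2)] sum_divide_distrib[symmetric] mult.commute)
  qed
  also have "tr_ent \<F> (pairs n) = log 2 (card \<F>)" using F(1) by (intro tr_ent_all fin F(2)) blast
  finally have *: "real N * log 2 (card \<F>) \<le> card ?I *
    (\<Sum>E\<in>Pow (pairs k). eta ((\<Sum>F\<in>\<F>. std_dens k E n F) / card \<F>))" (is "_ \<le> _ * ?R") .
  have "card ?I * (real (k choose 2) * log 2 (card \<F>)) = real N * log 2 (card \<F>) * real (n choose 2)"
    using N by simp
  also have "\<dots> \<le> card ?I * ?R * real (n choose 2)" using * by (rule mult_right_mono) simp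
  finally have "card ?I * (real (k choose 2) * log 2 (card \<F>)) \<le> card ?I * (real (n choose 2) * ?R)"
    by (simp add: mult_ac)
  then show ?thesis using I0 by simp
qed

section \<open>Labelled representatives of isomorphism classes\<close>

lemma ugraph_cases:
  fixes U :: ugraph
  obtains G where "is_graph G" "U = abs_ugraph G"
  using Quotient_abs_rep[OF Quotient_ugraph, of U] Quotient_rep_reflp[OF Quotient_ugraph, of U]
  by (metis graph_equiv_def)

lemma graph_equiv_refl: "is_graph G \<Longrightarrow> graph_equiv G G"
  by (simp add: graph_equiv_def isomorphic_refl)

lemma isomorphic_relabel:
  assumes G: "is_graph G" and f: "bij_betw f (verts G) V" and V: "finite V"
  shows "graph_equiv G (V, (`) f ` edges G)"
proof -
  have inj: "inj_on f (verts G)" and im: "f ` verts G = V" using f by (auto simp: bij_betw_def)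
  have sub: "edges G \<subseteq> vpairs (verts G)" using G by (simp add: is_graph_def)
  have "(`) f ` edges G \<subseteq> vpairs V"
  proof
    fix e' assume "e' \<in> (`) f ` edges G"
    then obtain e where e: "e \<in> edges G" "e' = f ` e" by blast
    then have "e \<subseteq> verts G" "card e = 2" using sub by (auto simp: vpairs_def)
    moreover from this have "card (f ` e) = 2" using inj by (metis card_image inj_on_subset)
    ultimately show "e' \<in> vpairs V" using e(2) im by (auto simp: vpairs_def)
  qed
  then have "is_graph (V, (`) f ` edges G)" using G V im by (auto simp: is_graph_def)
  moreover have "preserves_adj G (V, (`) f ` edges G) f" unfolding preserves_adj_def
  proof (intro ballI impI)
    fix u v assume uv: "u \<in> verts G" "v \<in> verts G"
    have "{u, v} \<in> edges G" if m: "{f u, f v} \<in> (`) f ` edges G"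
    proof -
      obtain e where e: "{f u, f v} = f ` e" "e \<in> edges G" using m by (rule imageE)
      have "e \<subseteq> verts G" using e sub by (auto simp: vpairs_def)
      then have "{u, v} = e" using e(1) inj_on_image_eq_iff[OF inj, of "{u, v}" e] uv by auto
      then show ?thesis using e by simp
    qed
    moreover have "{f u, f v} \<in> (`) f ` edges G" if "{u, v} \<in> edges G"
      using imageI[OF that, of "(`) f"] by simp
    ultimately show "{u, v} \<in> edges G \<longleftrightarrow> {f u, f v} \<in> edges (V, (`) f ` edges G)" by auto
  qed
  ultimately show ?thesis using f G unfolding graph_equiv_def isomorphic_def by auto
qed

lemma ugraph_standard:
  fixes U :: ugraph
  obtains F where "F \<subseteq> vpairs {..<graph_order U}" "0 < graph_order U" "U = abs_ugraph ({..<graph_order U}, F)"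
proof -
  obtain G where G: "is_graph G" and UG: "U = abs_ugraph G" by (rule ugraph_cases)
  have o: "graph_order U = card (verts G)"
    using UG graph_order.abs_eq[OF graph_equiv_refl[OF G]] by simp
  obtain f where f: "bij_betw f (verts G) {..<graph_order U}"
    using G o unfolding is_graph_def by (metis bij_betw_iff_card card_lessThan finite_lessThan)
  have e: "graph_equiv G ({..<graph_order U}, (`) f ` edges G)" using isomorphic_relabel[OF G f] by simp
  then have "U = abs_ugraph ({..<graph_order U}, (`) f ` edges G)"
    using UG Quotient_rel_abs[OF Quotient_ugraph] by blast
  moreover have "(`) f ` edges G \<subseteq> vpairs {..<graph_order U}"
    using e by (simp add: graph_equiv_def is_graph_def)
  moreover have "0 < graph_order U" using o G by (simp add: is_graph_def card_gt_0_iff)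
  ultimately show ?thesis by (rule that[rotated 2])
qed

abbreviation std_graph :: "nat \<Rightarrow> nat set set \<Rightarrow> ugraph" where
  "std_graph k E \<equiv> abs_ugraph ({..<k}, E)"

lemma is_graph_std: "0 < k \<Longrightarrow> E \<subseteq> pairs k \<Longrightarrow> is_graph ({..<k}, E)"
  by (auto simp: is_graph_def)

lemma ind_density_std:
  assumes "0 < k" "E \<subseteq> pairs k" "0 < n" "F \<subseteq> pairs n"
  shows "ind_density (std_graph k E) (std_graph n F) = std_dens k E n F"
  using assms by (intro ind_density.abs_eq graph_equiv_refl is_graph_std)

lemma ind_density_bounds: "0 \<le> ind_density H G" "ind_density H G \<le> 1"
proof -
  have "0 \<le> lgraph_density A B \<and> lgraph_density A B \<le> 1" for A B by (simp add: lgraph_density_def)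
  then show "0 \<le> ind_density H G" "ind_density H G \<le> 1"
    using ugraph_cases[of H] ugraph_cases[of G] ind_density.abs_eq graph_equiv_refl by metis+
qed

text \<open>The entropy of the subgraph of \<open>G\<close> induced by \<open>k\<close> random vertices.\<close>

definition ind_ent :: "nat \<Rightarrow> ugraph \<Rightarrow> real" where
  "ind_ent k G = (\<Sum>E\<in>Pow (pairs k). eta (ind_density (std_graph k E) G))"

text \<open>The class is split into boundedly many cells on which all sample densities are almost
  constant, so that the mean densities of a largest cell are close to those of any of its members.\<close>

lemma exists_graph_large_ind_ent:
  assumes \<epsilon>: "0 < \<epsilon>"
  obtains K :: nat where "0 < K"
    and "\<And>n \<X>. k \<le> n \<Longrightarrow> \<X> \<subseteq> {G. graph_order G = n} \<Longrightarrow> \<X> \<noteq> {} \<Longrightarrow>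
      \<exists>G\<in>\<X>. \<forall>j\<in>{2..k}. real (j choose 2) * log 2 (card \<X>)
        \<le> real (n choose 2) * (ind_ent j G + \<epsilon>) + real (j choose 2) * log 2 K"
proof -
  \<comment> \<open>\<open>c\<close> bounds the number of labelled graphs \<open>E\<close> for each
    sample size up to \<open>k\<close>; an error of \<open>\<epsilon> / c\<close> in each value of
    \<open>eta\<close> therefore totals at most \<epsilon>.\<close>
  define c where "c = card (Pow (pairs k))"
  have c0: "0 < c" by (simp add: c_def card_Pow)
  have "uniformly_continuous_on {0..1} eta"
    by (intro compact_uniformly_continuous continuous_on_subset[OF continuous_on_eta]) auto
  then obtain \<rho> where \<rho>: "0 < \<rho>" and
    uc: "\<And>x y. x \<in> {0..1} \<Longrightarrow> y \<in> {0..1} \<Longrightarrow> \<bar>x - y\<bar> < \<rho> \<Longrightarrow> \<bar>eta x - eta y\<bar> < \<epsilon> / c"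
    unfolding uniformly_continuous_on_def dist_real_def using \<epsilon> c0
    by (metis divide_pos_pos of_nat_0_less_iff)
  obtain m :: nat where m: "0 < m" "1 / real m < \<rho>" using \<rho>
    by (metis nat_approx_posE of_nat_0_less_iff zero_less_Suc)
  define J where "J = (SIGMA j:{2..k}. Pow (pairs j))"
  define p where "p \<iota> G = ind_density (std_graph (fst \<iota>) (snd \<iota>)) G" for \<iota> G
  \<comment> \<open>Every density is rounded down to a multiple of \<open>1 / m\<close>. The set
    \<open>C\<close> of possible cells depends on \<open>k\<close> and \<epsilon> alone, which makes
    its size an admissible \<open>K\<close>.\<close>
  define cell where "cell G = (\<lambda>\<iota>\<in>J. nat \<lfloor>p \<iota> G * m\<rfloor>)" for G
  define C where "C = (J \<rightarrow>\<^sub>E {..m})"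
  have finJ: "finite J" by (simp add: J_def)
  have finC: "finite C" by (simp add: C_def finJ finite_PiE)
  have C0: "C \<noteq> {}" by (simp add: C_def PiE_eq_empty_iff)
  have cell: "cell G \<in> C" for G
  proof -
    have "nat \<lfloor>p \<iota> G * m\<rfloor> \<le> m" for \<iota>
    proof -
      have "p \<iota> G * m \<le> 1 * real m" by (rule mult_right_mono) (auto simp: p_def ind_density_bounds)
      then show ?thesis by linarith
    qed
    then show ?thesis by (auto simp: cell_def C_def)
  qed
  have close: "\<bar>p \<iota> G - p \<iota> G'\<bar> \<le> 1 / m" if "cell G = cell G'" "\<iota> \<in> J" for G G' \<iota>
  proof -
    have "nat \<lfloor>p \<iota> G * m\<rfloor> = nat \<lfloor>p \<iota> G' * m\<rfloor>"
      using fun_cong[OF that(1), of \<iota>] that(2) by (simp add: cell_def)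
    moreover have "0 \<le> \<lfloor>p \<iota> G * m\<rfloor>" "0 \<le> \<lfloor>p \<iota> G' * m\<rfloor>" by (auto simp: p_def ind_density_bounds)
    ultimately have "\<lfloor>p \<iota> G * m\<rfloor> = \<lfloor>p \<iota> G' * m\<rfloor>" by linarith
    then have "\<bar>p \<iota> G * m - p \<iota> G' * m\<bar> \<le> 1" by linarith
    moreover have "\<bar>p \<iota> G * m - p \<iota> G' * m\<bar> = \<bar>p \<iota> G - p \<iota> G'\<bar> * m"
      by (simp add: left_diff_distrib[symmetric] abs_mult)
    ultimately show ?thesis using m by (simp add: field_simps)
  qed
  show ?thesis
  proof (rule that)
    show "0 < card C" using finC C0 by (simp add: card_gt_0_iff)
    fix n \<X> assume kn: "k \<le> n" and X: "\<X> \<subseteq> {G. graph_order G = n}" "\<X> \<noteq> {}"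
    have finX: "finite \<X>" using X(1) finite_order by (rule finite_subset)
    have "\<exists>y\<in>C. card (cell -` {y} \<inter> \<X>) * card C \<ge> card \<X>"
      using pigeonhole_card[of cell \<X> C] finX finC C0 cell by auto
    then obtain y where y: "card (cell -` {y} \<inter> \<X>) * card C \<ge> card \<X>" by blast
    define \<Y> where "\<Y> = cell -` {y} \<inter> \<X>"
    have finY: "finite \<Y>" using finX by (simp add: \<Y>_def)
    have X0: "0 < card \<X>" using finX X(2) by (simp add: card_gt_0_iff)
    then have Y0: "0 < card \<Y>" using y \<Y>_def by (cases "card \<Y> = 0") auto
    then obtain G where G: "G \<in> \<Y>" by (auto simp: card_gt_0_iff)
    have GX: "G \<in> \<X>" using G by (simp add: \<Y>_def)
    have "\<exists>F. F \<subseteq> pairs n \<and> 0 < n \<and> H = std_graph n F" if "H \<in> \<Y>" for H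
    proof -
      have "graph_order H = n" using that X by (auto simp: \<Y>_def)
      then show ?thesis using ugraph_standard[of H] by metis
    qed
    then have "\<forall>H\<in>\<Y>. \<exists>F. F \<subseteq> pairs n \<and> 0 < n \<and> H = std_graph n F" by blast
    \<comment> \<open>\<open>R\<close> picks one labelled graph per isomorphism class and
      \<open>std_graph n\<close> inverts it, so the labelled family has as many members as the
      cell.\<close>
    from bchoice[OF this] obtain R where R': "\<forall>H\<in>\<Y>. R H \<subseteq> pairs n \<and> 0 < n \<and> H = std_graph n (R H)" ..
    then have R: "\<And>H. H \<in> \<Y> \<Longrightarrow> R H \<subseteq> pairs n" "\<And>H. H \<in> \<Y> \<Longrightarrow> H = std_graph n (R H)"
      and n0: "0 < n" using G by blast+
    have injR: "inj_on R \<Y>" by (rule inj_on_inverseI[of _ "std_graph n"]) (rule R(2)[symmetric])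
    show "\<exists>G\<in>\<X>. \<forall>j\<in>{2..k}. real (j choose 2) * log 2 (card \<X>)
        \<le> real (n choose 2) * (ind_ent j G + \<epsilon>) + real (j choose 2) * log 2 (card C)"
    proof (intro bexI[OF _ GX] ballI)
      fix j assume j: "j \<in> {2..k}"
      let ?P = "Pow (pairs j)"
      define a where "a E = (\<Sum>H\<in>\<Y>. ind_density (std_graph j E) H) / card \<Y>" for E
      have "real (j choose 2) * log 2 (card (R ` \<Y>)) \<le> real (n choose 2) *
        (\<Sum>E\<in>?P. eta ((\<Sum>F\<in>R ` \<Y>. std_dens j E n F) / card (R ` \<Y>)))"
        using R G j kn by (intro log_card_le_sample_entropy) auto
      also have "(\<Sum>E\<in>?P. eta ((\<Sum>F\<in>R ` \<Y>. std_dens j E n F) / card (R ` \<Y>)))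
        = (\<Sum>E\<in>?P. eta (a E))"
      proof (rule sum.cong[OF refl])
        fix E assume E: "E \<in> ?P"
        have "(\<Sum>F\<in>R ` \<Y>. std_dens j E n F) = (\<Sum>H\<in>\<Y>. std_dens j E n (R H))"
          using injR by (simp add: sum.reindex)
        also have "\<dots> = (\<Sum>H\<in>\<Y>. ind_density (std_graph j E) H)"
        proof (rule sum.cong[OF refl])
          fix H assume H: "H \<in> \<Y>"
          have "ind_density (std_graph j E) (std_graph n (R H)) = std_dens j E n (R H)"
            using E j n0 R(1)[OF H] by (intro ind_density_std) auto
          then show "std_dens j E n (R H) = ind_density (std_graph j E) H" using R(2)[OF H] by simp
        qed
        finally show "eta ((\<Sum>F\<in>R ` \<Y>. std_dens j E n F) / card (R ` \<Y>)) = eta (a E)"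
          using injR by (simp add: a_def card_image)
      qed
      also have "\<dots> \<le> ind_ent j G + \<epsilon>"
      proof -
        have "(\<Sum>E\<in>?P. eta (a E)) \<le> (\<Sum>E\<in>?P. eta (ind_density (std_graph j E) G) + \<epsilon> / c)"
        proof (rule sum_mono)
          fix E assume E: "E \<in> ?P"
          have "\<bar>(\<Sum>H\<in>\<Y>. ind_density (std_graph j E) H - ind_density (std_graph j E) G)\<bar>
            \<le> (\<Sum>H\<in>\<Y>. 1 / m)" using close[of _ G "(j, E)"] G j E
            by (intro order_trans[OF sum_abs] sum_mono) (auto simp: \<Y>_def p_def J_def)
          then have "\<bar>a E - ind_density (std_graph j E) G\<bar> \<le> 1 / m"
            using Y0 by (simp add: a_def sum_subtractf field_simps abs_le_iff)
          moreover have "0 \<le> a E" by (auto simp: a_def intro!: divide_nonneg_nonneg sum_nonneg ind_density_bounds)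
          moreover have "(\<Sum>H\<in>\<Y>. ind_density (std_graph j E) H) \<le> (\<Sum>H\<in>\<Y>. 1)"
            by (intro sum_mono ind_density_bounds)
          then have "a E \<le> 1" using Y0 by (simp add: a_def)
          ultimately have "\<bar>eta (a E) - eta (ind_density (std_graph j E) G)\<bar> < \<epsilon> / c"
            using m by (intro uc) (auto simp: ind_density_bounds)
          then show "eta (a E) \<le> eta (ind_density (std_graph j E) G) + \<epsilon> / c" by linarith
        qed
        also have "\<dots> = ind_ent j G + card ?P * (\<epsilon> / c)" by (simp add: sum.distrib ind_ent_def)
        also have "card ?P \<le> c" using j unfolding c_def by (intro card_mono Pow_mono vpairs_mono) auto
        then have "card ?P * (\<epsilon> / c) \<le> c * (\<epsilon> / c)" using \<epsilon> by (intro mult_right_mono) auto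
        then have "card ?P * (\<epsilon> / c) \<le> \<epsilon>" using c0 by simp
        finally show ?thesis by simp
      qed
      finally have "real (j choose 2) * log 2 (card \<Y>) \<le> real (n choose 2) * (ind_ent j G + \<epsilon>)"
        using injR by (simp add: card_image mult_left_mono)
      moreover have "log 2 (card \<X>) \<le> log 2 (card \<Y>) + log 2 (card C)"
      proof -
        have "real (card \<X>) \<le> real (card \<Y>) * real (card C)"
          using y unfolding \<Y>_def by (metis of_nat_le_iff of_nat_mult)
        moreover have "0 < card C" using finC C0 by (simp add: card_gt_0_iff)
        ultimately have "log 2 (card \<X>) \<le> log 2 (real (card \<Y>) * real (card C))"
          using X0 Y0 by (subst log_le_cancel_iff) auto
        also have "\<dots> = log 2 (card \<Y>) + log 2 (card C)" using Y0 \<open>0 < card C\<close> by (simp add: log_mult)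
        finally show ?thesis .
      qed
      then have "real (j choose 2) * log 2 (card \<X>) \<le> real (j choose 2) * (log 2 (card \<Y>) + log 2 (card C))"
        by (rule mult_left_mono) simp
      ultimately show "real (j choose 2) * log 2 (card \<X>)
        \<le> real (n choose 2) * (ind_ent j G + \<epsilon>) + real (j choose 2) * log 2 (card C)"
        by (simp add: algebra_simps)
    qed
  qed
qed

section \<open>Step functions on product spaces\<close>

abbreviation square :: "'a measure \<Rightarrow> ('a \<times> 'a) measure" where
  "square M \<equiv> M \<Otimes>\<^sub>M M"

text \<open>A single colouring \<open>c\<close> serves both coordinates. The colours of the sampled
  points then determine all edge probabilities at once, which is what keeps the mixture in
  \<open>sample_ent_le_graphon_Ent\<close> cheap.\<close>

definition step_function :: "'a measure \<Rightarrow> ('a \<times> 'a \<Rightarrow> real) \<Rightarrow> bool" where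
  "step_function M s \<longleftrightarrow> (\<exists>N c g. c \<in> M \<rightarrow>\<^sub>M count_space UNIV \<and> (\<forall>x\<in>space M. c x < (N::nat)) \<and>
     (\<forall>x y. s (x, y) = g (c x) (c y)))"

text \<open>Both functions are constant on the classes of the common refinement, whose colours are
  the encoded pairs of colours.\<close>

lemma step_function_comb:
  assumes "step_function M s" "step_function M t"
  shows "step_function M (\<lambda>x. F (s x) (t x))"
proof -
  obtain N c g where s: "c \<in> M \<rightarrow>\<^sub>M count_space UNIV" "\<And>x. x \<in> space M \<Longrightarrow> c x < (N::nat)"
    "\<And>x y. s (x, y) = g (c x) (c y)" using assms(1) unfolding step_function_def by blast
  obtain L d h where t: "d \<in> M \<rightarrow>\<^sub>M count_space UNIV" "\<And>x. x \<in> space M \<Longrightarrow> d x < (L::nat)"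
    "\<And>x y. t (x, y) = h (d x) (d y)" using assms(2) unfolding step_function_def by blast
  define b where "b x = prod_encode (c x, d x)" for x
  define p where "p n = prod_decode n" for n
  have "b \<in> M \<rightarrow>\<^sub>M count_space UNIV" unfolding b_def using s(1) t(1) by measurable
  moreover have "b x < Suc (Max (prod_encode ` ({..<N} \<times> {..<L})))" if "x \<in> space M" for x
    unfolding b_def less_Suc_eq_le using that s(2) t(2) by (intro Max_ge) auto
  moreover have "F (s (x, y)) (t (x, y)) =
      F (g (fst (p (b x))) (fst (p (b y)))) (h (snd (p (b x))) (snd (p (b y))))" for x y
    by (simp add: b_def p_def s(3) t(3))
  ultimately show ?thesis unfolding step_function_def
    by (intro exI[of _ "Suc (Max (prod_encode ` ({..<N} \<times> {..<L})))"] exI[of _ b]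
        exI[of _ "\<lambda>m n. F (g (fst (p m)) (fst (p n))) (h (snd (p m)) (snd (p n)))"]) auto
qed

lemma step_function_const: "step_function M (\<lambda>_. r)"
  unfolding step_function_def by (intro exI[of _ 1] exI[of _ "\<lambda>_. 0"] exI[of _ "\<lambda>_ _. r"]) auto

lemma step_function_rectangle:
  assumes "A \<in> sets M" "B \<in> sets M"
  shows "step_function M (indicator (A \<times> B))"
proof -
  \<comment> \<open>The two binary digits of the colour record membership in \<open>A\<close> and in
    \<open>B\<close>.\<close>
  define c where "c x = (if x \<in> A then 1 else 0) + (if x \<in> B then 2 else (0::nat))" for x
  have "c \<in> M \<rightarrow>\<^sub>M count_space UNIV" unfolding c_def using assms by measurable
  moreover have "indicator (A \<times> B) (x, y) = (if odd (c x) \<and> 2 \<le> c y then 1 else (0::real))" for x y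
    by (auto simp: c_def indicator_def)
  moreover have "c x < 4" for x by (simp add: c_def)
  ultimately show ?thesis unfolding step_function_def
    by (intro exI[of _ 4] exI[of _ c] exI[of _ "\<lambda>m n. if odd m \<and> 2 \<le> n then 1 else 0"]) auto
qed

lemma step_function_measurable [measurable_dest]:
  assumes "step_function M s"
  shows "s \<in> borel_measurable (square M)"
proof -
  obtain N c g where s: "c \<in> M \<rightarrow>\<^sub>M count_space UNIV" "\<And>x. x \<in> space M \<Longrightarrow> c x < (N::nat)"
    "\<And>x y. s (x, y) = g (c x) (c y)" using assms(1) unfolding step_function_def by blast
  have "(\<lambda>x. (c (fst x), c (snd x))) \<in> M \<Otimes>\<^sub>M M \<rightarrow>\<^sub>M count_space UNIV" using s(1) by measurable
  then have "(\<lambda>x. case_prod g (c (fst x), c (snd x))) \<in> borel_measurable (square M)"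
    by (rule measurable_compose) simp
  moreover have "s = (\<lambda>x. case_prod g (c (fst x), c (snd x)))" using s(3) by (auto simp: fun_eq_iff)
  ultimately show ?thesis by simp
qed

lemma (in prob_space) step_function_integrable:
  assumes "step_function M s"
  shows "integrable (square M) s"
proof -
  interpret P: pair_prob_space M M ..
  obtain N c g where s: "c \<in> M \<rightarrow>\<^sub>M count_space UNIV" "\<And>x. x \<in> space M \<Longrightarrow> c x < (N::nat)"
    "\<And>x y. s (x, y) = g (c x) (c y)" using assms(1) unfolding step_function_def by blast
  have "\<bar>s (x, y)\<bar> \<le> Max ((\<lambda>(m, n). \<bar>g m n\<bar>) ` ({..<N} \<times> {..<N}))"
    if "x \<in> space M" "y \<in> space M" for x y using that s by (intro Max_ge) force+
  then show ?thesis using assms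
    by (intro P.P.integrable_const_bound[where B = "Max ((\<lambda>(m, n). \<bar>g m n\<bar>) ` ({..<N} \<times> {..<N}))"]
        AE_I2 step_function_measurable) (auto simp: space_pair_measure)
qed

section \<open>Density of the step functions in L1 of the square\<close>

abbreviation L1_dist :: "'a measure \<Rightarrow> ('a \<times> 'a \<Rightarrow> real) \<Rightarrow> ('a \<times> 'a \<Rightarrow> real) \<Rightarrow> real" where
  "L1_dist M f g \<equiv> \<integral>x. \<bar>f x - g x\<bar> \<partial>square M"

definition step_approx :: "'a measure \<Rightarrow> ('a \<times> 'a \<Rightarrow> real) \<Rightarrow> bool" where
  "step_approx M f \<longleftrightarrow> integrable (square M) f \<and>
     (\<forall>\<epsilon>>0. \<exists>s. step_function M s \<and> L1_dist M f s < \<epsilon>)"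

lemma (in prob_space) step_approx_lim:
  assumes f: "integrable (square M) f"
    and g: "\<And>\<epsilon>. 0 < \<epsilon> \<Longrightarrow> \<exists>g. step_approx M g \<and> L1_dist M f g < \<epsilon>"
  shows "step_approx M f"
  unfolding step_approx_def
proof (intro conjI allI impI f)
  fix \<epsilon> :: real assume "0 < \<epsilon>"
  then have e2: "0 < \<epsilon> / 2" by simp
  obtain g where g: "step_approx M g" "L1_dist M f g < \<epsilon> / 2" using assms(2)[OF e2] by blast
  obtain s where s: "step_function M s" "L1_dist M g s < \<epsilon> / 2"
    using g(1) e2 unfolding step_approx_def by blast
  have i: "integrable (square M) g" "integrable (square M) s"
    using g s step_function_integrable by (auto simp: step_approx_def)
  have "L1_dist M f s \<le> (\<integral>x. \<bar>f x - g x\<bar> + \<bar>g x - s x\<bar> \<partial>(square M))"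
    using i f by (intro integral_mono) auto
  also have "\<dots> = L1_dist M f g + L1_dist M g s"
    using i f by (intro Bochner_Integration.integral_add) auto
  finally show "\<exists>s. step_function M s \<and> L1_dist M f s < \<epsilon>" using s g by (intro exI[of _ s]) auto
qed

lemma (in prob_space) step_approx_dominated:
  assumes f: "integrable (square M) f" and s: "\<And>i. step_approx M (s i)"
    and lim: "\<And>x. x \<in> space (square M) \<Longrightarrow> (\<lambda>i. s i x) \<longlonglongrightarrow> f x"
    and w: "integrable (square M) w" "\<And>i x. x \<in> space (square M) \<Longrightarrow> \<bar>s i x\<bar> \<le> w x"
  shows "step_approx M f"
proof (rule step_approx_lim[OF f])
  fix \<epsilon> :: real assume e: "0 < \<epsilon>"
  have s_int: "integrable (square M) (s i)" for i using s by (simp add: step_approx_def)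
  have "(\<lambda>i. \<integral>x. \<bar>f x - s i x\<bar> \<partial>(square M)) \<longlonglongrightarrow> (\<integral>x. 0 \<partial>(square M))"
  proof (rule integral_dominated_convergence[where w = "\<lambda>x. \<bar>f x\<bar> + w x"])
    show "AE x in M \<Otimes>\<^sub>M M. (\<lambda>i. \<bar>f x - s i x\<bar>) \<longlonglongrightarrow> 0"
    proof (rule AE_I2)
      fix x assume "x \<in> space (square M)"
      from lim[OF this] show "(\<lambda>i. \<bar>f x - s i x\<bar>) \<longlonglongrightarrow> 0"
        by (intro tendsto_rabs_zero) (auto intro!: tendsto_eq_intros)
    qed
    show "AE x in M \<Otimes>\<^sub>M M. norm \<bar>f x - s i x\<bar> \<le> \<bar>f x\<bar> + w x" for i
    proof (rule AE_I2)
      fix x assume "x \<in> space (square M)"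
      from w(2)[OF this, of i] show "norm \<bar>f x - s i x\<bar> \<le> \<bar>f x\<bar> + w x" by auto
    qed
  qed (use f w s_int in auto)
  then have "\<forall>\<^sub>F i in sequentially. L1_dist M f (s i) < \<epsilon>" using e by (intro order_tendstoD(2)) auto
  then obtain i where "L1_dist M f (s i) < \<epsilon>" by (auto simp: eventually_sequentially)
  then show "\<exists>g. step_approx M g \<and> L1_dist M f g < \<epsilon>" using s by blast
qed

lemma (in prob_space) step_approx_step_function: "step_function M s \<Longrightarrow> step_approx M s"
  using step_function_integrable by (auto simp: step_approx_def intro!: exI[of _ s])

lemma (in prob_space) step_approx_add:
  assumes "step_approx M f" "step_approx M g"
  shows "step_approx M (\<lambda>x. f x + r * g x)"
  unfolding step_approx_def
proof (intro conjI allI impI)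
  have fg: "integrable (square M) f" "integrable (square M) g" using assms by (auto simp: step_approx_def)
  then show "integrable (square M) (\<lambda>x. f x + r * g x)" by simp
  fix \<epsilon> :: real assume e: "0 < \<epsilon>"
  obtain s where s: "step_function M s" "L1_dist M f s < \<epsilon> / 2"
    using assms(1) e unfolding step_approx_def by (metis half_gt_zero)
  define \<epsilon>' where "\<epsilon>' = \<epsilon> / (2 * (\<bar>r\<bar> + 1))"
  have "0 < \<epsilon>'" using e by (simp add: \<epsilon>'_def)
  then obtain t where t: "step_function M t" "L1_dist M g t < \<epsilon>'"
    using assms(2) unfolding step_approx_def by metis
  have st: "integrable (square M) s" "integrable (square M) t" using s t step_function_integrable by auto
  have "(\<integral>x. \<bar>f x + r * g x - (s x + r * t x)\<bar> \<partial>(square M))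
      \<le> (\<integral>x. \<bar>f x - s x\<bar> + \<bar>r\<bar> * \<bar>g x - t x\<bar> \<partial>(square M))"
  proof (rule integral_mono)
    fix x
    have "f x + r * g x - (s x + r * t x) = (f x - s x) + r * (g x - t x)" by (simp add: algebra_simps)
    then show "\<bar>f x + r * g x - (s x + r * t x)\<bar> \<le> \<bar>f x - s x\<bar> + \<bar>r\<bar> * \<bar>g x - t x\<bar>"
      by (metis abs_mult abs_triangle_ineq)
  qed (use fg st in auto)
  also have "\<dots> = L1_dist M f s + \<bar>r\<bar> * L1_dist M g t" using fg st by simp
  also have "\<bar>r\<bar> * L1_dist M g t \<le> (\<bar>r\<bar> + 1) * \<epsilon>'" using t by (intro mult_mono) auto
  also have "(\<bar>r\<bar> + 1) * \<epsilon>' = \<epsilon> / 2" by (simp add: \<epsilon>'_def field_simps)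
  finally show "\<exists>s. step_function M s \<and> (\<integral>x. \<bar>f x + r * g x - s x\<bar> \<partial>(square M)) < \<epsilon>"
    using s t by (intro exI[of _ "\<lambda>x. s x + r * t x"])
      (auto intro: step_function_comb[where F = "\<lambda>a b. a + r * b"])
qed

text \<open>Rectangles are stable under intersection and generate the product sigma-algebra;
  complements and disjoint countable unions preserve approximability, by linearity and dominated
  convergence.\<close>

lemma (in prob_space) step_approx_indicator:
  assumes "A \<in> sets (square M)"
  shows "step_approx M (indicator A)"
proof -
  interpret P: pair_prob_space M M ..
  have cong: "step_approx M f" if "step_approx M g" "\<And>x. x \<in> space (square M) \<Longrightarrow> f x = g x" for f g
  proof -
    have "integrable (square M) f"
      using that Bochner_Integration.integrable_cong[of "M \<Otimes>\<^sub>M M" "M \<Otimes>\<^sub>M M" f g] by (simp add: step_approx_def)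
    moreover have "L1_dist M f s = L1_dist M g s" for s
      using that by (intro Bochner_Integration.integral_cong) auto
    ultimately show ?thesis using that by (simp add: step_approx_def)
  qed
  show ?thesis
    using Int_stable_pair_measure_generator[of M M] pair_measure_closed[of M M] assms[unfolded sets_pair_measure]
  proof (induction rule: sigma_sets_induct_disjoint)
    case (basic A)
    then show ?case by (auto intro: step_approx_step_function step_function_rectangle)
  next
    case empty
    then show ?case using step_function_const[of M 0]
      by (auto intro: step_approx_step_function simp: indicator_def[abs_def])
  next
    case (compl A)
    have "step_approx M (\<lambda>x. 1 + (-1) * indicator A x)"
      by (intro step_approx_add step_approx_step_function step_function_const compl)
    then show ?case by (rule cong) (auto simp: indicator_def space_pair_measure)
  next
    case (union A)
    have A: "A i \<in> sets (square M)" for i using union(2) by (auto simp: sets_pair_measure)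
    have "step_approx M (indicator (\<Union>i<n. A i))" for n
    proof (induction n)
      case 0
      then show ?case using step_function_const[of M 0]
        by (auto intro: step_approx_step_function simp: indicator_def[abs_def])
    next
      case (Suc n)
      have "step_approx M (\<lambda>x. indicator (\<Union>i<n. A i) x + 1 * indicator (A n) x)"
        using Suc union(3) by (rule step_approx_add)
      then show ?case
      proof (rule cong)
        fix x
        have "A n \<inter> (\<Union>i<n. A i) = {}"
          using union(1) by (auto simp: disjoint_family_on_def) (metis disjoint_iff less_irrefl)
        then show "(indicator (\<Union>i<Suc n. A i) x :: real) = indicator (\<Union>i<n. A i) x + 1 * indicator (A n) x"
          by (auto simp: indicator_def lessThan_Suc)
      qed
    qed
    note fin = this
    show ?case
    proof (rule step_approx_dominated[where s = "\<lambda>n. indicator (\<Union>i<n. A i)" and w = "\<lambda>_. 1"])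
      show "integrable (square M) (indicator (\<Union>i. A i) :: _ \<Rightarrow> real)"
        using A by (intro P.P.integrable_const_bound[where B = 1]) (auto simp: indicator_def)
      show "integrable (square M) (\<lambda>_. 1 :: real)" by simp
      show "\<bar>indicator (\<Union>i<n. A i) x :: real\<bar> \<le> 1" for n x by (simp add: indicator_def)
    qed (rule fin LIMSEQ_indicator_UN)+
  qed
qed

lemma (in prob_space) step_approx_integrable:
  assumes "integrable (square M) f"
  shows "step_approx M f"
  using assms
proof (induction rule: integrable_induct)
  case (base A c)
  have "step_approx M (\<lambda>x. 0 + c * indicator A x)"
    by (intro step_approx_add step_approx_indicator base step_approx_step_function step_function_const)
  then show ?case by (simp add: mult.commute)
next
  case (add f g)
  then show ?case using step_approx_add[of f g 1] by simp
next
  case (lim f s)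
  show ?case by (rule step_approx_dominated[where w = "\<lambda>x. 2 * \<bar>f x\<bar>" and s = s]) (use lim in auto)
qed

section \<open>Bernoulli products\<close>

text \<open>The probability that a random subset of \<open>P\<close>, containing each
  \<open>e\<close> independently with probability \<open>x e\<close>, equals
  \<open>E\<close>.\<close>

definition bern :: "'a set \<Rightarrow> 'a set \<Rightarrow> ('a \<Rightarrow> real) \<Rightarrow> real" where
  "bern P E x = (\<Prod>e\<in>E. x e) * (\<Prod>e\<in>P - E. 1 - x e)"

lemma bern_sum: "finite P \<Longrightarrow> (\<Sum>E\<in>Pow P. bern P E x) = 1"
  using prod_add[of P x "\<lambda>e. 1 - x e"] by (simp add: bern_def)

lemma bern_nonneg:
  assumes "E \<subseteq> P" "\<And>e. e \<in> P \<Longrightarrow> 0 \<le> x e \<and> x e \<le> 1"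
  shows "0 \<le> bern P E x"
  using assms unfolding bern_def by (intro mult_nonneg_nonneg prod_nonneg) auto

lemma bern_le_1:
  assumes "E \<subseteq> P" "\<And>e. e \<in> P \<Longrightarrow> 0 \<le> x e \<and> x e \<le> 1"
  shows "bern P E x \<le> 1"
proof -
  have "(\<Prod>e\<in>E. x e) * (\<Prod>e\<in>P - E. 1 - x e) \<le> 1 * 1"
    using assms by (intro mult_mono prod_le_1 prod_nonneg) auto
  then show ?thesis by (simp add: bern_def)
qed

lemma bern_insert:
  assumes "finite P" "p \<notin> P" "E \<subseteq> P"
  shows "bern (insert p P) E x = (1 - x p) * bern P E x"
    and "bern (insert p P) (insert p E) x = x p * bern P E x"
proof -
  have E: "finite E" "p \<notin> E" using assms finite_subset by auto
  have "insert p P - E = insert p (P - E)" "insert p P - insert p E = P - E" using assms by auto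
  then show "bern (insert p P) E x = (1 - x p) * bern P E x"
    "bern (insert p P) (insert p E) x = x p * bern P E x" using E assms by (simp_all add: bern_def)
qed

lemma sum_Pow_insert:
  assumes "finite P" "p \<notin> P"
  shows "(\<Sum>E\<in>Pow (insert p P). g E) = (\<Sum>E\<in>Pow P. g E + g (insert p E))"
proof -
  have "inj_on (insert p) (Pow P)" using assms by (auto simp: inj_on_def)
  moreover have "Pow P \<inter> insert p ` Pow P = {}" using assms by auto
  ultimately show ?thesis
    using assms by (simp add: Pow_insert sum.union_disjoint sum.reindex sum.distrib)
qed

text \<open>The conditions that \<open>y e\<close> vanishes only with \<open>x e\<close>, and \<open>1 - y e\<close> only with \<open>1 - x e\<close>, make
  the junk value of the logarithm at 0 irrelevant.\<close>

lemma bern_cross_entropy: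
  assumes "finite P"
    and "\<And>e. e \<in> P \<Longrightarrow> (y e = 0 \<longrightarrow> x e = 0) \<and> (y e = 1 \<longrightarrow> x e = 1)"
  shows "(\<Sum>E\<in>Pow P. bern P E x * - log 2 (bern P E y))
       = (\<Sum>e\<in>P. - x e * log 2 (y e) - (1 - x e) * log 2 (1 - y e))" using assms
proof (induction P rule: finite_induct)
  case empty
  then show ?case by (simp add: bern_def)
next
  case (insert p P)
  \<comment> \<open>The logarithm of the product splits when both factors are nonzero; otherwise the
    weight in front vanishes on both sides.\<close>
  have split: "a * B * - log 2 (a' * B') = - a * log 2 a' * B + a * (B * - log 2 B')"
    if "a' = 0 \<longrightarrow> a = 0" "B' = 0 \<longrightarrow> B = 0" for a a' B B' :: real
    using that by (cases "a' = 0"; cases "B' = 0") (auto simp: log_mult algebra_simps)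
  have zero: "bern P E y = 0 \<longrightarrow> bern P E x = 0" if "E \<subseteq> P" for E
  proof -
    have "finite E" "finite (P - E)" using that insert finite_subset by auto
    then show ?thesis using insert.prems that by (auto simp: bern_def)
  qed
  have p: "y p = 0 \<longrightarrow> x p = 0" "1 - y p = 0 \<longrightarrow> 1 - x p = 0" using insert.prems by auto
  have "(\<Sum>E\<in>Pow (insert p P). bern (insert p P) E x * - log 2 (bern (insert p P) E y))
      = (\<Sum>E\<in>Pow P. (- x p * log 2 (y p) - (1 - x p) * log 2 (1 - y p)) * bern P E x
          + bern P E x * - log 2 (bern P E y))" unfolding sum_Pow_insert[OF insert.hyps]
  proof (rule sum.cong[OF refl])
    fix E assume "E \<in> Pow P"
    then have E: "E \<subseteq> P" by simp
    show "bern (insert p P) E x * - log 2 (bern (insert p P) E y)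
        + bern (insert p P) (insert p E) x * - log 2 (bern (insert p P) (insert p E) y)
      = (- x p * log 2 (y p) - (1 - x p) * log 2 (1 - y p)) * bern P E x + bern P E x * - log 2 (bern P E y)"
      unfolding bern_insert[OF insert.hyps E] split[OF p(1) zero[OF E]] split[OF p(2) zero[OF E]]
      by (simp add: algebra_simps)
  qed
  also have "\<dots> = (- x p * log 2 (y p) - (1 - x p) * log 2 (1 - y p))
      + (\<Sum>E\<in>Pow P. bern P E x * - log 2 (bern P E y))"
    using insert.hyps unfolding sum.distrib sum_distrib_left[symmetric] by (simp add: bern_sum)
  finally show ?case using insert by simp
qed

lemma bern_entropy: "finite P \<Longrightarrow> (\<Sum>E\<in>Pow P. eta (bern P E x)) = (\<Sum>e\<in>P. binary_entropy (x e))"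
  using bern_cross_entropy[of P x x] by (simp add: eta_def binary_entropy_def)

text \<open>The relative entropy is at most the \<open>\<chi>\<^sup>2\<close>-divergence.\<close>

lemma cross_entropy_le:
  assumes x: "0 \<le> x" "x \<le> 1" and y: "0 < y" "y < 1"
  shows "- x * log 2 y - (1 - x) * log 2 (1 - y) \<le> binary_entropy x + (x - y)\<^sup>2 / (y * (1 - y) * ln 2)"
proof -
  have *: "- x * log 2 y \<le> eta x + x * (x / y - 1) / ln 2" if "0 \<le> x" "0 < y" for x y :: real
  proof (cases "x = 0")
    case False
    then have "x * log 2 (x / y) \<le> x * ((x / y - 1) / ln 2)"
      using that by (intro mult_left_mono log2_le) auto
    then show ?thesis using that False by (simp add: eta_def log_divide algebra_simps)
  qed simp
  have "- x * log 2 y - (1 - x) * log 2 (1 - y)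
      \<le> binary_entropy x + (x * (x / y - 1) / ln 2 + (1 - x) * ((1 - x) / (1 - y) - 1) / ln 2)"
    using *[of x y] *[of "1 - x" "1 - y"] x y by (simp add: binary_entropy_eq_eta algebra_simps)
  also have "x * (x / y - 1) / ln 2 + (1 - x) * ((1 - x) / (1 - y) - 1) / ln 2
      = (x * (x / y - 1) + (1 - x) * ((1 - x) / (1 - y) - 1)) / ln 2" by (simp add: add_divide_distrib)
  also have "x * (x / y - 1) + (1 - x) * ((1 - x) / (1 - y) - 1) = (x - y)\<^sup>2 / (y * (1 - y))"
    using y by (simp add: field_simps power2_eq_square)
  finally show ?thesis by simp
qed

section \<open>Samples from graphons\<close>

interpretation unit: prob_space unit_measure by (rule prob_space_unit_measure)

interpretation unit_pair: pair_prob_space unit_measure unit_measure ..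

interpretation unit_prod: product_prob_space "\<lambda>_. unit_measure" I for I :: "nat set" ..

abbreviation unit2 :: "(real \<times> real) measure" where
  "unit2 \<equiv> unit_measure \<Otimes>\<^sub>M unit_measure"

abbreviation cube :: "nat set \<Rightarrow> (nat \<Rightarrow> real) measure" where
  "cube V \<equiv> (\<Pi>\<^sub>M u\<in>V. unit_measure)"

section \<open>Marginals of independent uniform points\<close>

lemma prob_space_cube: "prob_space (cube V)"
  by (rule prob_space_PiM) (rule prob_space_unit_measure)

lemma space_cubeD: "X \<in> space (cube V) \<Longrightarrow> u \<in> V \<Longrightarrow> X u \<in> {0..1}"
  by (auto simp: space_PiM space_unit_measure)

lemma pair_measurable_cube [measurable]:
  assumes "u \<in> V" "v \<in> V"
  shows "(\<lambda>X. (X u, X v)) \<in> cube V \<rightarrow>\<^sub>M unit2"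
  using assms by (intro measurable_Pair measurable_component_singleton)

text \<open>It suffices to compare rectangles. The preimage of a rectangle is a box, and the
  coordinates other than \<open>u\<close> and \<open>v\<close> contribute factors 1.\<close>

lemma distr_cube_pair:
  assumes V: "finite V" and uv: "u \<in> V" "v \<in> V" "u \<noteq> v"
  shows "distr (cube V) unit2 (\<lambda>X. (X u, X v)) = unit2"
proof (rule pair_measure_eqI[symmetric])
  fix A B assume A: "A \<in> sets unit_measure" and B: "B \<in> sets unit_measure"
  define S where "S i = (if i = u then A else if i = v then B else space unit_measure)" for i
  have sp: "A \<subseteq> space unit_measure" "B \<subseteq> space unit_measure" using A B sets.sets_into_space by blast+
  have "(\<lambda>X. (X u, X v)) -` (A \<times> B) \<inter> space (cube V) = Pi\<^sub>E V S"
    using uv sp by (auto simp: space_PiM S_def PiE_iff split: if_splits) blast+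
  then have "emeasure (distr (cube V) unit2 (\<lambda>X. (X u, X v))) (A \<times> B) = emeasure (cube V) (Pi\<^sub>E V S)"
    using A B uv by (subst emeasure_distr) (auto intro: pair_measurable_cube)
  also have "\<dots> = (\<Prod>i\<in>V. emeasure unit_measure (S i))"
    using V A B by (intro unit_prod.emeasure_PiM) (auto simp: S_def)
  also have "\<dots> = (\<Prod>i\<in>{u, v}. emeasure unit_measure (S i))"
    using V uv by (intro prod.mono_neutral_right) (auto simp: S_def unit.emeasure_space_1)
  also have "\<dots> = emeasure unit_measure A * emeasure unit_measure B" using uv by (simp add: S_def)
  finally show "emeasure unit_measure A * emeasure unit_measure B
    = emeasure (distr (cube V) unit2 (\<lambda>X. (X u, X v))) (A \<times> B)" by simp
qed (auto intro: unit.sigma_finite_measure_axioms)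

lemma integral_cube_pair:
  fixes f :: "real \<times> real \<Rightarrow> real"
  assumes "finite V" "u \<in> V" "v \<in> V" "u \<noteq> v" "f \<in> borel_measurable unit2"
  shows "(\<integral>X. f (X u, X v) \<partial>cube V) = (\<integral>z. f z \<partial>unit2)"
  using integral_distr[of "\<lambda>X. (X u, X v)" "cube V" unit2 f] assms distr_cube_pair[of V u v]
  by (simp add: pair_measurable_cube)

lemma integrable_cube_pair:
  fixes f :: "real \<times> real \<Rightarrow> real"
  assumes "finite V" "u \<in> V" "v \<in> V" "u \<noteq> v" "integrable unit2 f"
  shows "integrable (cube V) (\<lambda>X. f (X u, X v))"
  using integrable_distr[of "\<lambda>X. (X u, X v)" "cube V" unit2 f] assms distr_cube_pair[of V u v]
  by (simp add: pair_measurable_cube)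

lemma AE_cube_pair:
  assumes "finite V" "u \<in> V" "v \<in> V" "u \<noteq> v" "AE z in unit2. P z"
  shows "AE X in cube V. P (X u, X v)"
proof (rule AE_distrD[OF pair_measurable_cube[OF assms(2,3)]])
  show "AE z in distr (cube V) unit2 (\<lambda>X. (X u, X v)). P z"
    unfolding distr_cube_pair[OF assms(1-4)] by (rule assms(5))
qed

lemma vpairs_Min_Max:
  assumes "e \<in> vpairs V"
  shows "Min e \<in> V" "Max e \<in> V" "Min e \<noteq> Max e"
  using assms by (auto elim!: vpairsE)

lemma graphon_measurable: "graphon W \<Longrightarrow> case_prod W \<in> borel_measurable unit2"
  by (simp add: graphon_def)

lemma graphon_bounds: "graphon W \<Longrightarrow> z \<in> space unit2 \<Longrightarrow> 0 \<le> case_prod W z \<and> case_prod W z \<le> 1"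
  by (auto simp: graphon_def space_pair_measure space_unit_measure)

lemma integrable_unit2_bounded:
  fixes f :: "real \<times> real \<Rightarrow> real"
  assumes "f \<in> borel_measurable unit2" "\<And>z. z \<in> space unit2 \<Longrightarrow> \<bar>f z\<bar> \<le> B"
  shows "integrable unit2 f"
  using assms by (intro unit_pair.P.integrable_const_bound[where B = B]) auto

lemma binary_entropy_measurable [measurable]: "binary_entropy \<in> borel_measurable borel"
  unfolding binary_entropy_def by measurable

lemma integrable_binary_entropy_graphon:
  assumes "graphon W"
  shows "integrable unit2 (\<lambda>z. binary_entropy (case_prod W z))"
proof (rule integrable_unit2_bounded[where B = 1])
  show "(\<lambda>z. binary_entropy (case_prod W z)) \<in> borel_measurable unit2"
    using graphon_measurable[OF assms] by measurable
  show "\<bar>binary_entropy (case_prod W z)\<bar> \<le> 1" if "z \<in> space unit2" for z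
    using graphon_bounds[OF assms that] binary_entropy_nonneg binary_entropy_le_1 by simp
qed

lemma graphon_Ent_eq:
  assumes "graphon W"
  shows "graphon_Ent W = (\<integral>z. binary_entropy (case_prod W z) \<partial>unit2)"
proof -
  have "integrable unit2 (case_prod (\<lambda>x y. binary_entropy (W x y)))"
    using integrable_binary_entropy_graphon[OF assms] by (simp add: case_prod_unfold)
  from unit_pair.integral_fst[OF this] show ?thesis by (simp add: graphon_Ent_def case_prod_unfold)
qed

section \<open>Sample densities and sample entropy\<close>

abbreviation sample_dens :: "nat \<Rightarrow> nat set set \<Rightarrow> (real \<Rightarrow> real \<Rightarrow> real) \<Rightarrow> real" where
  "sample_dens k E \<equiv> lgraphon_density ({..<k}, E)"

text \<open>The points have an arbitrary type: sampled reals and colours of a finite kernel are both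
  used. \<open>Min\<close> and \<open>Max\<close> match the form of
  \<open>lgraphon_density\<close>.\<close>

definition pair_val :: "('a \<Rightarrow> 'a \<Rightarrow> real) \<Rightarrow> (nat \<Rightarrow> 'a) \<Rightarrow> nat set \<Rightarrow> real" where
  "pair_val W X e = W (X (Min e)) (X (Max e))"

lemma pair_val_bounds:
  assumes "graphon W" "e \<in> vpairs V" "X \<in> space (cube V)"
  shows "0 \<le> pair_val W X e \<and> pair_val W X e \<le> 1"
  using assms vpairs_Min_Max[OF assms(2)] space_cubeD[OF assms(3)] unfolding pair_val_def graphon_def by blast

lemma pair_val_measurable:
  assumes "graphon W" "e \<in> vpairs V"
  shows "(\<lambda>X. pair_val W X e) \<in> borel_measurable (cube V)"
proof -
  have "(\<lambda>X. case_prod W (X (Min e), X (Max e))) \<in> borel_measurable (cube V)"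
    using pair_measurable_cube[OF vpairs_Min_Max(1,2)[OF assms(2)]] graphon_measurable[OF assms(1)]
    by (rule measurable_compose)
  then show ?thesis by (simp add: pair_val_def)
qed

lemma lgraphon_density_eq: "lgraphon_density (V, E) W = (\<integral>X. bern (vpairs V) E (pair_val W X) \<partial>cube V)"
  by (simp add: lgraphon_density_def bern_def pair_val_def)

lemma bern_measurable:
  assumes "graphon W" "E \<subseteq> vpairs V"
  shows "(\<lambda>X. bern (vpairs V) E (pair_val W X)) \<in> borel_measurable (cube V)"
  unfolding bern_def using assms
  by (intro borel_measurable_times borel_measurable_prod borel_measurable_diff pair_val_measurable) auto

lemma bern_bounds:
  assumes "graphon W" "E \<subseteq> vpairs V" "X \<in> space (cube V)"
  shows "0 \<le> bern (vpairs V) E (pair_val W X)" "bern (vpairs V) E (pair_val W X) \<le> 1"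
  using assms pair_val_bounds by (auto intro!: bern_nonneg bern_le_1)

lemma integrable_cube_bounded:
  fixes f :: "(nat \<Rightarrow> real) \<Rightarrow> real"
  assumes "f \<in> borel_measurable (cube V)" "\<And>X. X \<in> space (cube V) \<Longrightarrow> \<bar>f X\<bar> \<le> B"
  shows "integrable (cube V) f"
proof -
  have fm: "finite_measure (cube V)" using prob_space_cube by (rule prob_space.axioms)
  show ?thesis using assms by (intro finite_measure.integrable_const_bound[OF fm, where B = B]) auto
qed

lemma bern_integrable:
  assumes "graphon W" "E \<subseteq> vpairs V"
  shows "integrable (cube V) (\<lambda>X. bern (vpairs V) E (pair_val W X))"
  using bern_bounds[OF assms] by (intro integrable_cube_bounded[where B = 1] bern_measurable assms) auto

lemma lgraphon_density_bounds:
  assumes "graphon W" "E \<subseteq> vpairs V"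
  shows "0 \<le> lgraphon_density (V, E) W"
  unfolding lgraphon_density_eq using bern_bounds[OF assms] by (intro integral_nonneg_AE AE_I2) auto

lemma lgraphon_density_sum:
  assumes "graphon W" "finite V"
  shows "(\<Sum>E\<in>Pow (vpairs V). lgraphon_density (V, E) W) = 1"
proof -
  have "(\<Sum>E\<in>Pow (vpairs V). lgraphon_density (V, E) W)
      = (\<integral>X. (\<Sum>E\<in>Pow (vpairs V). bern (vpairs V) E (pair_val W X)) \<partial>cube V)"
    unfolding lgraphon_density_eq using assms
    by (intro Bochner_Integration.integral_sum[symmetric] bern_integrable) auto
  also have "\<dots> = 1" using assms by (simp add: bern_sum vpairs_finite prob_space.prob_space[OF prob_space_cube])
  finally show ?thesis .
qed

definition sample_ent :: "nat \<Rightarrow> (real \<Rightarrow> real \<Rightarrow> real) \<Rightarrow> real" where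
  "sample_ent k W = (\<Sum>E\<in>Pow (pairs k). eta (sample_dens k E W))"

lemma sum_integral_pair_val:
  assumes f: "f \<in> borel_measurable unit2" "integrable unit2 f" and V: "finite V"
  shows "(\<integral>X. (\<Sum>e\<in>vpairs V. f (X (Min e), X (Max e))) \<partial>cube V) = card (vpairs V) * (\<integral>z. f z \<partial>unit2)"
proof -
  have "(\<integral>X. (\<Sum>e\<in>vpairs V. f (X (Min e), X (Max e))) \<partial>cube V)
      = (\<Sum>e\<in>vpairs V. \<integral>X. f (X (Min e), X (Max e)) \<partial>cube V)"
    by (rule Bochner_Integration.integral_sum) (rule integrable_cube_pair[OF V vpairs_Min_Max f(2)])
  also have "\<dots> = (\<Sum>e\<in>vpairs V. \<integral>z. f z \<partial>unit2)"
    by (rule sum.cong[OF refl]) (rule integral_cube_pair[OF V vpairs_Min_Max f(1)])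
  finally show ?thesis by simp
qed

text \<open>Conditioning on the sampled points makes the edges independent, and conditioning decreases
  entropy.\<close>

lemma graphon_Ent_le_sample_ent:
  assumes W: "graphon W"
  shows "real (k choose 2) * graphon_Ent W \<le> sample_ent k W"
proof -
  let ?V = "{..<k}"
  let ?P = "vpairs ?V"
  have int: "integrable (cube ?V) (\<lambda>X. eta (bern ?P E (pair_val W X)))" if "E \<in> Pow ?P" for E
  proof (rule integrable_cube_bounded[where B = "1 / ln 2"])
    show "(\<lambda>X. eta (bern ?P E (pair_val W X))) \<in> borel_measurable (cube ?V)"
      using bern_measurable[OF W, of E ?V] that by (intro measurable_compose[OF _ eta_measurable]) auto
    show "\<bar>eta (bern ?P E (pair_val W X))\<bar> \<le> 1 / ln 2" if "X \<in> space (cube ?V)" for X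
      using bern_bounds[OF W _ that, of E] \<open>E \<in> Pow ?P\<close> eta_nonneg eta_le by simp
  qed
  have "real (k choose 2) * graphon_Ent W = (\<integral>X. (\<Sum>e\<in>?P. binary_entropy (case_prod W (X (Min e), X (Max e)))) \<partial>cube ?V)"
    using integrable_binary_entropy_graphon[OF W]
    by (subst sum_integral_pair_val) (auto simp: graphon_Ent_eq[OF W] card_vpairs_lessThan)
  also have "\<dots> = (\<integral>X. (\<Sum>E\<in>Pow ?P. eta (bern ?P E (pair_val W X))) \<partial>cube ?V)"
    by (simp add: bern_entropy pair_val_def)
  also have "\<dots> = (\<Sum>E\<in>Pow ?P. \<integral>X. eta (bern ?P E (pair_val W X)) \<partial>cube ?V)"
    by (rule Bochner_Integration.integral_sum) (rule int)
  also have "\<dots> \<le> sample_ent k W" unfolding sample_ent_def lgraphon_density_eq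
    using int bern_integrable[OF W] bern_bounds[OF W] by (intro sum_mono prob_space.eta_jensen[OF prob_space_cube]) auto
  finally show ?thesis .
qed

lemma real_choose_two: "real (k choose 2) = real k * (real k - 1) / 2"
proof (induction k)
  case (Suc k)
  have "Suc k choose 2 = k + (k choose 2)" by (simp add: numeral_2_eq_2)
  then show ?case using Suc by (simp add: field_simps)
qed simp

lemma bern_cong: "E \<subseteq> P \<Longrightarrow> (\<And>e. e \<in> P \<Longrightarrow> x e = y e) \<Longrightarrow> bern P E x = bern P E y"
  unfolding bern_def by (intro arg_cong2[where f = times] prod.cong) auto

text \<open>Gibbs' inequality against the mixture \<open>q\<close> of the independent models with edge probabilities
  given by a step function close to \<open>W\<close>. The mixture costs only the entropy \<open>k log N\<close> of the
  \<open>k\<close> colours, which is negligible compared with the number of pairs.\<close>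

lemma sample_ent_le_graphon_Ent:
  assumes W: "graphon W" and \<epsilon>: "0 < \<epsilon>"
  obtains k where "2 \<le> k" "sample_ent k W \<le> real (k choose 2) * (graphon_Ent W + \<epsilon>)"
proof -
  \<comment> \<open>With clamping level \<delta> and L1 error below the square of \<delta>, the
    total error is at most \<open>8 * \<delta> / ln 2\<close>; the constant 16 makes this at most
    \<open>\<epsilon> / 2\<close>.\<close>
  define \<delta> where "\<delta> = min (1/2) (\<epsilon> * ln 2 / 16)"
  have \<delta>: "0 < \<delta>" "\<delta> \<le> 1/2" "\<delta> \<le> \<epsilon> * ln 2 / 16" using \<epsilon> by (auto simp: \<delta>_def)
  have "integrable unit2 (case_prod W)"
    using graphon_bounds[OF W] by (intro integrable_unit2_bounded[where B = 1] graphon_measurable[OF W]) auto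
  then have "step_approx unit_measure (case_prod W)" by (rule unit.step_approx_integrable)
  then obtain s where s: "step_function unit_measure s" "(\<integral>z. \<bar>case_prod W z - s z\<bar> \<partial>unit2) < \<delta>\<^sup>2"
    and W_int: "integrable unit2 (case_prod W)"
    using \<delta>(1) unfolding step_approx_def by (metis zero_less_power)
  have s_int: "integrable unit2 s" using s(1) by (rule unit.step_function_integrable)
  obtain N c g where c: "\<And>x. x \<in> {0..1} \<Longrightarrow> c x < (N::nat)" and g: "\<And>x y. s (x, y) = g (c x) (c y)"
    using s(1) unfolding step_function_def space_unit_measure by blast
  have N: "0 < N" using c[of 0] by auto
  \<comment> \<open>Clamping keeps the model probabilities away from 0 and 1, so that the
    denominators of the divergence bound stay positive.\<close>
  define y where "y m n = max \<delta> (min (1 - \<delta>) (g m n))" for m n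
  define D where "D x x' = y (c x) (c x')" for x x'
  have y: "\<delta> \<le> y m n" "y m n \<le> 1 - \<delta>" for m n using \<delta> by (auto simp: y_def)
  have y01: "0 < y m n" "y m n < 1" for m n using y[of m n] \<delta> by linarith+
  have D_eq: "case_prod D z = max \<delta> (min (1 - \<delta>) (s z))" for z by (cases z) (simp add: D_def y_def g)
  have D_meas: "case_prod D \<in> borel_measurable unit2"
    unfolding D_eq[abs_def] using step_function_measurable[OF s(1)] by measurable
  define f where "f z = binary_entropy (case_prod W z) +
      (case_prod W z - case_prod D z)\<^sup>2 / (case_prod D z * (1 - case_prod D z) * ln 2)" for z
  \<comment> \<open>On the interval from \<delta> to \<open>1 - \<delta>\<close> the product of a
    number with its complement is least at the ends, and \<open>1 - \<delta>\<close> is at least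
    1/2.\<close>
  have yy: "\<delta> / 2 \<le> y m n * (1 - y m n)" for m n
  proof -
    have "\<delta> * (1 - \<delta>) \<le> y m n * (1 - y m n)"
    proof -
      have "0 \<le> (y m n - \<delta>) * (1 - \<delta> - y m n)" using y[of m n] by (intro mult_nonneg_nonneg) auto
      then show ?thesis by (simp add: algebra_simps)
    qed
    moreover have "\<delta> * (1/2) \<le> \<delta> * (1 - \<delta>)" using \<delta> by (intro mult_left_mono) auto
    ultimately show ?thesis by linarith
  qed
  \<comment> \<open>The middle bound is linear in the L1 error and will be integrated; the last one
    is uniform and serves for integrability only.\<close>
  have err: "0 \<le> (w - y m n)\<^sup>2 / (y m n * (1 - y m n) * ln 2) \<and>
      (w - y m n)\<^sup>2 / (y m n * (1 - y m n) * ln 2) \<le> (2 * \<bar>w - g m n\<bar> + 2 * \<delta>\<^sup>2) * (2 / (\<delta> * ln 2)) \<and>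
      (w - y m n)\<^sup>2 / (y m n * (1 - y m n) * ln 2) \<le> 2 / (\<delta> * ln 2)" if w: "0 \<le> w" "w \<le> 1" for w m n
  proof -
    have pos: "0 < y m n * (1 - y m n)" using y01[of m n] by simp
    have a: "\<bar>w - y m n\<bar> \<le> 1" using w y01[of m n] by auto
    have b: "\<bar>w - y m n\<bar> \<le> \<bar>w - g m n\<bar> + \<delta>" using w \<delta> by (auto simp: y_def)
    have sq1: "(w - y m n)\<^sup>2 \<le> 1" using a by (simp add: abs_square_le_1)
    have sq2: "(w - y m n)\<^sup>2 \<le> 2 * \<bar>w - g m n\<bar> + 2 * \<delta>\<^sup>2"
    proof (cases "\<bar>w - g m n\<bar> \<le> 1")
      case True
      have "(w - y m n)\<^sup>2 \<le> (\<bar>w - g m n\<bar> + \<delta>)\<^sup>2" using b by (metis abs_ge_zero power2_abs power_mono)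
      also have "\<dots> \<le> 2 * \<bar>w - g m n\<bar>\<^sup>2 + 2 * \<delta>\<^sup>2"
        using sum_squares_bound[of "\<bar>w - g m n\<bar>" \<delta>] by (simp add: power2_sum)
      also have "\<bar>w - g m n\<bar>\<^sup>2 \<le> \<bar>w - g m n\<bar>" unfolding power2_eq_square using True by (intro mult_left_le) auto
      finally show ?thesis by simp
    next
      case False
      then have "1 \<le> 2 * \<bar>w - g m n\<bar>" by simp
      also have "\<dots> \<le> 2 * \<bar>w - g m n\<bar> + 2 * \<delta>\<^sup>2" by simp
      finally show ?thesis by (rule order_trans[OF sq1])
    qed
    have inv: "1 / (y m n * (1 - y m n) * ln 2) \<le> 2 / (\<delta> * ln 2)"
    proof -
      have "1 / (y m n * (1 - y m n) * ln 2) \<le> 1 / (\<delta> / 2 * ln 2)"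
        using yy[of m n] \<delta> by (intro divide_left_mono mult_right_mono mult_pos_pos) (auto simp: y01)
      then show ?thesis by simp
    qed
    have "(w - y m n)\<^sup>2 * (1 / (y m n * (1 - y m n) * ln 2)) \<le> (2 * \<bar>w - g m n\<bar> + 2 * \<delta>\<^sup>2) * (2 / (\<delta> * ln 2))"
      using sq2 inv pos \<delta> by (intro mult_mono) auto
    moreover have "(w - y m n)\<^sup>2 * (1 / (y m n * (1 - y m n) * ln 2)) \<le> 1 * (2 / (\<delta> * ln 2))"
      using sq1 inv pos \<delta> by (intro mult_mono) auto
    ultimately show ?thesis using pos by simp
  qed
  have f_meas: "f \<in> borel_measurable unit2"
    unfolding f_def[abs_def] using graphon_measurable[OF W] D_meas by measurable
  have f_int: "integrable unit2 f"
  proof (rule integrable_unit2_bounded[OF f_meas])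
    fix z assume "z \<in> space unit2"
    then have w: "0 \<le> case_prod W z" "case_prod W z \<le> 1" using graphon_bounds[OF W] by auto
    show "\<bar>f z\<bar> \<le> 1 + 2 / (\<delta> * ln 2)"
      using err[OF w, of "c (fst z)" "c (snd z)"] binary_entropy_nonneg[OF w] binary_entropy_le_1[OF w]
      by (simp add: f_def D_def case_prod_unfold)
  qed
  have "(\<integral>z. f z \<partial>unit2) \<le> (\<integral>z. binary_entropy (case_prod W z)
      + (2 * \<bar>case_prod W z - s z\<bar> + 2 * \<delta>\<^sup>2) * (2 / (\<delta> * ln 2)) \<partial>unit2)"
  proof (rule integral_mono)
    show "integrable unit2 (\<lambda>z. binary_entropy (case_prod W z)
      + (2 * \<bar>case_prod W z - s z\<bar> + 2 * \<delta>\<^sup>2) * (2 / (\<delta> * ln 2)))"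
      using integrable_binary_entropy_graphon[OF W] W_int s_int by simp
    fix z assume "z \<in> space unit2"
    then have w: "0 \<le> case_prod W z" "case_prod W z \<le> 1" using graphon_bounds[OF W] by auto
    show "f z \<le> binary_entropy (case_prod W z) + (2 * \<bar>case_prod W z - s z\<bar> + 2 * \<delta>\<^sup>2) * (2 / (\<delta> * ln 2))"
      using err[OF w, of "c (fst z)" "c (snd z)"] g[of "fst z" "snd z"]
      by (simp add: f_def D_def case_prod_unfold)
  qed (rule f_int)
  also have "\<dots> = graphon_Ent W + (2 * (\<integral>z. \<bar>case_prod W z - s z\<bar> \<partial>unit2) + 2 * \<delta>\<^sup>2) * (2 / (\<delta> * ln 2))"
    using integrable_binary_entropy_graphon[OF W] W_int s_int
    by (simp add: graphon_Ent_eq[OF W] unit_pair.P.prob_space)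
  also have "\<dots> \<le> graphon_Ent W + (2 * \<delta>\<^sup>2 + 2 * \<delta>\<^sup>2) * (2 / (\<delta> * ln 2))"
    using s(2) \<delta> by (intro add_left_mono mult_right_mono) auto
  also have "(2 * \<delta>\<^sup>2 + 2 * \<delta>\<^sup>2) * (2 / (\<delta> * ln 2)) = 8 * \<delta> / ln 2"
    using \<delta> by (simp add: power2_eq_square)
  also have "8 * \<delta> / ln 2 \<le> \<epsilon> / 2" using \<delta> by (simp add: field_simps)
  finally have f_le: "(\<integral>z. f z \<partial>unit2) \<le> graphon_Ent W + \<epsilon> / 2" by simp
  \<comment> \<open>As \<open>k choose 2\<close> is \<open>k * (k - 1) / 2\<close>, this choice
    makes the colour cost \<open>k * log 2 N\<close> at most half of the allowed error.\<close>
  obtain k0 :: nat where k0: "4 * log 2 N / \<epsilon> \<le> real k0" using real_arch_simple by blast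
  define k where "k = k0 + 2"
  let ?V = "{..<k}"
  let ?P = "vpairs ?V"
  define p where "p E = lgraphon_density (?V, E) W" for E
  define K where "K = ?V \<rightarrow>\<^sub>E {..<N}"
  define yv where "yv a e = y (a (Min e)) (a (Max e))" for a :: "nat \<Rightarrow> nat" and e
  \<comment> \<open>The mixture is uniform over all colourings of the \<open>k\<close> points,
    whatever the measures of the colour classes. Dominating one of its \<open>N ^ k\<close> terms
    costs a factor \<open>N ^ k\<close> and nothing else.\<close>
  define q where "q E = (\<Sum>a\<in>K. bern ?P E (yv a)) / real N ^ k" for E
  have finK: "finite K" by (simp add: K_def finite_PiE)
  have cardK: "card K = N ^ k" by (simp add: K_def card_PiE)
  have bern_pos: "0 < bern ?P E (yv a)" for E a
    unfolding bern_def by (intro mult_pos_pos prod_pos) (auto simp: yv_def y01)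
  have K0: "K \<noteq> {}" using N by (auto simp: K_def PiE_eq_empty_iff)
  have q_pos: "0 < q E" for E
    unfolding q_def using N finK K0 bern_pos by (intro divide_pos_pos sum_pos) auto
  have "(\<Sum>E\<in>Pow ?P. q E) = (\<Sum>a\<in>K. \<Sum>E\<in>Pow ?P. bern ?P E (yv a)) / real N ^ k"
    unfolding q_def sum_divide_distrib[symmetric] by (subst sum.swap) simp
  also have "\<dots> = 1" using N by (simp add: bern_sum cardK)
  finally have q_sum: "(\<Sum>E\<in>Pow ?P. q E) = 1" .
  have p_sum: "(\<Sum>E\<in>Pow ?P. p E) = 1" unfolding p_def by (rule lgraphon_density_sum[OF W]) simp
  \<comment> \<open>Gibbs' inequality through tangents: \<open>p\<close> and \<open>q\<close> both
    sum to 1, so the linear terms drop out.\<close>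
  have "sample_ent k W \<le> (\<Sum>E\<in>Pow ?P. - p E * log 2 (q E) + (q E - p E) / ln 2)"
    unfolding sample_ent_def p_def using lgraphon_density_bounds[OF W] q_pos
    by (intro sum_mono eta_le_tangent) auto
  also have "\<dots> = (\<Sum>E\<in>Pow ?P. p E * - log 2 (q E)) + ((\<Sum>E\<in>Pow ?P. q E) - (\<Sum>E\<in>Pow ?P. p E)) / ln 2"
    by (simp add: sum.distrib sum_subtractf sum_divide_distrib[symmetric] diff_divide_distrib sum_negf)
  also have "\<dots> = (\<Sum>E\<in>Pow ?P. p E * - log 2 (q E))" by (simp add: q_sum p_sum)
  also have "\<dots> = (\<integral>X. (\<Sum>E\<in>Pow ?P. bern ?P E (pair_val W X) * - log 2 (q E)) \<partial>cube ?V)"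
    unfolding p_def lgraphon_density_eq using bern_integrable[OF W, of _ ?V]
    by (subst Bochner_Integration.integral_sum) auto
  also have "\<dots> \<le> (\<integral>X. k * log 2 N + (\<Sum>e\<in>?P. f (X (Min e), X (Max e))) \<partial>cube ?V)"
  proof (rule integral_mono)
    show "integrable (cube ?V) (\<lambda>X. \<Sum>E\<in>Pow ?P. bern ?P E (pair_val W X) * - log 2 (q E))"
      using bern_integrable[OF W, of _ ?V] by (intro Bochner_Integration.integrable_sum integrable_mult_left) auto
    have "integrable (cube ?V) (\<lambda>X. \<Sum>e\<in>?P. f (X (Min e), X (Max e)))"
      by (rule Bochner_Integration.integrable_sum) (rule integrable_cube_pair[OF _ vpairs_Min_Max f_int], simp)
    then show "integrable (cube ?V) (\<lambda>X. k * log 2 N + (\<Sum>e\<in>?P. f (X (Min e), X (Max e))))"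
      using integrable_cube_bounded[of "\<lambda>_. k * log 2 N" ?V "\<bar>k * log 2 N\<bar>"] by simp
    fix X assume X: "X \<in> space (cube ?V)"
    define a where "a = (\<lambda>i\<in>?V. c (X i))"
    have a: "a \<in> K" using c space_cubeD[OF X] by (auto simp: a_def K_def)
    have ya: "yv a e = pair_val D X e" if "e \<in> ?P" for e
      using vpairs_Min_Max[OF that] by (simp add: yv_def a_def pair_val_def D_def)
    \<comment> \<open>The mixture is at least its term for the true colouring \<open>a\<close> of
      the sampled points.\<close>
    have logq: "- log 2 (q E) \<le> k * log 2 N - log 2 (bern ?P E (yv a))" for E
    proof -
      have "bern ?P E (yv a) \<le> (\<Sum>a\<in>K. bern ?P E (yv a))"
        using a finK bern_pos by (intro member_le_sum) (auto intro: less_imp_le)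
      also have "\<dots> = real N ^ k * q E" using N by (simp add: q_def)
      finally have "log 2 (bern ?P E (yv a)) \<le> log 2 (real N ^ k * q E)"
        using N q_pos[of E] bern_pos by (subst log_le_cancel_iff) auto
      also have "\<dots> = k * log 2 N + log 2 (q E)"
        using N q_pos[of E] by (simp add: log_mult log_nat_power)
      finally show ?thesis by simp
    qed
    have "(\<Sum>E\<in>Pow ?P. bern ?P E (pair_val W X) * - log 2 (q E))
        \<le> (\<Sum>E\<in>Pow ?P. bern ?P E (pair_val W X) * (k * log 2 N - log 2 (bern ?P E (yv a))))"
      using bern_bounds[OF W _ X] logq by (intro sum_mono mult_left_mono) auto
    also have "\<dots> = k * log 2 N * (\<Sum>E\<in>Pow ?P. bern ?P E (pair_val W X))
        + (\<Sum>E\<in>Pow ?P. bern ?P E (pair_val W X) * - log 2 (bern ?P E (yv a)))"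
      by (simp add: sum.distrib[symmetric] sum_distrib_left algebra_simps)
    also have "\<dots> = k * log 2 N + (\<Sum>e\<in>?P. - pair_val W X e * log 2 (yv a e) - (1 - pair_val W X e) * log 2 (1 - yv a e))"
    proof -
      have "(\<Sum>E\<in>Pow ?P. bern ?P E (pair_val W X) * - log 2 (bern ?P E (yv a)))
        = (\<Sum>e\<in>?P. - pair_val W X e * log 2 (yv a e) - (1 - pair_val W X e) * log 2 (1 - yv a e))"
        using less_imp_neq[OF y01(1)] less_imp_neq[OF y01(2)]
        by (intro bern_cross_entropy) (auto simp: yv_def dest: not_sym)
      then show ?thesis by (simp add: bern_sum)
    qed
    also have "\<dots> \<le> k * log 2 N + (\<Sum>e\<in>?P. f (X (Min e), X (Max e)))"
    proof (intro add_left_mono sum_mono)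
      fix e assume e: "e \<in> ?P"
      have "- pair_val W X e * log 2 (yv a e) - (1 - pair_val W X e) * log 2 (1 - yv a e)
        \<le> binary_entropy (pair_val W X e) + (pair_val W X e - yv a e)\<^sup>2 / (yv a e * (1 - yv a e) * ln 2)"
        using pair_val_bounds[OF W e X] y01 by (intro cross_entropy_le) (auto simp: yv_def)
      also have "\<dots> = f (X (Min e), X (Max e))" by (simp add: f_def ya[OF e]) (simp add: pair_val_def)
      finally show "- pair_val W X e * log 2 (yv a e) - (1 - pair_val W X e) * log 2 (1 - yv a e)
        \<le> f (X (Min e), X (Max e))" .
    qed
    finally show "(\<Sum>E\<in>Pow ?P. bern ?P E (pair_val W X) * - log 2 (q E))
        \<le> k * log 2 N + (\<Sum>e\<in>?P. f (X (Min e), X (Max e)))" .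
  qed
  also have "\<dots> = k * log 2 N + real (k choose 2) * (\<integral>z. f z \<partial>unit2)"
  proof -
    have "integrable (cube ?V) (\<lambda>X. \<Sum>e\<in>?P. f (X (Min e), X (Max e)))"
      by (rule Bochner_Integration.integrable_sum) (rule integrable_cube_pair[OF _ vpairs_Min_Max f_int], simp)
    moreover have "integrable (cube ?V) (\<lambda>_. k * log 2 N)"
      by (rule integrable_cube_bounded[where B = "\<bar>k * log 2 N\<bar>"]) auto
    moreover have "(\<integral>X. (\<Sum>e\<in>?P. f (X (Min e), X (Max e))) \<partial>cube ?V) = real (k choose 2) * (\<integral>z. f z \<partial>unit2)"
      using sum_integral_pair_val[OF f_meas f_int, of ?V] by (simp add: card_vpairs_lessThan)
    ultimately show ?thesis
      by (subst Bochner_Integration.integral_add) (auto simp: prob_space.prob_space[OF prob_space_cube])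
  qed
  also have "\<dots> \<le> real (k choose 2) * (\<epsilon> / 2) + real (k choose 2) * (graphon_Ent W + \<epsilon> / 2)"
  proof (intro add_mono mult_left_mono f_le)
    have "4 * log 2 N \<le> (real k - 1) * \<epsilon>" using k0 \<epsilon> by (simp add: k_def field_simps)
    then have "real k * (4 * log 2 N) \<le> real k * ((real k - 1) * \<epsilon>)" by (rule mult_left_mono) simp
    then show "k * log 2 N \<le> real (k choose 2) * (\<epsilon> / 2)" by (simp add: real_choose_two)
  qed simp
  finally have "sample_ent k W \<le> real (k choose 2) * (graphon_Ent W + \<epsilon>)" by (simp add: algebra_simps)
  then show ?thesis by (rule that[rotated]) (simp add: k_def)
qed

text \<open>Sample entropies coincide for equivalent graphons and bound the entropy from above up to
  an arbitrarily small error per pair; the slack is needed since the infimum need not be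
  attained.\<close>

lemma graphon_Ent_cong_le:
  assumes "graphon_equiv W W'"
  shows "graphon_Ent W \<le> graphon_Ent W'"
proof (rule field_le_epsilon)
  fix \<epsilon> :: real assume "0 < \<epsilon>"
  have W: "graphon W" "graphon W'" using assms by (auto simp: graphon_equiv_def)
  obtain k where k: "2 \<le> k" "sample_ent k W' \<le> real (k choose 2) * (graphon_Ent W' + \<epsilon>)"
    using sample_ent_le_graphon_Ent[OF W(2) \<open>0 < \<epsilon>\<close>] by blast
  have "sample_dens k E W = sample_dens k E W'" if "E \<in> Pow (pairs k)" for E
    using assms is_graph_std[of k E] that k unfolding graphon_equiv_def by auto
  then have "sample_ent k W = sample_ent k W'" by (simp add: sample_ent_def)
  then have "real (k choose 2) * graphon_Ent W \<le> real (k choose 2) * (graphon_Ent W' + \<epsilon>)"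
    using graphon_Ent_le_sample_ent[OF W(1), of k] k by linarith
  moreover have "0 < real (k choose 2)" using k by (simp add: zero_less_binomial)
  ultimately show "graphon_Ent W \<le> graphon_Ent W' + \<epsilon>" by simp
qed

lemma graphon_equiv_sym: "graphon_equiv W W' \<Longrightarrow> graphon_equiv W' W"
  by (auto simp: graphon_equiv_def)

lemma graphon_equiv_refl: "graphon W \<Longrightarrow> graphon_equiv W W"
  by (auto simp: graphon_equiv_def)

text \<open>The definite description in \<open>Ent\<close> denotes because equivalent graphons have
  equal entropy.\<close>

lemma Ent_abs:
  assumes W: "graphon W"
  shows "Ent (abs_graph_limit W) = graphon_Ent W"
  unfolding Ent_def
proof (rule the_equality)
  show "\<forall>W'. graphon W' \<and> abs_graph_limit W' = abs_graph_limit W \<longrightarrow> graphon_Ent W' = graphon_Ent W"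
  proof (intro allI impI, elim conjE)
    fix W' assume "graphon W'" "abs_graph_limit W' = abs_graph_limit W"
    then have "graphon_equiv W' W"
      using Quotient_rel[OF Quotient_graph_limit, of W' W] graphon_equiv_refl W by auto
    then show "graphon_Ent W' = graphon_Ent W"
      using graphon_Ent_cong_le graphon_equiv_sym by (intro antisym) blast+
  qed
qed (use W in blast)

section \<open>Entropy and sample entropy of graph limits\<close>

lemma graph_limit_cases:
  fixes \<Gamma> :: graph_limit
  obtains W where "graphon W" "\<Gamma> = abs_graph_limit W"
  using Quotient_abs_rep[OF Quotient_graph_limit, of \<Gamma>] Quotient_rep_reflp[OF Quotient_graph_limit, of \<Gamma>]
  by (metis graphon_equiv_def)

lemma limit_density_abs:
  "is_graph H \<Longrightarrow> graphon W \<Longrightarrow> limit_density (abs_ugraph H) (abs_graph_limit W) = lgraphon_density H W"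
  by (intro limit_density.abs_eq graph_equiv_refl graphon_equiv_refl)

definition limit_ent :: "nat \<Rightarrow> graph_limit \<Rightarrow> real" where
  "limit_ent k \<Gamma> = (\<Sum>E\<in>Pow (pairs k). eta (limit_density (std_graph k E) \<Gamma>))"

lemma limit_ent_abs:
  "0 < k \<Longrightarrow> graphon W \<Longrightarrow> limit_ent k (abs_graph_limit W) = sample_ent k W"
  unfolding limit_ent_def sample_ent_def by (intro sum.cong refl) (simp add: limit_density_abs is_graph_std)

lemma Ent_le_limit_ent: "2 \<le> k \<Longrightarrow> real (k choose 2) * Ent \<Gamma> \<le> limit_ent k \<Gamma>"
  using graph_limit_cases[of \<Gamma>] graphon_Ent_le_sample_ent
  by (metis Ent_abs limit_ent_abs less_le_trans pos2)

text \<open>Upper semicontinuity in the form in which it is used: the hypothesis consists of closed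
  conditions on the densities, so it can be obtained by passing to a limit of graphs.\<close>

lemma le_Ent:
  assumes "\<And>k. 2 \<le> k \<Longrightarrow> real (k choose 2) * L \<le> limit_ent k \<Gamma>"
  shows "L \<le> Ent \<Gamma>"
proof (rule field_le_epsilon)
  fix \<epsilon> :: real assume "0 < \<epsilon>"
  obtain W where W: "graphon W" "\<Gamma> = abs_graph_limit W" by (rule graph_limit_cases)
  obtain k where k: "2 \<le> k" "sample_ent k W \<le> real (k choose 2) * (graphon_Ent W + \<epsilon>)"
    using sample_ent_le_graphon_Ent[OF W(1) \<open>0 < \<epsilon>\<close>] by blast
  have "limit_ent k \<Gamma> = sample_ent k W" "Ent \<Gamma> = graphon_Ent W"
    using k W by (simp_all add: Ent_abs limit_ent_abs)
  then have "real (k choose 2) * L \<le> real (k choose 2) * (Ent \<Gamma> + \<epsilon>)"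
    using assms[OF k(1)] k(2) by (metis order_trans)
  moreover have "0 < real (k choose 2)" using k by (simp add: zero_less_binomial)
  ultimately show "L \<le> Ent \<Gamma> + \<epsilon>" by simp
qed

lemma Ent_le_1: "Ent \<Gamma> \<le> 1"
proof -
  obtain W where W: "graphon W" "\<Gamma> = abs_graph_limit W" by (rule graph_limit_cases)
  have "graphon_Ent W \<le> (\<integral>z. 1 \<partial>unit2)"
    unfolding graphon_Ent_eq[OF W(1)] using graphon_bounds[OF W(1)] binary_entropy_le_1
    by (intro integral_mono integrable_binary_entropy_graphon W) auto
  then show ?thesis using W by (simp add: Ent_abs unit_pair.P.prob_space)
qed

section \<open>Weighted kernels and their quotients\<close>

text \<open>A finite probability space \<open>(I, w)\<close> with a kernel of density at most 1: \<open>e x y\<close> is the mass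
  of the kernel on the pair \<open>(x, y)\<close>.\<close>

definition kernel :: "nat set \<Rightarrow> (nat \<Rightarrow> real) \<Rightarrow> (nat \<Rightarrow> nat \<Rightarrow> real) \<Rightarrow> bool" where
  "kernel I w e \<longleftrightarrow> finite I \<and> (\<forall>x\<in>I. 0 \<le> w x) \<and> (\<Sum>x\<in>I. w x) = 1 \<and>
     (\<forall>x\<in>I. \<forall>y\<in>I. 0 \<le> e x y \<and> e x y \<le> w x * w y)"

definition quot_w :: "nat set \<Rightarrow> (nat \<Rightarrow> real) \<Rightarrow> (nat \<Rightarrow> nat) \<Rightarrow> nat \<Rightarrow> real" where
  "quot_w I w \<pi> a = (\<Sum>x\<in>{x\<in>I. \<pi> x = a}. w x)"

definition quot_e :: "nat set \<Rightarrow> (nat \<Rightarrow> nat \<Rightarrow> real) \<Rightarrow> (nat \<Rightarrow> nat) \<Rightarrow> nat \<Rightarrow> nat \<Rightarrow> real" where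
  "quot_e I e \<pi> a b = (\<Sum>x\<in>{x\<in>I. \<pi> x = a}. \<Sum>y\<in>{y\<in>I. \<pi> y = b}. e x y)"

text \<open>On classes of weight 0 this is the junk value 0; there \<open>e\<close> vanishes as well.\<close>

definition dens :: "(nat \<Rightarrow> real) \<Rightarrow> (nat \<Rightarrow> nat \<Rightarrow> real) \<Rightarrow> nat \<Rightarrow> nat \<Rightarrow> real" where
  "dens w e a b = e a b / (w a * w b)"

text \<open>The mean square density, the potential function of regularity lemmas.\<close>

definition energy :: "nat set \<Rightarrow> (nat \<Rightarrow> real) \<Rightarrow> (nat \<Rightarrow> nat \<Rightarrow> real) \<Rightarrow> real" where
  "energy I w e = (\<Sum>x\<in>I. \<Sum>y\<in>I. w x * w y * (dens w e x y)\<^sup>2)"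

abbreviation quot_dens where
  "quot_dens I w e \<pi> x y \<equiv> dens (quot_w I w \<pi>) (quot_e I e \<pi>) (\<pi> x) (\<pi> y)"

abbreviation quot_energy where
  "quot_energy J I w e \<pi> \<equiv> energy J (quot_w I w \<pi>) (quot_e I e \<pi>)"

lemma kernelD:
  assumes "kernel I w e"
  shows "finite I" "x \<in> I \<Longrightarrow> 0 \<le> w x" "(\<Sum>x\<in>I. w x) = 1"
    "x \<in> I \<Longrightarrow> y \<in> I \<Longrightarrow> 0 \<le> e x y" "x \<in> I \<Longrightarrow> y \<in> I \<Longrightarrow> e x y \<le> w x * w y"
  using assms by (auto simp: kernel_def)

lemma kernel_dens:
  assumes "kernel I w e" "x \<in> I" "y \<in> I"
  shows "0 \<le> dens w e x y" "dens w e x y \<le> 1" "w x * w y * dens w e x y = e x y"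
proof -
  have "0 \<le> w x * w y" using kernelD[OF assms(1)] assms by auto
  then show "0 \<le> dens w e x y" "dens w e x y \<le> 1"
    using kernelD(4,5)[OF assms] by (auto simp: dens_def divide_le_eq_1 order_less_le)
  show "w x * w y * dens w e x y = e x y"
    using kernelD(4,5)[OF assms] by (cases "w x * w y = 0") (auto simp: dens_def)
qed

lemma quot_w_nonneg: "kernel I w e \<Longrightarrow> 0 \<le> quot_w I w \<pi> a"
  unfolding quot_w_def by (intro sum_nonneg) (auto dest: kernelD)

lemma quot_e_nonneg: "kernel I w e \<Longrightarrow> 0 \<le> quot_e I e \<pi> a b"
  unfolding quot_e_def by (intro sum_nonneg) (auto dest: kernelD)

lemma quot_e_le: "kernel I w e \<Longrightarrow> quot_e I e \<pi> a b \<le> quot_w I w \<pi> a * quot_w I w \<pi> b"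
  unfolding quot_e_def quot_w_def sum_product by (intro sum_mono) (auto dest: kernelD)

lemma kernel_quot:
  assumes k: "kernel I w e" and J: "finite J" "\<pi> ` I \<subseteq> J"
  shows "kernel J (quot_w I w \<pi>) (quot_e I e \<pi>)"
proof -
  have "(\<Sum>a\<in>J. quot_w I w \<pi> a) = 1"
    unfolding quot_w_def using sum.group[of I J \<pi> w] kernelD[OF k] J by simp
  then show ?thesis
    using J quot_w_nonneg[OF k] quot_e_nonneg[OF k] quot_e_le[OF k] by (simp add: kernel_def)
qed

lemma sum_quot:
  assumes "finite I" "finite J" "\<pi> ` I \<subseteq> J"
  shows "(\<Sum>x\<in>I. \<Sum>y\<in>I. F x y * g (\<pi> x) (\<pi> y))
       = (\<Sum>a\<in>J. \<Sum>b\<in>J. (\<Sum>x\<in>{x\<in>I. \<pi> x = a}. \<Sum>y\<in>{y\<in>I. \<pi> y = b}. F x y) * (g a b :: real))"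
proof -
  have "(\<Sum>x\<in>I. \<Sum>y\<in>I. F x y * g (\<pi> x) (\<pi> y))
      = (\<Sum>a\<in>J. \<Sum>x\<in>{x\<in>I. \<pi> x = a}. \<Sum>y\<in>I. F x y * g (\<pi> x) (\<pi> y))" by (rule sum.group[OF assms, symmetric])
  also have "\<dots> = (\<Sum>a\<in>J. \<Sum>x\<in>{x\<in>I. \<pi> x = a}. \<Sum>b\<in>J. \<Sum>y\<in>{y\<in>I. \<pi> y = b}. F x y * g (\<pi> x) (\<pi> y))"
    by (intro sum.cong refl) (rule sum.group[OF assms, symmetric])
  also have "\<dots> = (\<Sum>a\<in>J. \<Sum>b\<in>J. \<Sum>x\<in>{x\<in>I. \<pi> x = a}. \<Sum>y\<in>{y\<in>I. \<pi> y = b}. F x y * g (\<pi> x) (\<pi> y))"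
    by (intro sum.cong refl sum.swap)
  also have "\<dots> = (\<Sum>a\<in>J. \<Sum>b\<in>J. (\<Sum>x\<in>{x\<in>I. \<pi> x = a}. \<Sum>y\<in>{y\<in>I. \<pi> y = b}. F x y) * g a b)"
    unfolding sum_distrib_right by (intro sum.cong refl) auto
  finally show ?thesis .
qed

lemma sum_quot_weights:
  assumes k: "kernel I w e" and J: "finite J" "\<pi> ` I \<subseteq> J"
  shows "(\<Sum>x\<in>I. \<Sum>y\<in>I. w x * w y * g (\<pi> x) (\<pi> y))
       = (\<Sum>a\<in>J. \<Sum>b\<in>J. quot_w I w \<pi> a * quot_w I w \<pi> b * g a b)"
  using sum_quot[OF kernelD(1)[OF k] J, of "\<lambda>x y. w x * w y" g] by (simp add: quot_w_def sum_product)

text \<open>The quotient density is the conditional expectation of the density.\<close>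

lemma sum_kernel_quot_dens:
  assumes k: "kernel I w e"
  shows "(\<Sum>x\<in>I. \<Sum>y\<in>I. e x y * g (\<pi> x) (\<pi> y))
       = (\<Sum>x\<in>I. \<Sum>y\<in>I. w x * w y * (quot_dens I w e \<pi> x y * g (\<pi> x) (\<pi> y)))"
proof -
  note fin = kernelD(1)[OF k]
  have q: "kernel (\<pi> ` I) (quot_w I w \<pi>) (quot_e I e \<pi>)" using k fin by (intro kernel_quot) auto
  have "(\<Sum>x\<in>I. \<Sum>y\<in>I. e x y * g (\<pi> x) (\<pi> y)) = (\<Sum>a\<in>\<pi> ` I. \<Sum>b\<in>\<pi> ` I. quot_e I e \<pi> a b * g a b)"
    using fin by (simp add: sum_quot[of I "\<pi> ` I"] quot_e_def)
  also have "\<dots> = (\<Sum>a\<in>\<pi> ` I. \<Sum>b\<in>\<pi> ` I. quot_w I w \<pi> a * quot_w I w \<pi> b *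
      (dens (quot_w I w \<pi>) (quot_e I e \<pi>) a b * g a b))"
    using kernel_dens(3)[OF q] by (intro sum.cong refl) (simp add: mult.assoc[symmetric])
  also have "\<dots> = (\<Sum>x\<in>I. \<Sum>y\<in>I. w x * w y * (quot_dens I w e \<pi> x y * g (\<pi> x) (\<pi> y)))"
    using sum_quot_weights[OF k, of "\<pi> ` I" \<pi>
        "\<lambda>a b. dens (quot_w I w \<pi>) (quot_e I e \<pi>) a b * g a b"] fin by simp
  finally show ?thesis .
qed

lemma energy_quot:
  assumes k: "kernel I w e" and J: "finite J" "\<pi> ` I \<subseteq> J"
  shows "quot_energy J I w e \<pi> = (\<Sum>x\<in>I. \<Sum>y\<in>I. w x * w y * (quot_dens I w e \<pi> x y)\<^sup>2)"
  using sum_quot_weights[OF k J, of "\<lambda>a b. (dens (quot_w I w \<pi>) (quot_e I e \<pi>) a b)\<^sup>2"]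
  by (simp add: energy_def)

lemma energy_bounds:
  assumes k: "kernel I w e"
  shows "0 \<le> energy I w e" "energy I w e \<le> 1"
proof -
  show "0 \<le> energy I w e"
    unfolding energy_def using kernelD(2)[OF k] by (intro sum_nonneg mult_nonneg_nonneg) auto
  have "energy I w e \<le> (\<Sum>x\<in>I. \<Sum>y\<in>I. w x * w y * 1)"
    unfolding energy_def using kernelD(2)[OF k] kernel_dens[OF k]
    by (intro sum_mono mult_left_mono mult_nonneg_nonneg power_le_one) auto
  also have "\<dots> = 1" using kernelD(3)[OF k] by (simp add: sum_product[symmetric])
  finally show "energy I w e \<le> 1" .
qed

text \<open>The coarser density is the conditional expectation of the finer one, so the mixed term
  equals the square of the coarser density.\<close>

lemma energy_pythagoras:
  assumes k: "kernel I w e" and J: "finite J" "\<pi> ` I \<subseteq> J" and J': "finite J'" "\<rho> ` I \<subseteq> J'"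
    and \<rho>: "\<And>x. x \<in> I \<Longrightarrow> \<rho> x = \<tau> (\<pi> x)"
  shows "(\<Sum>x\<in>I. \<Sum>y\<in>I. w x * w y * (quot_dens I w e \<pi> x y - quot_dens I w e \<rho> x y)\<^sup>2)
    = quot_energy J I w e \<pi> - quot_energy J' I w e \<rho>"
proof -
  let ?p = "quot_dens I w e \<pi>" and ?r = "quot_dens I w e \<rho>"
  let ?g = "dens (quot_w I w \<rho>) (quot_e I e \<rho>)"
  have "(\<Sum>x\<in>I. \<Sum>y\<in>I. w x * w y * (?p x y * ?r x y))
      = (\<Sum>x\<in>I. \<Sum>y\<in>I. w x * w y * (?p x y * ?g (\<tau> (\<pi> x)) (\<tau> (\<pi> y))))"
    by (intro sum.cong refl) (simp add: \<rho>)
  also have "\<dots> = (\<Sum>x\<in>I. \<Sum>y\<in>I. e x y * ?g (\<tau> (\<pi> x)) (\<tau> (\<pi> y)))"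
    by (rule sum_kernel_quot_dens[OF k, of "\<lambda>a b. ?g (\<tau> a) (\<tau> b)", symmetric])
  also have "\<dots> = (\<Sum>x\<in>I. \<Sum>y\<in>I. e x y * ?g (\<rho> x) (\<rho> y))" by (intro sum.cong refl) (simp add: \<rho>)
  also have "\<dots> = (\<Sum>x\<in>I. \<Sum>y\<in>I. w x * w y * (?r x y)\<^sup>2)"
    by (subst sum_kernel_quot_dens[OF k, of ?g]) (simp add: power2_eq_square)
  finally have *: "(\<Sum>x\<in>I. \<Sum>y\<in>I. w x * w y * (?p x y * ?r x y)) = (\<Sum>x\<in>I. \<Sum>y\<in>I. w x * w y * (?r x y)\<^sup>2)" .
  have "(\<Sum>x\<in>I. \<Sum>y\<in>I. w x * w y * (?p x y - ?r x y)\<^sup>2)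
      = (\<Sum>x\<in>I. \<Sum>y\<in>I. w x * w y * (?p x y)\<^sup>2) - 2 * (\<Sum>x\<in>I. \<Sum>y\<in>I. w x * w y * (?p x y * ?r x y))
        + (\<Sum>x\<in>I. \<Sum>y\<in>I. w x * w y * (?r x y)\<^sup>2)"
    by (simp add: sum_distrib_left sum_subtractf[symmetric] sum.distrib[symmetric] power2_eq_square algebra_simps)
  then show ?thesis by (simp add: energy_quot[OF k J] energy_quot[OF k J'] *)
qed

lemma weighted_cauchy_schwarz:
  fixes w f g :: "'a \<Rightarrow> real"
  assumes w: "\<And>x. x \<in> A \<Longrightarrow> 0 \<le> w x"
  shows "(\<Sum>x\<in>A. w x * (f x * g x))\<^sup>2 \<le> (\<Sum>x\<in>A. w x * (f x)\<^sup>2) * (\<Sum>x\<in>A. w x * (g x)\<^sup>2)"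
proof -
  have "(\<Sum>x\<in>A. (sqrt (w x) * f x) * (sqrt (w x) * g x))\<^sup>2
      \<le> (\<Sum>x\<in>A. (sqrt (w x) * f x)\<^sup>2) * (\<Sum>x\<in>A. (sqrt (w x) * g x)\<^sup>2)" by (rule Cauchy_Schwarz_ineq_sum)
  moreover have "(\<Sum>x\<in>A. (sqrt (w x) * f x) * (sqrt (w x) * g x)) = (\<Sum>x\<in>A. w x * (f x * g x))"
    using w by (intro sum.cong) (auto simp: mult.assoc[symmetric] mult.commute[of "f _" "sqrt _"])
  moreover have "(\<Sum>x\<in>A. (sqrt (w x) * h x)\<^sup>2) = (\<Sum>x\<in>A. w x * (h x)\<^sup>2)" for h
    using w by (intro sum.cong) (auto simp: power_mult_distrib)
  ultimately show ?thesis by simp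
qed

section \<open>Greedy refinement\<close>

text \<open>The integral over a rectangle of the kernel minus its quotient; the largest absolute
  value over all rectangles is the cut norm of this difference.\<close>

definition cut_diff :: "nat set \<Rightarrow> (nat \<Rightarrow> real) \<Rightarrow> (nat \<Rightarrow> nat \<Rightarrow> real) \<Rightarrow> (nat \<Rightarrow> nat) \<Rightarrow> nat set \<Rightarrow> nat set \<Rightarrow> real"
  where "cut_diff I w e \<pi> S T = (\<Sum>x\<in>S. \<Sum>y\<in>T. w x * w y * (dens w e x y - quot_dens I w e \<pi> x y))"

text \<open>The classes are split by a pair of sets with the largest cut difference; the last base-4 digit
  of \<open>\<pi>'\<close> records the membership in the two sets.\<close>

lemma greedy_step:
  assumes k: "kernel I w e"
  shows "\<exists>\<pi>' \<kappa>. (\<forall>x. \<pi>' x div 4 = \<pi> x) \<and> 0 \<le> \<kappa> \<and> (\<forall>S T. S \<subseteq> I \<longrightarrow> T \<subseteq> I \<longrightarrow> \<bar>cut_diff I w e \<pi> S T\<bar> \<le> \<kappa>) \<and>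
    quot_energy (\<pi> ` I) I w e \<pi> + \<kappa>\<^sup>2 \<le> quot_energy (\<pi>' ` I) I w e \<pi>'"
proof -
  note fin = kernelD(1)[OF k]
  define C where "C = (\<lambda>(S, T). \<bar>cut_diff I w e \<pi> S T\<bar>) ` (Pow I \<times> Pow I)"
  have finC: "finite C" "C \<noteq> {}" using fin by (auto simp: C_def)
  have "Max C \<in> C" using finC by (rule Max_in)
  then obtain S T where ST: "S \<subseteq> I" "T \<subseteq> I" "Max C = \<bar>cut_diff I w e \<pi> S T\<bar>" by (auto simp: C_def)
  have max: "\<bar>cut_diff I w e \<pi> S' T'\<bar> \<le> Max C" if "S' \<subseteq> I" "T' \<subseteq> I" for S' T'
    using finC that by (intro Max_ge) (auto simp: C_def)
  define \<pi>' where "\<pi>' x = 4 * \<pi> x + ((if x \<in> S then 2 else 0) + (if x \<in> T then 1 else 0))" for x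
  have div: "\<pi>' x div 4 = \<pi> x" for x by (simp add: \<pi>'_def)
  have "\<pi>' x mod 4 = (if x \<in> S then 2 else 0) + (if x \<in> T then 1 else 0)" for x by (simp add: \<pi>'_def)
  then have iS: "x \<in> S \<longleftrightarrow> 2 \<le> \<pi>' x mod 4" and iT: "x \<in> T \<longleftrightarrow> odd (\<pi>' x mod 4)" for x by auto
  \<comment> \<open>The indicator of the rectangle, expressed through the new colours.\<close>
  define g where "g a b = (if 2 \<le> a mod 4 \<and> odd (b mod 4) then 1 else 0 :: real)" for a b :: nat
  let ?d = "quot_dens I w e \<pi>" and ?d' = "quot_dens I w e \<pi>'"
  have "cut_diff I w e \<pi> S T = (\<Sum>x\<in>I. \<Sum>y\<in>I. w x * w y * (dens w e x y - ?d x y) * g (\<pi>' x) (\<pi>' y))"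
  proof -
    have "cut_diff I w e \<pi> S T = (\<Sum>x\<in>I. \<Sum>y\<in>T. if x \<in> S then w x * w y * (dens w e x y - ?d x y) else 0)"
      unfolding cut_diff_def using fin ST by (intro sum.mono_neutral_cong_left) (auto simp: finite_subset)
    also have "\<dots> = (\<Sum>x\<in>I. \<Sum>y\<in>I. w x * w y * (dens w e x y - ?d x y) * g (\<pi>' x) (\<pi>' y))"
      using fin ST by (intro sum.cong refl sum.mono_neutral_cong_left) (auto simp: g_def iS iT)
    finally show ?thesis .
  qed
  also have "\<dots> = (\<Sum>x\<in>I. \<Sum>y\<in>I. e x y * g (\<pi>' x) (\<pi>' y)) - (\<Sum>x\<in>I. \<Sum>y\<in>I. w x * w y * (?d x y * g (\<pi>' x) (\<pi>' y)))"
    unfolding sum_subtractf[symmetric]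
  proof (intro sum.cong refl)
    fix x y assume "x \<in> I" "y \<in> I"
    from kernel_dens(3)[OF k this]
    show "w x * w y * (dens w e x y - ?d x y) * g (\<pi>' x) (\<pi>' y)
      = e x y * g (\<pi>' x) (\<pi>' y) - w x * w y * (?d x y * g (\<pi>' x) (\<pi>' y))"
      by (metis left_diff_distrib' mult.assoc right_diff_distrib')
  qed
  \<comment> \<open>Since \<open>g\<close> depends only on the new colours, the kernel may be
    replaced by its new quotient density. Cauchy-Schwarz then bounds the squared cut difference by
    the energy gain.\<close>
  also have "\<dots> = (\<Sum>x\<in>I. \<Sum>y\<in>I. w x * w y * ((?d' x y - ?d x y) * g (\<pi>' x) (\<pi>' y)))"
    unfolding sum_kernel_quot_dens[OF k, of g \<pi>'] sum_subtractf[symmetric] by (simp add: algebra_simps)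
  also have "\<dots> = (\<Sum>z\<in>I \<times> I. (w (fst z) * w (snd z)) * ((?d' (fst z) (snd z) - ?d (fst z) (snd z)) * g (\<pi>' (fst z)) (\<pi>' (snd z))))"
    by (simp add: sum.cartesian_product case_prod_unfold)
  finally have "(cut_diff I w e \<pi> S T)\<^sup>2 \<le>
      (\<Sum>z\<in>I \<times> I. (w (fst z) * w (snd z)) * (?d' (fst z) (snd z) - ?d (fst z) (snd z))\<^sup>2) *
      (\<Sum>z\<in>I \<times> I. (w (fst z) * w (snd z)) * (g (\<pi>' (fst z)) (\<pi>' (snd z)))\<^sup>2)" (is "_ \<le> ?a * ?b")
    using kernelD(2)[OF k] by (auto intro!: weighted_cauchy_schwarz)
  also have "\<dots> \<le> ?a * 1"
  proof (rule mult_left_mono)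
    have "?b \<le> (\<Sum>z\<in>I \<times> I. (w (fst z) * w (snd z)) * 1)"
      using kernelD(2)[OF k] by (intro sum_mono mult_left_mono) (auto simp: g_def)
    also have "\<dots> = (\<Sum>x\<in>I. \<Sum>y\<in>I. w x * w y)" by (simp add: sum.cartesian_product case_prod_unfold)
    also have "\<dots> = 1" using kernelD(3)[OF k] by (simp add: sum_product[symmetric])
    finally show "?b \<le> 1" .
    show "0 \<le> ?a" using kernelD(2)[OF k] by (intro sum_nonneg mult_nonneg_nonneg) auto
  qed
  also have "?a * 1 = (\<Sum>x\<in>I. \<Sum>y\<in>I. w x * w y * (?d' x y - ?d x y)\<^sup>2)"
    by (simp add: sum.cartesian_product case_prod_unfold)
  also have "\<dots> = quot_energy (\<pi>' ` I) I w e \<pi>' - quot_energy (\<pi> ` I) I w e \<pi>"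
    using fin by (intro energy_pythagoras[OF k, where \<tau> = "\<lambda>a. a div 4"]) (auto simp: div)
  finally have "(Max C)\<^sup>2 \<le> quot_energy (\<pi>' ` I) I w e \<pi>' - quot_energy (\<pi> ` I) I w e \<pi>"
    by (simp add: ST(3))
  then show ?thesis using div max by (intro exI[of _ \<pi>'] exI[of _ "Max C"]) (auto simp: ST(3))
qed

text \<open>The bound \<open>4 ^ r\<close> on the colours is the same for all kernels. The last
  clause is the energy budget: it survives limits and forces the cut differences of the limit to 0,
  although no rate is known for a fixed step.\<close>

definition greedy :: "nat set \<Rightarrow> (nat \<Rightarrow> real) \<Rightarrow> (nat \<Rightarrow> nat \<Rightarrow> real) \<Rightarrow> (nat \<Rightarrow> nat \<Rightarrow> nat) \<Rightarrow> (nat \<Rightarrow> real) \<Rightarrow> bool"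
  where "greedy I w e col \<kappa> \<longleftrightarrow> (\<forall>r x. col r x < 4 ^ r) \<and> (\<forall>r x. col (Suc r) x div 4 = col r x) \<and>
    (\<forall>r. 0 \<le> \<kappa> r) \<and> (\<forall>r S T. S \<subseteq> I \<longrightarrow> T \<subseteq> I \<longrightarrow> \<bar>cut_diff I w e (col r) S T\<bar> \<le> \<kappa> r) \<and>
    (\<forall>R. (\<Sum>r<R. (\<kappa> r)\<^sup>2) \<le> 1)"

text \<open>The energy gains telescope, and energies lie between 0 and 1.\<close>

lemma greedy_exists:
  assumes k: "kernel I w e"
  shows "\<exists>col \<kappa>. greedy I w e col \<kappa>"
proof -
  define En where "En \<pi> = quot_energy (\<pi> ` I) I w e \<pi>" for \<pi>
  obtain nx kap where nk: "\<And>\<pi> x. nx \<pi> x div 4 = \<pi> x" "\<And>\<pi>. 0 \<le> kap \<pi>"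
    "\<And>\<pi> S T. S \<subseteq> I \<Longrightarrow> T \<subseteq> I \<Longrightarrow> \<bar>cut_diff I w e \<pi> S T\<bar> \<le> kap \<pi>"
    "\<And>\<pi>. En \<pi> + (kap \<pi>)\<^sup>2 \<le> En (nx \<pi>)" using greedy_step[OF k] unfolding En_def by metis
  define col where "col r = (nx ^^ r) (\<lambda>_. 0)" for r
  have col_Suc: "col (Suc r) = nx (col r)" for r by (simp add: col_def)
  have lt: "col r x < 4 ^ r" for r x
  proof (induction r)
    case (Suc r)
    then have "col (Suc r) x div 4 < 4 ^ r" by (simp add: col_Suc nk)
    then show ?case by (simp add: div_less_iff_less_mult mult.commute)
  qed (simp add: col_def)
  have En: "0 \<le> En \<pi>" "En \<pi> \<le> 1" for \<pi>
    unfolding En_def using kernelD(1)[OF k] by (auto intro!: energy_bounds kernel_quot[OF k])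
  have "(\<Sum>r<R. (kap (col r))\<^sup>2) \<le> En (col R)" for R
  proof (induction R)
    case (Suc R)
    then show ?case using nk(4)[of "col R"] by (simp add: col_Suc)
  qed (simp add: En)
  then have "(\<Sum>r<R. (kap (col r))\<^sup>2) \<le> 1" for R using En(2) order_trans by blast
  then show ?thesis
    using lt nk by (intro exI[of _ col] exI[of _ "\<lambda>r. kap (col r)"]) (auto simp: greedy_def col_Suc)
qed

section \<open>The counting lemma\<close>

text \<open>The induced density in a finite weighted kernel whose vertices are sampled with
  repetition, hence by maps that need not be injective.\<close>

definition hom_dens :: "nat set \<Rightarrow> (nat \<Rightarrow> real) \<Rightarrow> nat set \<Rightarrow> nat set set \<Rightarrow> (nat \<Rightarrow> nat \<Rightarrow> real) \<Rightarrow> real" where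
  "hom_dens I w V E D = (\<Sum>\<phi>\<in>V \<rightarrow>\<^sub>E I. (\<Prod>v\<in>V. w (\<phi> v)) * bern (vpairs V) E (pair_val D \<phi>))"

lemma sum_PiE_insert:
  assumes "u \<notin> V"
  shows "(\<Sum>\<phi>\<in>insert u V \<rightarrow>\<^sub>E I. F \<phi>) = (\<Sum>x\<in>I. \<Sum>\<psi>\<in>V \<rightarrow>\<^sub>E I. F (\<psi>(u := x)))"
proof -
  have "inj_on (\<lambda>(y, g). g(u := y)) (I \<times> (V \<rightarrow>\<^sub>E I))" by (rule inj_combinator[OF assms])
  then show ?thesis
    unfolding PiE_insert_eq by (subst sum.reindex) (auto simp: sum.cartesian_product case_prod_unfold)
qed

lemma sum_PiE_prod:
  assumes "finite V" "finite I"
  shows "(\<Sum>\<phi>\<in>V \<rightarrow>\<^sub>E I. \<Prod>v\<in>V. w (\<phi> v)) = (\<Sum>x\<in>I. w x :: real) ^ card V"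
  using prod_sum_PiE[of V "\<lambda>_. I" "\<lambda>_. w"] assms by simp

text \<open>The sum is linear in \<open>f\<close> and in \<open>g\<close> separately, so each may be
  replaced by the indicator of the set where its coefficient is positive. The lower bound is the
  same argument for the negated \<open>B\<close>.\<close>

lemma cut_bilinear:
  fixes B :: "'a \<Rightarrow> 'a \<Rightarrow> real" and \<kappa> :: real
  assumes fin: "finite I" and B: "\<And>S T. S \<subseteq> I \<Longrightarrow> T \<subseteq> I \<Longrightarrow> \<bar>\<Sum>x\<in>S. \<Sum>y\<in>T. B x y\<bar> \<le> \<kappa>"
    and f: "\<And>x. x \<in> I \<Longrightarrow> 0 \<le> f x \<and> f x \<le> 1" and g: "\<And>x. x \<in> I \<Longrightarrow> 0 \<le> g x \<and> g x \<le> 1"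
  shows "\<bar>\<Sum>x\<in>I. \<Sum>y\<in>I. B x y * (f x * g y)\<bar> \<le> \<kappa>"
proof -
  have select: "(\<Sum>x\<in>I. a x * f x) \<le> (\<Sum>x\<in>{x\<in>I. 0 < a x}. a x)"
    if f: "\<And>x. x \<in> I \<Longrightarrow> 0 \<le> f x \<and> f x \<le> 1" for a f :: "'a \<Rightarrow> real"
  proof -
    have "(\<Sum>x\<in>I. a x * f x) \<le> (\<Sum>x\<in>I. if 0 < a x then a x else 0)"
      using f by (intro sum_mono) (auto simp: mult_left_le not_less mult_nonpos_nonneg)
    then show ?thesis using fin by (simp add: sum.If_cases Int_def)
  qed
  have one: "(\<Sum>x\<in>I. \<Sum>y\<in>I. B x y * (f x * g y)) \<le> \<kappa>"
    if B: "\<And>S T. S \<subseteq> I \<Longrightarrow> T \<subseteq> I \<Longrightarrow> \<bar>\<Sum>x\<in>S. \<Sum>y\<in>T. B x y\<bar> \<le> \<kappa>" for B :: "'a \<Rightarrow> 'a \<Rightarrow> real"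
  proof -
    define a where "a x = (\<Sum>y\<in>I. B x y * g y)" for x
    define S where "S = {x\<in>I. 0 < a x}"
    define b where "b y = (\<Sum>x\<in>S. B x y)" for y
    have "(\<Sum>x\<in>I. \<Sum>y\<in>I. B x y * (f x * g y)) = (\<Sum>x\<in>I. a x * f x)"
      by (simp add: a_def sum_distrib_left sum_distrib_right mult_ac)
    also have "\<dots> \<le> (\<Sum>x\<in>S. a x)" unfolding S_def by (rule select[OF f])
    also have "\<dots> = (\<Sum>y\<in>I. b y * g y)" unfolding a_def b_def sum_distrib_right by (rule sum.swap)
    also have "\<dots> \<le> (\<Sum>y\<in>{y\<in>I. 0 < b y}. b y)" by (rule select[OF g])
    also have "\<dots> = (\<Sum>x\<in>S. \<Sum>y\<in>{y\<in>I. 0 < b y}. B x y)" unfolding b_def by (rule sum.swap)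
    also have "\<dots> \<le> \<kappa>" using B[of S "{y\<in>I. 0 < b y}"] by (auto simp: S_def abs_le_iff)
    finally show ?thesis .
  qed
  have "(\<Sum>x\<in>I. \<Sum>y\<in>I. - B x y * (f x * g y)) \<le> \<kappa>" using B by (intro one) (simp add: sum_negf)
  then show ?thesis using one[OF B] by (simp add: sum_negf abs_le_iff)
qed

lemma bern_eq_prod:
  assumes "finite P" "E \<subseteq> P"
  shows "bern P E x = (\<Prod>e\<in>P. if e \<in> E then x e else 1 - x e)"
proof -
  have "P \<inter> E = E" using assms by auto
  then show ?thesis using assms by (simp add: bern_def prod.If_cases Diff_eq)
qed

text \<open>When the images of all vertices but the ends \<open>u\<close>, \<open>v\<close> of one edge are fixed, the factors of the
  other edges form a product of a function of the image of \<open>u\<close> and a function of the image of \<open>v\<close>.\<close>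

lemma counting_step:
  fixes \<kappa> :: real
  assumes fin: "finite I" and w: "\<And>x. x \<in> I \<Longrightarrow> 0 \<le> w x" "(\<Sum>x\<in>I. w x) = 1" and V: "finite V"
    and B: "\<And>S T. S \<subseteq> I \<Longrightarrow> T \<subseteq> I \<Longrightarrow> \<bar>\<Sum>x\<in>S. \<Sum>y\<in>T. w x * w y * B x y\<bar> \<le> \<kappa>"
    and z: "\<And>e x y. x \<in> I \<Longrightarrow> y \<in> I \<Longrightarrow> 0 \<le> z e x y \<and> z e x y \<le> (1::real)"
    and e0: "e0 \<in> vpairs V"
  shows "\<bar>\<Sum>\<phi>\<in>V \<rightarrow>\<^sub>E I. (\<Prod>v\<in>V. w (\<phi> v)) * (pair_val B \<phi> e0 * (\<Prod>e\<in>vpairs V - {e0}. pair_val (z e) \<phi> e))\<bar> \<le> \<kappa>"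
proof -
  obtain u v where uv: "u \<in> V" "v \<in> V" "u < v" "e0 = {u, v}" "Min e0 = u" "Max e0 = v"
    using e0 by (rule vpairsE)
  define V' where "V' = V - {u, v}"
  have V': "V = insert v (insert u V')" "u \<notin> V'" "v \<notin> insert u V'" "finite V'"
    using uv V by (auto simp: V'_def)
  let ?P = "vpairs V - {e0}"
  define Pu where "Pu = {e\<in>?P. u \<in> e}"
  define Pv where "Pv = {e\<in>?P. u \<notin> e}"
  have P: "?P = Pu \<union> Pv" "Pu \<inter> Pv = {}" "finite Pu" "finite Pv"
    using V by (auto simp: Pu_def Pv_def vpairs_finite)
  have mm: "Min e \<in> e" "Max e \<in> e" if "e \<in> vpairs V" for e using that by (auto elim!: vpairsE)
  \<comment> \<open>A pair containing both ends is \<open>e0\<close> itself; so the factors in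
    \<open>Pu\<close> do not involve \<open>v\<close>, and those in \<open>Pv\<close> do not involve
    \<open>u\<close>.\<close>
  have nv: "v \<notin> e" if "e \<in> Pu" for e using that uv by (auto simp: Pu_def elim!: vpairsE)
  define f where "f \<psi> x = (\<Prod>e\<in>Pu. pair_val (z e) (\<psi>(u := x)) e)" for \<psi> x
  define g where "g \<psi> y = (\<Prod>e\<in>Pv. pair_val (z e) (\<psi>(v := y)) e)" for \<psi> y
  have split: "(\<Prod>e\<in>?P. pair_val (z e) (\<psi>(u := x, v := y)) e) = f \<psi> x * g \<psi> y" for \<psi> x y
  proof -
    have "pair_val (z e) (\<psi>(u := x, v := y)) e = pair_val (z e) (\<psi>(u := x)) e" if "e \<in> Pu" for e
      using nv[OF that] mm[of e] that by (auto simp: pair_val_def Pu_def)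
    moreover have "pair_val (z e) (\<psi>(u := x, v := y)) e = pair_val (z e) (\<psi>(v := y)) e" if "e \<in> Pv" for e
      using mm[of e] that by (auto simp: pair_val_def Pv_def)
    ultimately show ?thesis unfolding P(1) f_def g_def by (subst prod.union_disjoint[OF P(3,4,2)]) simp
  qed
  have prod01: "0 \<le> (\<Prod>e\<in>X. pair_val (z e) \<phi> e) \<and> (\<Prod>e\<in>X. pair_val (z e) \<phi> e) \<le> 1"
    if X: "\<And>e. e \<in> X \<Longrightarrow> e \<in> vpairs V \<and> e \<subseteq> A" and A: "\<And>a. a \<in> A \<Longrightarrow> \<phi> a \<in> I" for X A \<phi>
  proof -
    have "0 \<le> pair_val (z e) \<phi> e \<and> pair_val (z e) \<phi> e \<le> 1" if "e \<in> X" for e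
      unfolding pair_val_def using X[OF that] mm[of e] A by (intro z) auto
    then show ?thesis by (auto intro!: prod_nonneg prod_le_1)
  qed
  have f01: "0 \<le> f \<psi> x \<and> f \<psi> x \<le> 1" if "x \<in> I" "\<psi> \<in> V' \<rightarrow>\<^sub>E I" for \<psi> x unfolding f_def
  proof (rule prod01[where A = "insert u V'"])
    show "e \<in> vpairs V \<and> e \<subseteq> insert u V'" if "e \<in> Pu" for e
      using nv[OF that] that by (auto simp: Pu_def vpairs_def V'_def)
  qed (use that in auto)
  have g01: "0 \<le> g \<psi> y \<and> g \<psi> y \<le> 1" if "y \<in> I" "\<psi> \<in> V' \<rightarrow>\<^sub>E I" for \<psi> y unfolding g_def
  proof (rule prod01[where A = "insert v V'"])
    show "e \<in> vpairs V \<and> e \<subseteq> insert v V'" if "e \<in> Pv" for e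
      using that by (auto simp: Pv_def vpairs_def V'_def)
  qed (use that in auto)
  have wprod: "(\<Prod>i\<in>V. w ((\<psi>(u := x, v := y)) i)) = w x * w y * (\<Prod>i\<in>V'. w (\<psi> i))" for \<psi> x y
  proof -
    have "(\<Prod>i\<in>V'. w ((\<psi>(u := x, v := y)) i)) = (\<Prod>i\<in>V'. w (\<psi> i))" using V' by (intro prod.cong) auto
    then show ?thesis using V' uv by (simp add: mult_ac)
  qed
  have "(\<Sum>\<phi>\<in>V \<rightarrow>\<^sub>E I. (\<Prod>v\<in>V. w (\<phi> v)) * (pair_val B \<phi> e0 * (\<Prod>e\<in>?P. pair_val (z e) \<phi> e)))
      = (\<Sum>y\<in>I. \<Sum>x\<in>I. \<Sum>\<psi>\<in>V' \<rightarrow>\<^sub>E I. (w x * w y * (\<Prod>i\<in>V'. w (\<psi> i))) * (B x y * (f \<psi> x * g \<psi> y)))"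
  proof -
    have b: "pair_val B (\<psi>(u := x, v := y)) e0 = B x y" for \<psi> x y using uv by (simp add: pair_val_def)
    show ?thesis by (subst V'(1), subst sum_PiE_insert[OF V'(3)], subst sum_PiE_insert[OF V'(2)])
        (simp only: wprod split b)
  qed
  also have "\<dots> = (\<Sum>\<psi>\<in>V' \<rightarrow>\<^sub>E I. (\<Prod>i\<in>V'. w (\<psi> i)) * (\<Sum>x\<in>I. \<Sum>y\<in>I. w x * w y * B x y * (f \<psi> x * g \<psi> y)))"
    unfolding sum_distrib_left
    by (subst sum.swap, subst sum.swap[of _ "V' \<rightarrow>\<^sub>E I"], subst sum.swap[of _ "V' \<rightarrow>\<^sub>E I"])
      (simp add: mult_ac)
  also have "\<bar>\<dots>\<bar> \<le> (\<Sum>\<psi>\<in>V' \<rightarrow>\<^sub>E I. (\<Prod>i\<in>V'. w (\<psi> i)) * \<kappa>)"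
  proof (rule order_trans[OF sum_abs sum_mono])
    fix \<psi> assume \<psi>: "\<psi> \<in> V' \<rightarrow>\<^sub>E I"
    have "0 \<le> (\<Prod>i\<in>V'. w (\<psi> i))" using \<psi> w by (intro prod_nonneg) auto
    moreover have "\<bar>\<Sum>x\<in>I. \<Sum>y\<in>I. w x * w y * B x y * (f \<psi> x * g \<psi> y)\<bar> \<le> \<kappa>"
      using f01[OF _ \<psi>] g01[OF _ \<psi>] by (intro cut_bilinear[OF fin B])
    ultimately show "\<bar>(\<Prod>i\<in>V'. w (\<psi> i)) * (\<Sum>x\<in>I. \<Sum>y\<in>I. w x * w y * B x y * (f \<psi> x * g \<psi> y))\<bar>
      \<le> (\<Prod>i\<in>V'. w (\<psi> i)) * \<kappa>" by (simp add: abs_mult mult_left_mono)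
  qed
  also have "\<dots> = \<kappa>" unfolding sum_distrib_right[symmetric] by (simp add: sum_PiE_prod V' fin w)
  finally show ?thesis .
qed

text \<open>The pairs are exchanged one at a time: \<open>Z R\<close> uses \<open>D\<close> on
  \<open>R\<close> and \<open>D'\<close> elsewhere. A non-edge only flips the sign of the
  difference, so each exchange costs at most \<kappa>.\<close>

lemma counting_lemma:
  fixes \<kappa> :: real
  assumes fin: "finite I" and w: "\<And>x. x \<in> I \<Longrightarrow> 0 \<le> w x" "(\<Sum>x\<in>I. w x) = 1"
    and V: "finite V" and E: "E \<subseteq> vpairs V"
    and D: "\<And>x y. x \<in> I \<Longrightarrow> y \<in> I \<Longrightarrow> 0 \<le> D x y \<and> D x y \<le> 1"
    and D': "\<And>x y. x \<in> I \<Longrightarrow> y \<in> I \<Longrightarrow> 0 \<le> D' x y \<and> D' x y \<le> 1"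
    and cut: "\<And>S T. S \<subseteq> I \<Longrightarrow> T \<subseteq> I \<Longrightarrow> \<bar>\<Sum>x\<in>S. \<Sum>y\<in>T. w x * w y * (D x y - D' x y)\<bar> \<le> \<kappa>"
  shows "\<bar>hom_dens I w V E D - hom_dens I w V E D'\<bar> \<le> card (vpairs V) * \<kappa>"
proof -
  let ?P = "vpairs V"
  have finP: "finite ?P" using V by (rule vpairs_finite)
  define Z where "Z R e x y = (if e \<in> E then (if e \<in> R then D x y else D' x y)
    else 1 - (if e \<in> R then D x y else D' x y))" for R e x y
  define H where "H R = (\<Sum>\<phi>\<in>V \<rightarrow>\<^sub>E I. (\<Prod>v\<in>V. w (\<phi> v)) * (\<Prod>e\<in>?P. pair_val (Z R e) \<phi> e))" for R
  have "\<bar>H R - H {}\<bar> \<le> card R * \<kappa>" if "finite R" "R \<subseteq> ?P" for R using that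
  proof (induction R rule: finite_induct)
    case (insert e0 R)
    define s where "s = (if e0 \<in> E then 1 else - 1 :: real)"
    define B where "B x y = s * (D x y - D' x y)" for x y
    have e0: "e0 \<in> ?P" using insert by simp
    have step: "(\<Prod>e\<in>?P. pair_val (Z (insert e0 R) e) \<phi> e) - (\<Prod>e\<in>?P. pair_val (Z R e) \<phi> e)
        = pair_val B \<phi> e0 * (\<Prod>e\<in>?P - {e0}. pair_val (Z R e) \<phi> e)" for \<phi>
    proof -
      have "(\<Prod>e\<in>?P - {e0}. pair_val (Z (insert e0 R) e) \<phi> e) = (\<Prod>e\<in>?P - {e0}. pair_val (Z R e) \<phi> e)"
        by (intro prod.cong refl) (auto simp: pair_val_def Z_def)
      moreover have "pair_val (Z (insert e0 R) e0) \<phi> e0 - pair_val (Z R e0) \<phi> e0 = pair_val B \<phi> e0"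
        using insert by (auto simp: pair_val_def Z_def B_def s_def)
      ultimately show ?thesis by (simp add: prod.remove[OF finP e0] left_diff_distrib[symmetric])
    qed
    have "H (insert e0 R) - H R = (\<Sum>\<phi>\<in>V \<rightarrow>\<^sub>E I. (\<Prod>v\<in>V. w (\<phi> v)) * (pair_val B \<phi> e0 * (\<Prod>e\<in>?P - {e0}. pair_val (Z R e) \<phi> e)))"
      unfolding H_def step[symmetric] by (simp add: sum_subtractf right_diff_distrib)
    also have "\<bar>\<dots>\<bar> \<le> \<kappa>"
    proof (rule counting_step[OF fin w V _ _ e0])
      fix S T assume ST: "S \<subseteq> I" "T \<subseteq> I"
      have "(\<Sum>x\<in>S. \<Sum>y\<in>T. w x * w y * B x y) = s * (\<Sum>x\<in>S. \<Sum>y\<in>T. w x * w y * (D x y - D' x y))"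
        by (simp add: B_def sum_distrib_left mult_ac)
      then show "\<bar>\<Sum>x\<in>S. \<Sum>y\<in>T. w x * w y * B x y\<bar> \<le> \<kappa>" using cut[OF ST] by (simp add: abs_mult s_def)
    next
      show "0 \<le> Z R e x y \<and> Z R e x y \<le> 1" if "x \<in> I" "y \<in> I" for e x y
        using D[OF that] D'[OF that] by (auto simp: Z_def)
    qed
    finally show ?case using insert by (simp add: algebra_simps)
  qed simp
  from this[OF finP order_refl] have "\<bar>H ?P - H {}\<bar> \<le> card ?P * \<kappa>" .
  moreover have "H ?P = hom_dens I w V E D" "H {} = hom_dens I w V E D'"
    unfolding H_def hom_dens_def bern_eq_prod[OF finP E]
    by (intro sum.cong refl arg_cong2[where f = times] prod.cong; simp add: Z_def pair_val_def)+
  ultimately show ?thesis by simp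
qed

section \<open>Limits of kernels\<close>

text \<open>The kernel sees points only through their classes, so the maps can be grouped by their
  composites with \<pi>; each group has the product of the class weights.\<close>

lemma hom_dens_quot:
  assumes k: "kernel I w e" and J: "finite J" "\<pi> ` I \<subseteq> J" and V: "finite V" and E: "E \<subseteq> vpairs V"
  shows "hom_dens I w V E (\<lambda>x y. D (\<pi> x) (\<pi> y)) = hom_dens J (quot_w I w \<pi>) V E D"
proof -
  note fin = kernelD(1)[OF k]
  define c where "c \<phi> = (\<lambda>v\<in>V. \<pi> (\<phi> v))" for \<phi> :: "nat \<Rightarrow> nat"
  have D: "bern (vpairs V) E (pair_val (\<lambda>x y. D (\<pi> x) (\<pi> y)) \<phi>) = bern (vpairs V) E (pair_val D (c \<phi>))" for \<phi>
    using vpairs_Min_Max by (intro bern_cong[OF E]) (simp add: pair_val_def c_def)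
  have fib: "{\<phi>\<in>V \<rightarrow>\<^sub>E I. c \<phi> = a} = (\<Pi>\<^sub>E v\<in>V. {x\<in>I. \<pi> x = a v})" if "a \<in> V \<rightarrow>\<^sub>E J" for a
  proof (intro equalityI subsetI)
    fix \<phi> assume \<phi>: "\<phi> \<in> {\<phi>\<in>V \<rightarrow>\<^sub>E I. c \<phi> = a}"
    then show "\<phi> \<in> (\<Pi>\<^sub>E v\<in>V. {x\<in>I. \<pi> x = a v})" by (auto simp: PiE_iff c_def)
  next
    fix \<phi> assume \<phi>: "\<phi> \<in> (\<Pi>\<^sub>E v\<in>V. {x\<in>I. \<pi> x = a v})"
    then have "c \<phi> = a" using that by (intro ext) (auto simp: PiE_iff c_def extensional_def)
    then show "\<phi> \<in> {\<phi>\<in>V \<rightarrow>\<^sub>E I. c \<phi> = a}" using \<phi> by (auto simp: PiE_iff)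
  qed
  have "hom_dens I w V E (\<lambda>x y. D (\<pi> x) (\<pi> y))
      = (\<Sum>a\<in>V \<rightarrow>\<^sub>E J. \<Sum>\<phi>\<in>{\<phi>\<in>V \<rightarrow>\<^sub>E I. c \<phi> = a}. (\<Prod>v\<in>V. w (\<phi> v)) * bern (vpairs V) E (pair_val D (c \<phi>)))"
    unfolding hom_dens_def D using V fin J
    by (intro sum.group[symmetric] finite_PiE) (auto simp: c_def image_subset_iff dest: PiE_mem)
  also have "\<dots> = (\<Sum>a\<in>V \<rightarrow>\<^sub>E J. (\<Sum>\<phi>\<in>(\<Pi>\<^sub>E v\<in>V. {x\<in>I. \<pi> x = a v}). \<Prod>v\<in>V. w (\<phi> v)) * bern (vpairs V) E (pair_val D a))"
    unfolding sum_distrib_right by (intro sum.cong refl) (auto simp: fib[symmetric])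
  also have "\<dots> = hom_dens J (quot_w I w \<pi>) V E D" unfolding hom_dens_def quot_w_def using V fin
    by (intro sum.cong refl arg_cong2[where f = times] prod_sum_PiE[symmetric]) auto
  finally show ?thesis .
qed

text \<open>\<open>dens\<close> need not converge where a limiting weight is 0. There the product of
  the weights tends to 0 while the Bernoulli factor stays bounded.\<close>

lemma hom_dens_tendsto:
  assumes k: "\<And>i. kernel J (w i) (e i)" and k': "kernel J w' e'"
    and w: "\<And>a. (\<lambda>i. w i a) \<longlonglongrightarrow> w' a" and e: "\<And>a b. (\<lambda>i. e i a b) \<longlonglongrightarrow> e' a b"
    and V: "finite V" and E: "E \<subseteq> vpairs V"
  shows "(\<lambda>i. hom_dens J (w i) V E (dens (w i) (e i))) \<longlonglongrightarrow> hom_dens J w' V E (dens w' e')"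
  unfolding hom_dens_def
proof (rule tendsto_sum)
  fix \<phi> assume \<phi>: "\<phi> \<in> V \<rightarrow>\<^sub>E J"
  have finP: "finite (vpairs V)" using V by (rule vpairs_finite)
  have W: "(\<lambda>i. \<Prod>v\<in>V. w i (\<phi> v)) \<longlonglongrightarrow> (\<Prod>v\<in>V. w' (\<phi> v))" by (intro tendsto_prod w)
  show "(\<lambda>i. (\<Prod>v\<in>V. w i (\<phi> v)) * bern (vpairs V) E (pair_val (dens (w i) (e i)) \<phi>))
    \<longlonglongrightarrow> (\<Prod>v\<in>V. w' (\<phi> v)) * bern (vpairs V) E (pair_val (dens w' e') \<phi>)"
  proof (cases "\<exists>v\<in>V. w' (\<phi> v) = 0")
    case True
    then have 0: "(\<Prod>v\<in>V. w' (\<phi> v)) = 0" using V by auto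
    have "0 \<le> bern (vpairs V) E (pair_val (dens (w i) (e i)) \<phi>) \<and>
      bern (vpairs V) E (pair_val (dens (w i) (e i)) \<phi>) \<le> 1" for i
    proof -
      have "0 \<le> pair_val (dens (w i) (e i)) \<phi> p \<and> pair_val (dens (w i) (e i)) \<phi> p \<le> 1" if "p \<in> vpairs V" for p
        using kernel_dens(1,2)[OF k PiE_mem[OF \<phi>] PiE_mem[OF \<phi>]] vpairs_Min_Max[OF that] by (simp add: pair_val_def)
      then show ?thesis using E by (auto intro!: bern_nonneg bern_le_1)
    qed
    then have "norm ((\<Prod>v\<in>V. w i (\<phi> v)) * bern (vpairs V) E (pair_val (dens (w i) (e i)) \<phi>))
      \<le> norm (\<Prod>v\<in>V. w i (\<phi> v))" for i by (simp add: abs_mult mult_left_le)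
    with W[unfolded 0] have "(\<lambda>i. (\<Prod>v\<in>V. w i (\<phi> v)) * bern (vpairs V) E (pair_val (dens (w i) (e i)) \<phi>)) \<longlonglongrightarrow> 0"
      by (intro Lim_null_comparison[OF _ tendsto_norm_zero[OF W[unfolded 0]]]) simp
    then show ?thesis by (simp add: 0)
  next
    case False
    then have nz: "w' (\<phi> v) \<noteq> 0" if "v \<in> V" for v using that by auto
    have pv: "(\<lambda>i. pair_val (dens (w i) (e i)) \<phi> p) \<longlonglongrightarrow> pair_val (dens w' e') \<phi> p" if "p \<in> vpairs V" for p
      unfolding pair_val_def dens_def using vpairs_Min_Max[OF that] nz
      by (intro tendsto_divide tendsto_mult w e) auto
    show ?thesis
      unfolding bern_def using E finP by (intro tendsto_mult tendsto_prod tendsto_diff tendsto_const w pv) auto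
  qed
qed

lemma kernel_limit:
  assumes k: "\<And>i. kernel J (w i) (e i)"
    and w: "\<And>a. (\<lambda>i. w i a) \<longlonglongrightarrow> w' a" and e: "\<And>a b. (\<lambda>i. e i a b) \<longlonglongrightarrow> e' a b"
  shows "kernel J w' e'"
  unfolding kernel_def
proof (intro conjI ballI)
  show "finite J" using kernelD(1)[OF k] .
  show "0 \<le> w' x" if "x \<in> J" for x using kernelD(2)[OF k that] by (intro LIMSEQ_le_const[OF w]) auto
  have "(\<lambda>i. \<Sum>x\<in>J. w i x) \<longlonglongrightarrow> (\<Sum>x\<in>J. w' x)" by (intro tendsto_sum w)
  then show "(\<Sum>x\<in>J. w' x) = 1" using kernelD(3)[OF k] by (simp add: LIMSEQ_const_iff)
  show "0 \<le> e' x y" if "x \<in> J" "y \<in> J" for x y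
    using kernelD(4)[OF k that] by (intro LIMSEQ_le_const[OF e]) auto
  show "e' x y \<le> w' x * w' y" if "x \<in> J" "y \<in> J" for x y
    using kernelD(5)[OF k that] by (intro LIMSEQ_le[OF e tendsto_mult[OF w w]]) auto
qed

lemma quot_w_quot:
  assumes fin: "finite I" and J: "finite J" "\<pi> ` I \<subseteq> J" and \<rho>: "\<And>x. x \<in> I \<Longrightarrow> \<rho> x = \<tau> (\<pi> x)"
  shows "quot_w J (quot_w I w \<pi>) \<tau> a = quot_w I w \<rho> a"
proof -
  have "quot_w J (quot_w I w \<pi>) \<tau> a = (\<Sum>b\<in>{b\<in>J. \<tau> b = a}. \<Sum>x\<in>{x\<in>{x\<in>I. \<rho> x = a}. \<pi> x = b}. w x)"
    unfolding quot_w_def using \<rho> by (intro sum.cong) auto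
  also have "\<dots> = quot_w I w \<rho> a" unfolding quot_w_def using fin J \<rho> by (intro sum.group) auto
  finally show ?thesis .
qed

lemma quot_e_quot:
  assumes fin: "finite I" and J: "finite J" "\<pi> ` I \<subseteq> J" and \<rho>: "\<And>x. x \<in> I \<Longrightarrow> \<rho> x = \<tau> (\<pi> x)"
  shows "quot_e J (quot_e I e \<pi>) \<tau> a b = quot_e I e \<rho> a b"
proof -
  let ?J = "\<lambda>c. {x\<in>J. \<tau> x = c}" and ?I = "\<lambda>c. {x\<in>I. \<rho> x = c}"
  have *: "(\<Sum>c\<in>?J a. \<Sum>x\<in>{x\<in>?I a. \<pi> x = c}. F x) = (\<Sum>x\<in>?I a. F x :: real)" for F a
    using fin J \<rho> by (intro sum.group) auto
  have **: "{x\<in>I. \<pi> x = c} = {x\<in>?I a. \<pi> x = c}" if "c \<in> ?J a" for a c using that \<rho> by auto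
  have "quot_e J (quot_e I e \<pi>) \<tau> a b
      = (\<Sum>c\<in>?J a. \<Sum>d\<in>?J b. \<Sum>x\<in>{x\<in>?I a. \<pi> x = c}. \<Sum>y\<in>{y\<in>?I b. \<pi> y = d}. e x y)"
    unfolding quot_e_def by (intro sum.cong refl **)
  also have "\<dots> = (\<Sum>c\<in>?J a. \<Sum>x\<in>{x\<in>?I a. \<pi> x = c}. \<Sum>d\<in>?J b. \<Sum>y\<in>{y\<in>?I b. \<pi> y = d}. e x y)"
    by (intro sum.cong refl sum.swap)
  also have "\<dots> = quot_e I e \<rho> a b" unfolding * quot_e_def ..
  finally show ?thesis .
qed

section \<open>Graphs as kernels\<close>

abbreviation graph_w :: "nat \<Rightarrow> nat \<Rightarrow> real" where
  "graph_w n \<equiv> \<lambda>_. 1 / real n"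

definition graph_e :: "nat \<Rightarrow> nat set set \<Rightarrow> nat \<Rightarrow> nat \<Rightarrow> real" where
  "graph_e n F x y = of_bool ({x, y} \<in> F) / (real n)\<^sup>2"

lemma kernel_graph: "0 < n \<Longrightarrow> kernel {..<n} (graph_w n) (graph_e n F)"
  by (auto simp: kernel_def graph_e_def power2_eq_square)

lemma dens_graph: "0 < n \<Longrightarrow> dens (graph_w n) (graph_e n F) x y = of_bool ({x, y} \<in> F)"
  by (simp add: dens_def graph_e_def power2_eq_square)

text \<open>Such a map is recovered from its restriction to the points other than \<open>u\<close>,
  its value at \<open>u\<close> being the one at \<open>v\<close>.\<close>

lemma card_PiE_collision:
  assumes "finite V" "finite I" "u \<in> V" "v \<in> V" "u \<noteq> v"
  shows "card {\<phi>\<in>V \<rightarrow>\<^sub>E I. \<phi> u = \<phi> v} \<le> card I ^ (card V - 1)"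
proof -
  have "card {\<phi>\<in>V \<rightarrow>\<^sub>E I. \<phi> u = \<phi> v} \<le> card ((V - {u}) \<rightarrow>\<^sub>E I)"
  proof (rule card_inj_on_le[where f = "\<lambda>\<phi>. restrict \<phi> (V - {u})"])
    show "inj_on (\<lambda>\<phi>. restrict \<phi> (V - {u})) {\<phi>\<in>V \<rightarrow>\<^sub>E I. \<phi> u = \<phi> v}"
    proof (rule inj_onI)
      fix \<phi> \<psi> assume p: "\<phi> \<in> {\<phi>\<in>V \<rightarrow>\<^sub>E I. \<phi> u = \<phi> v}" "\<psi> \<in> {\<phi>\<in>V \<rightarrow>\<^sub>E I. \<phi> u = \<phi> v}"
        and eq: "restrict \<phi> (V - {u}) = restrict \<psi> (V - {u})"
      have *: "\<phi> x = \<psi> x" if "x \<in> V - {u}" for x using fun_cong[OF eq, of x] that by simp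
      have "\<phi> x = \<psi> x" if "x \<in> V" for x using *[of x] *[of v] that p assms by (cases "x = u") auto
      then show "\<phi> = \<psi>" using p by (auto intro: PiE_ext)
    qed
  qed (use assms in \<open>auto intro!: finite_PiE simp: PiE_iff split: if_splits\<close>)
  then show ?thesis using assms by (simp add: card_PiE)
qed

text \<open>Sampling with and without repetition differ by at most the probability of a collision,
  which the union bound over pairs estimates by \<open>(k choose 2) / n\<close>.\<close>

lemma hom_dens_graph:
  assumes n: "0 < n" and kn: "k \<le> n" and E: "E \<subseteq> pairs k"
  shows "\<bar>std_dens k E n F
    - hom_dens {..<n} (graph_w n) {..<k} E (dens (graph_w n) (graph_e n F))\<bar> \<le> real (k choose 2) / n"
proof -
  let ?A = "{..<k} \<rightarrow>\<^sub>E {..<n}" and ?B = "injs k n" and ?P = "pairs k"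
  have finA: "finite ?A" by (simp add: finite_PiE)
  have cardA: "card ?A = n ^ k" by (simp add: card_PiE)
  have BA: "?B \<subseteq> ?A" by (auto simp: injs_def)
  define a where "a = real (card {\<phi>\<in>?A. pull k \<phi> F = E})"
  define b where "b = real (card {\<phi>\<in>?B. pull k \<phi> F = E})"
  have "bern ?P E (pair_val (dens (graph_w n) (graph_e n F)) \<phi>) = of_bool (pull k \<phi> F = E)" for \<phi>
  proof -
    have pv: "pair_val (dens (graph_w n) (graph_e n F)) \<phi> e = of_bool (\<phi> ` e \<in> F)" if "e \<in> ?P" for e
      using that by (elim vpairsE) (simp add: pair_val_def dens_graph[OF n])
    have "bern ?P E (pair_val (dens (graph_w n) (graph_e n F)) \<phi>) = (\<Prod>e\<in>?P. of_bool (e \<in> E \<longleftrightarrow> \<phi> ` e \<in> F))"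
      unfolding bern_eq_prod[OF finite_vpairs_lessThan E] using pv by (intro prod.cong) auto
    also have "\<dots> = of_bool (\<forall>e\<in>?P. e \<in> E \<longleftrightarrow> \<phi> ` e \<in> F)"
    proof (cases "\<forall>e\<in>?P. e \<in> E \<longleftrightarrow> \<phi> ` e \<in> F")
      case False
      then show ?thesis by (subst prod_zero) auto
    qed simp
    also have "(\<forall>e\<in>?P. e \<in> E \<longleftrightarrow> \<phi> ` e \<in> F) \<longleftrightarrow> pull k \<phi> F = E" using E by (auto simp: pull_def)
    finally show ?thesis .
  qed
  then have hom: "hom_dens {..<n} (graph_w n) {..<k} E (dens (graph_w n) (graph_e n F)) = a / real (card ?A)"
    using finA by (simp add: hom_dens_def a_def cardA sum_divide_distrib[symmetric] power_one_over
        sum.If_cases Int_def of_bool_def)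
  have ind: "std_dens k E n F = b / real (card ?B)" by (simp add: lgraph_density_eq[OF E kn] b_def)
  define d where "d = real (card ?A) - real (card ?B)"
  have B0: "0 < card ?B" using injs_nonempty[OF kn] finite_injs by (simp add: card_gt_0_iff)
  have ab: "b \<le> a" unfolding a_def b_def using finA BA by (intro of_nat_mono card_mono) auto
  have bB: "b \<le> real (card ?B)" unfolding b_def using finite_injs by (intro of_nat_mono card_mono) auto
  have "a \<le> b + d"
  proof -
    have "card {\<phi>\<in>?A. pull k \<phi> F = E} \<le> card ({\<phi>\<in>?B. pull k \<phi> F = E} \<union> (?A - ?B))"
      using finA finite_injs by (intro card_mono) auto
    also have "\<dots> \<le> card {\<phi>\<in>?B. pull k \<phi> F = E} + card (?A - ?B)" by (rule card_Un_le)
    also have "card (?A - ?B) = card ?A - card ?B" using BA finite_injs by (simp add: card_Diff_subset)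
    finally show ?thesis using card_mono[OF finA BA] by (simp add: a_def b_def d_def of_nat_diff)
  qed
  have d0: "0 \<le> d" using card_mono[OF finA BA] by (simp add: d_def)
  have "real (card ?A) = card ?B + d" by (simp add: d_def)
  have b0: "0 \<le> b" by (simp add: b_def)
  have A0: "0 < real (card ?A)" using n cardA by simp
  have "b / card ?A \<le> b / card ?B" using B0 b0 card_mono[OF finA BA] by (intro divide_left_mono) auto
  \<comment> \<open>Adding \<open>d\<close> to both parts of a fraction that is at most 1 does not
    decrease it.\<close>
  moreover have "b / card ?B \<le> (b + d) / card ?A"
  proof -
    have "b * card ?A \<le> (b + d) * card ?B"
      using mult_right_mono[OF bB d0] by (simp add: \<open>real (card ?A) = card ?B + d\<close> algebra_simps)
    then show ?thesis using A0 B0 by (simp add: field_simps)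
  qed
  moreover have "b / card ?A \<le> a / card ?A" "a / card ?A \<le> (b + d) / card ?A"
    using ab \<open>a \<le> b + d\<close> by (auto intro: divide_right_mono)
  moreover have "(b + d) / card ?A = b / card ?A + d / card ?A" by (simp add: add_divide_distrib)
  ultimately have "\<bar>b / card ?B - a / card ?A\<bar> \<le> d / card ?A" by linarith
  also have "d \<le> real (k choose 2) * real n ^ (k - 1)"
  proof -
    have "?A - ?B \<subseteq> (\<Union>e\<in>?P. {\<phi>\<in>?A. \<phi> (Min e) = \<phi> (Max e)})"
    proof
      fix \<phi> assume \<phi>: "\<phi> \<in> ?A - ?B"
      then obtain x y where xy: "x < k" "y < k" "x < y" "\<phi> x = \<phi> y"
        by (auto simp: injs_def inj_on_def) (metis linorder_neqE_nat)
      then have "{x, y} \<in> ?P" by (auto simp: vpairs_def)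
      moreover have "Min {x, y} = x" "Max {x, y} = y" using xy by auto
      ultimately show "\<phi> \<in> (\<Union>e\<in>?P. {\<phi>\<in>?A. \<phi> (Min e) = \<phi> (Max e)})"
        using xy \<phi> by (intro UN_I[of "{x, y}"]) auto
    qed
    then have "card (?A - ?B) \<le> card (\<Union>e\<in>?P. {\<phi>\<in>?A. \<phi> (Min e) = \<phi> (Max e)})"
      using finA by (intro card_mono) auto
    also have "\<dots> \<le> (\<Sum>e\<in>?P. card {\<phi>\<in>?A. \<phi> (Min e) = \<phi> (Max e)})" by (rule card_UN_le) simp
    also have "\<dots> \<le> (\<Sum>e\<in>?P. n ^ (k - 1))"
    proof (rule sum_mono)
      fix e assume "e \<in> ?P"
      from card_PiE_collision[OF _ _ vpairs_Min_Max[OF this], of "{..<n}"]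
      show "card {\<phi>\<in>?A. \<phi> (Min e) = \<phi> (Max e)} \<le> n ^ (k - 1)" by simp
    qed
    also have "\<dots> = (k choose 2) * n ^ (k - 1)" by (simp add: card_vpairs_lessThan)
    finally have "real (card (?A - ?B)) \<le> real ((k choose 2) * n ^ (k - 1))" by (rule of_nat_mono)
    moreover have "real (card (?A - ?B)) = d"
      using BA finite_injs card_mono[OF finA BA] by (simp add: card_Diff_subset d_def of_nat_diff)
    ultimately show ?thesis by simp
  qed
  also have "real (k choose 2) * real n ^ (k - 1) / card ?A = real (k choose 2) / n"
  proof (cases "k = 0")
    case False
    then have "real n ^ k = real n * real n ^ (k - 1)" by (simp add: power_eq_if)
    then show ?thesis using n by (simp add: cardA)
  qed (simp add: binomial_eq_0)
  finally show ?thesis unfolding hom ind using A0 by (simp add: divide_right_mono)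
qed

section \<open>Towers of refining kernels and diagonal selection\<close>

abbreviation level :: "nat \<Rightarrow> nat set" where
  "level r \<equiv> {..<4 ^ r}"

text \<open>Refining kernels of \<open>4 ^ r\<close> points; point \<open>a\<close> of level \<open>r\<close> splits into the points
  \<open>4 a, \<dots>, 4 a + 3\<close> of level \<open>r + 1\<close>.\<close>

locale kernel_tower =
  fixes w :: "nat \<Rightarrow> nat \<Rightarrow> real" and e :: "nat \<Rightarrow> nat \<Rightarrow> nat \<Rightarrow> real"
  assumes kern: "kernel (level r) (w r) (e r)"
    and e_sym: "e r a b = e r b a"
    and w_quot: "r \<le> r' \<Longrightarrow> a < 4 ^ r \<Longrightarrow> w r a = quot_w (level r') (w r') (\<lambda>x. x div 4 ^ (r' - r)) a"
    and e_quot: "r \<le> r' \<Longrightarrow> a < 4 ^ r \<Longrightarrow> b < 4 ^ r \<Longrightarrow>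
      e r a b = quot_e (level r') (e r') (\<lambda>x. x div 4 ^ (r' - r)) a b"

abbreviation (in kernel_tower) level_dens :: "nat \<Rightarrow> nat \<Rightarrow> nat set set \<Rightarrow> real" where
  "level_dens r k E \<equiv> hom_dens (level r) (w r) {..<k} E (dens (w r) (e r))"

text \<open>For a fixed level three errors add up: collisions, which vanish with growing order; the
  greedy cut difference, through the counting lemma; and the convergence of the finitely many
  parameters of the level. Only the middle one persists as the graphs grow, and it vanishes with the
  level.\<close>

lemma graphs_kernel_tower:
  assumes n: "\<And>i. 0 < n i" and lim: "filterlim n at_top sequentially"
  obtains \<sigma> :: "nat \<Rightarrow> nat" and w e and \<kappa> :: "nat \<Rightarrow> real" where "strict_mono \<sigma>" "kernel_tower w e" "\<kappa> \<longlonglongrightarrow> 0"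
    "\<And>r k E (\<delta> :: real). E \<subseteq> pairs k \<Longrightarrow> 0 < \<delta> \<Longrightarrow> \<forall>\<^sub>F i in sequentially.
      \<bar>std_dens k E (n (\<sigma> i)) (F (\<sigma> i))
        - hom_dens (level r) (w r) {..<k} E (dens (w r) (e r))\<bar> \<le> (k choose 2) * \<kappa> r + \<delta>"
proof -
  let ?K = "\<lambda>i. graph_w (n i)" and ?G = "\<lambda>i. graph_e (n i) (F i)"
  note K = kernel_graph[OF n]
  have "\<forall>i. \<exists>col \<kappa>. greedy {..<n i} (?K i) (?G i) col \<kappa>" using greedy_exists[OF K] by blast
  then obtain col kap where "\<forall>i. greedy {..<n i} (?K i) (?G i) (col i) (kap i)" by metis
  then have col: "col i r x < 4 ^ r" and col_Suc: "col i (Suc r) x div 4 = col i r x"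
    and kap0: "0 \<le> kap i r"
    and kap: "S \<subseteq> {..<n i} \<Longrightarrow> T \<subseteq> {..<n i} \<Longrightarrow> \<bar>cut_diff {..<n i} (?K i) (?G i) (col i r) S T\<bar> \<le> kap i r"
    and kap_sum: "(\<Sum>r<R. (kap i r)\<^sup>2) \<le> 1" for i r x S T R
    by (auto simp: greedy_def)
  have col_div: "col i (r + d) x div 4 ^ d = col i r x" for i r d x
  proof (induction d)
    case (Suc d)
    have "col i (r + Suc d) x div 4 ^ Suc d = (col i (Suc (r + d)) x div 4) div 4 ^ d"
      by (simp add: div_mult2_eq)
    then show ?case using Suc by (simp add: col_Suc)
  qed simp
  define wi where "wi i r = quot_w {..<n i} (?K i) (col i r)" for i r
  define ei where "ei i r = quot_e {..<n i} (?G i) (col i r)" for i r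
  have kern: "kernel (level r) (wi i r) (ei i r)" for i r
    unfolding wi_def ei_def by (rule kernel_quot[OF K]) (auto simp: col)
  have wi01: "0 \<le> wi i r a" "wi i r a \<le> 1" for i r a
  proof -
    show "0 \<le> wi i r a" unfolding wi_def by (rule quot_w_nonneg[OF K])
    have "wi i r a \<le> (\<Sum>x\<in>{..<n i}. ?K i x)" unfolding wi_def quot_w_def by (rule sum_mono2) auto
    then show "wi i r a \<le> 1" using n[of i] by simp
  qed
  have ei01: "0 \<le> ei i r a b" "ei i r a b \<le> 1" for i r a b
  proof -
    show "0 \<le> ei i r a b" unfolding ei_def by (rule quot_e_nonneg[OF K])
    have "ei i r a b \<le> wi i r a * wi i r b" unfolding wi_def ei_def by (rule quot_e_le[OF K])
    also have "\<dots> \<le> 1" using wi01 by (intro mult_le_one)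
    finally show "ei i r a b \<le> 1" .
  qed
  have kap1: "kap i r \<le> 1" for i r
  proof -
    have "(kap i r)\<^sup>2 \<le> (\<Sum>r<Suc r. (kap i r)\<^sup>2)" by (rule member_le_sum) auto
    then have "(kap i r)\<^sup>2 \<le> 1" using kap_sum order_trans by blast
    then show ?thesis using abs_square_le_1[of "kap i r"] by simp
  qed
  \<comment> \<open>All weights, masses and cut bounds are packed into one family with countable
    index set, the tag \<open>t\<close> telling them apart; diagonal selection then makes all of
    them converge along one subsequence.\<close>
  define f where "f i x = (case x of (t :: nat, r, a, b) \<Rightarrow>
      if t = 0 then ei i r a b else if t = 1 then wi i r a else kap i r)" for i x
  have "\<bar>f i x\<bar> \<le> 1" for i x by (cases x) (auto simp: f_def wi01 ei01 kap0 kap1)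
  then have f1: "norm (f i x) \<le> 1" for i x by simp
  have "\<exists>\<sigma>. strict_mono \<sigma> \<and> (\<forall>x. \<exists>l. (\<lambda>i. f (\<sigma> i) x) \<longlonglongrightarrow> l)"
    by (rule function_convergent_subsequence[where f = f, OF countableI_type[of UNIV] f1]) blast
  then obtain \<sigma> where \<sigma>: "strict_mono \<sigma>" "\<And>x. convergent (\<lambda>i. f (\<sigma> i) x)"
    unfolding convergent_def by blast
  define w where "w r a = lim (\<lambda>i. wi (\<sigma> i) r a)" for r a
  define e where "e r a b = lim (\<lambda>i. ei (\<sigma> i) r a b)" for r a b
  define \<kappa> where "\<kappa> r = lim (\<lambda>i. kap (\<sigma> i) r)" for r
  have w: "(\<lambda>i. wi (\<sigma> i) r a) \<longlonglongrightarrow> w r a" for r a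
    using \<sigma>(2)[of "(1, r, a, 0)"] by (simp add: f_def w_def convergent_LIMSEQ_iff)
  have e: "(\<lambda>i. ei (\<sigma> i) r a b) \<longlonglongrightarrow> e r a b" for r a b
    using \<sigma>(2)[of "(0, r, a, b)"] by (simp add: f_def e_def convergent_LIMSEQ_iff)
  have \<kappa>: "(\<lambda>i. kap (\<sigma> i) r) \<longlonglongrightarrow> \<kappa> r" for r
    using \<sigma>(2)[of "(2, r, 0, 0)"] by (simp add: f_def \<kappa>_def convergent_LIMSEQ_iff)
  have kern': "kernel (level r) (w r) (e r)" for r using kern w e by (rule kernel_limit)
  have tower: "kernel_tower w e"
  proof
    fix r r' a b :: nat
    show "kernel (level r) (w r) (e r)" by (rule kern')
    have "ei i r a b = ei i r b a" for i
      unfolding ei_def quot_e_def graph_e_def by (subst sum.swap) (simp add: insert_commute)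
    then show "e r a b = e r b a" by (simp add: e_def)
    assume r: "r \<le> r'"
    have div: "col i r x = col i r' x div 4 ^ (r' - r)" for i x using col_div[of i r "r' - r" x] r by simp
    have "wi i r a = quot_w (level r') (wi i r') (\<lambda>x. x div 4 ^ (r' - r)) a" for i
      unfolding wi_def by (rule quot_w_quot[symmetric]) (auto simp: col div)
    then have "(\<lambda>i. wi (\<sigma> i) r a) \<longlonglongrightarrow> quot_w (level r') (w r') (\<lambda>x. x div 4 ^ (r' - r)) a"
      unfolding quot_w_def by (simp add: tendsto_sum w)
    then show "w r a = quot_w (level r') (w r') (\<lambda>x. x div 4 ^ (r' - r)) a" by (rule LIMSEQ_unique[OF w])
    have "ei i r a b = quot_e (level r') (ei i r') (\<lambda>x. x div 4 ^ (r' - r)) a b" for i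
      unfolding ei_def by (rule quot_e_quot[symmetric]) (auto simp: col div)
    then have "(\<lambda>i. ei (\<sigma> i) r a b) \<longlonglongrightarrow> quot_e (level r') (e r') (\<lambda>x. x div 4 ^ (r' - r)) a b"
      unfolding quot_e_def by (simp add: tendsto_sum e)
    then show "e r a b = quot_e (level r') (e r') (\<lambda>x. x div 4 ^ (r' - r)) a b" by (rule LIMSEQ_unique[OF e])
  qed
  have \<kappa>0: "\<kappa> \<longlonglongrightarrow> 0"
  proof -
    have "(\<Sum>r<R. (\<kappa> r)\<^sup>2) \<le> 1" for R
    proof (rule LIMSEQ_le_const2)
      show "(\<lambda>i. \<Sum>r<R. (kap (\<sigma> i) r)\<^sup>2) \<longlonglongrightarrow> (\<Sum>r<R. (\<kappa> r)\<^sup>2)" by (intro tendsto_sum tendsto_power \<kappa>)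
    qed (use kap_sum in auto)
    then have "summable (\<lambda>r. (\<kappa> r)\<^sup>2)" by (intro summableI_nonneg_bounded[where x = 1]) auto
    then have "(\<lambda>r. (\<kappa> r)\<^sup>2) \<longlonglongrightarrow> 0" by (rule summable_LIMSEQ_zero)
    from tendsto_real_sqrt[OF this] show ?thesis by (simp add: tendsto_rabs_zero_iff)
  qed
  have "\<forall>\<^sub>F i in sequentially. \<bar>std_dens k E (n (\<sigma> i)) (F (\<sigma> i))
        - hom_dens (level r) (w r) {..<k} E (dens (w r) (e r))\<bar> \<le> (k choose 2) * \<kappa> r + \<delta>"
    if E: "E \<subseteq> pairs k" and \<delta>: "0 < \<delta>" for r k E \<delta>
  proof -
    let ?H = "\<lambda>i. hom_dens (level r) (wi i r) {..<k} E (dens (wi i r) (ei i r))"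
    let ?H' = "hom_dens (level r) (w r) {..<k} E (dens (w r) (e r))"
    have 1: "\<bar>std_dens k E (n i) (F i) - ?H i\<bar> \<le> real (k choose 2) / n i + (k choose 2) * kap i r"
      if "k \<le> n i" for i
    proof -
      let ?h = "hom_dens {..<n i} (?K i) {..<k} E (dens (?K i) (?G i))"
      let ?h' = "hom_dens {..<n i} (?K i) {..<k} E (quot_dens {..<n i} (?K i) (?G i) (col i r))"
      have "\<bar>?h - ?h'\<bar> \<le> card (pairs k) * kap i r"
      proof (rule counting_lemma)
        fix x y assume xy: "x \<in> {..<n i}" "y \<in> {..<n i}"
        show "0 \<le> dens (?K i) (?G i) x y \<and> dens (?K i) (?G i) x y \<le> 1"
          using kernel_dens[OF K xy] by simp
        show "0 \<le> quot_dens {..<n i} (?K i) (?G i) (col i r) x y \<and> quot_dens {..<n i} (?K i) (?G i) (col i r) x y \<le> 1"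
          using kernel_dens[OF kern[of r i], of "col i r x" "col i r y"] col by (simp add: wi_def ei_def)
      next
        fix S T assume "S \<subseteq> {..<n i}" "T \<subseteq> {..<n i}"
        from kap[OF this, of r]
        show "\<bar>\<Sum>x\<in>S. \<Sum>y\<in>T. ?K i x * ?K i y * (dens (?K i) (?G i) x y - quot_dens {..<n i} (?K i) (?G i) (col i r) x y)\<bar> \<le> kap i r"
          by (simp add: cut_diff_def)
      qed (use E n[of i] in auto)
      moreover have "?h' = ?H i"
        unfolding wi_def ei_def by (rule hom_dens_quot[OF K]) (use E in \<open>auto simp: col\<close>)
      moreover note hom_dens_graph[OF n that E, of "F i"]
      ultimately show ?thesis unfolding card_vpairs_lessThan by linarith
    qed
    have lim': "filterlim (\<lambda>i. n (\<sigma> i)) at_top sequentially"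
      using lim filterlim_subseq[OF \<sigma>(1)] by (rule filterlim_compose)
    have "(\<lambda>i. real (k choose 2) / n (\<sigma> i) + (k choose 2) * kap (\<sigma> i) r + \<bar>?H (\<sigma> i) - ?H'\<bar>)
        \<longlonglongrightarrow> 0 + (k choose 2) * \<kappa> r + \<bar>?H' - ?H'\<bar>"
    proof (intro tendsto_add tendsto_mult tendsto_const \<kappa> tendsto_rabs tendsto_diff)
      show "(\<lambda>i. real (k choose 2) / n (\<sigma> i)) \<longlonglongrightarrow> 0"
        using lim' by (intro tendsto_divide_0[OF tendsto_const] filterlim_at_top_imp_at_infinity
            filterlim_compose[OF filterlim_real_sequentially])
      show "(\<lambda>i. ?H (\<sigma> i)) \<longlonglongrightarrow> ?H'" using E by (intro hom_dens_tendsto kern kern' w e) auto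
    qed
    then have "\<forall>\<^sub>F i in sequentially. real (k choose 2) / n (\<sigma> i) + (k choose 2) * kap (\<sigma> i) r + \<bar>?H (\<sigma> i) - ?H'\<bar>
        < (k choose 2) * \<kappa> r + \<delta>" using \<delta> by (intro order_tendstoD(2)) auto
    moreover have "\<forall>\<^sub>F i in sequentially. k \<le> n (\<sigma> i)" using lim' by (simp add: filterlim_at_top)
    ultimately show ?thesis
    proof eventually_elim
      case (elim i)
      then show ?case using 1[of "\<sigma> i"] by linarith
    qed
  qed
  note approx = this
  show ?thesis by (rule that[OF \<sigma>(1) tower \<kappa>0]) (rule approx)
qed

section \<open>The graphon of a tower of kernels\<close>

text \<open>A downward closed condition holds exactly on an initial segment, whose size is its last
  element.\<close>

lemma card_initial_ge_iff:
  fixes a N :: nat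
  assumes P: "\<And>a b. a \<le> b \<Longrightarrow> P b \<Longrightarrow> P a" and a: "1 \<le> a" "a < N"
  shows "a \<le> card {b\<in>{1..<N}. P b} \<longleftrightarrow> P a"
proof
  assume "P a"
  then have "{1..a} \<subseteq> {b\<in>{1..<N}. P b}" using P a by auto
  then have "card {1..a} \<le> card {b\<in>{1..<N}. P b}" by (intro card_mono) auto
  then show "a \<le> card {b\<in>{1..<N}. P b}" by simp
next
  assume le: "a \<le> card {b\<in>{1..<N}. P b}"
  show "P a"
  proof (rule ccontr)
    assume "\<not> P a"
    then have "b < a" if "P b" for b using P[of a b] that by (cases "a \<le> b") auto
    then have "{b\<in>{1..<N}. P b} \<subseteq> {1..<a}" by auto
    then have "card {b\<in>{1..<N}. P b} \<le> card {1..<a}" by (intro card_mono) auto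
    then show False using le a by simp
  qed
qed

lemma measure_unit:
  assumes "A \<in> sets borel" "A \<subseteq> {0..1}"
  shows "measure unit_measure A = measure lborel A"
  using assms unfolding unit_measure_def by (intro measure_restrict_space) auto

lemma borel_sets_unit: "A \<in> sets borel \<Longrightarrow> A \<subseteq> {0..1} \<Longrightarrow> A \<in> sets unit_measure"
  unfolding unit_measure_def by (auto simp: sets_restrict_space)

text \<open>The points of level \<open>r\<close> are laid out as consecutive intervals of \<open>[0, 1]\<close> whose lengths are
  their weights; \<open>colour r x\<close> is the interval that contains \<open>x\<close>.\<close>

context kernel_tower
begin

definition cum :: "nat \<Rightarrow> nat \<Rightarrow> real" where
  "cum r a = (\<Sum>b<a. w r b)"

definition colour :: "nat \<Rightarrow> real \<Rightarrow> nat" where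
  "colour r x = card {a\<in>{1..<4 ^ r}. cum r a \<le> x}"

abbreviation colour_set :: "nat \<Rightarrow> nat \<Rightarrow> real set" where
  "colour_set r a \<equiv> {x\<in>space unit_measure. colour r x = a}"

definition level_graphon :: "nat \<Rightarrow> real \<Rightarrow> real \<Rightarrow> real" where
  "level_graphon r x y = dens (w r) (e r) (colour r x) (colour r y)"

lemma cum_mono: "a \<le> b \<Longrightarrow> b \<le> 4 ^ r \<Longrightarrow> cum r a \<le> cum r b"
  unfolding cum_def using kernelD(2)[OF kern] by (intro sum_mono2) auto

lemma cum_0: "cum r 0 = 0" and cum_all: "cum r (4 ^ r) = 1"
  using kernelD(3)[OF kern] by (auto simp: cum_def)

lemma cum_bounds: "a \<le> 4 ^ r \<Longrightarrow> 0 \<le> cum r a \<and> cum r a \<le> 1"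
  using cum_mono[of 0 a r] cum_mono[of a "4 ^ r" r] by (simp add: cum_0 cum_all)

lemma colour_less: "colour r x < 4 ^ r"
proof -
  have "colour r x \<le> card {1..<(4::nat) ^ r}" unfolding colour_def by (intro card_mono) auto
  also have "\<dots> < 4 ^ r" by simp
  finally show ?thesis .
qed

lemma le_colour_iff:
  assumes "1 \<le> a" "a < 4 ^ r"
  shows "a \<le> colour r x \<longleftrightarrow> cum r a \<le> x"
proof -
  have "colour r x = card {b\<in>{1..<4 ^ r}. b < 4 ^ r \<and> cum r b \<le> x}"
    unfolding colour_def by (intro arg_cong[where f = card]) auto
  moreover have "a \<le> card {b\<in>{1..<4 ^ r}. b < 4 ^ r \<and> cum r b \<le> x} \<longleftrightarrow> a < 4 ^ r \<and> cum r a \<le> x"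
    using assms by (intro card_initial_ge_iff) (auto intro: order_trans[OF cum_mono])
  ultimately show ?thesis using assms by simp
qed

text \<open>The intervals are half-open except the last, which is closed at 1:
  \<open>cum r (4 ^ r)\<close> is not among the thresholds counted by \<open>colour\<close>.\<close>

lemma colour_eq_iff:
  assumes a: "a < 4 ^ r" and x: "x \<in> {0..1}"
  shows "colour r x = a \<longleftrightarrow> cum r a \<le> x \<and> (Suc a = 4 ^ r \<or> x < cum r (Suc a))"
proof -
  have "a \<le> colour r x \<longleftrightarrow> cum r a \<le> x"
    using le_colour_iff[of a r x] a x by (cases "a = 0") (auto simp: cum_0)
  moreover have "colour r x \<le> a \<longleftrightarrow> Suc a = 4 ^ r \<or> x < cum r (Suc a)"
  proof (cases "Suc a = 4 ^ r")
    case True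
    then show ?thesis using colour_less[of r x] by linarith
  next
    case False
    then have "Suc a < 4 ^ r" using a by linarith
    then have "Suc a \<le> colour r x \<longleftrightarrow> cum r (Suc a) \<le> x" by (intro le_colour_iff) auto
    then show ?thesis using False by auto
  qed
  ultimately show ?thesis by (metis antisym order_refl)
qed

lemma colour_class:
  assumes a: "a < 4 ^ r"
  shows "colour_set r a \<in> sets unit_measure" (is "?A \<in> _")
    and "measure unit_measure (colour_set r a) = w r a"
proof -
  have Suc: "cum r (Suc a) = cum r a + w r a" by (simp add: cum_def)
  have bounds: "0 \<le> cum r a" "cum r a \<le> 1" "cum r (Suc a) \<le> 1" "cum r a \<le> cum r (Suc a)"
    using cum_bounds[of a r] cum_bounds[of "Suc a" r] cum_mono[of a "Suc a" r] a by auto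
  have A_eq: "?A = {x\<in>{0..1}. cum r a \<le> x \<and> (Suc a = 4 ^ r \<or> x < cum r (Suc a))}"
    unfolding space_unit_measure by (rule Collect_cong) (use colour_eq_iff[OF a] in blast)
  have "?A \<in> sets borel \<and> measure lborel ?A = w r a"
  proof (cases "Suc a = 4 ^ r")
    case True
    then have "?A = {cum r a..1}" unfolding A_eq using bounds by auto
    moreover have "1 - cum r a = w r a" using Suc True cum_all by simp
    ultimately show ?thesis using bounds by simp
  next
    case False
    then have "?A = {cum r a..<cum r (Suc a)}" unfolding A_eq using bounds False by auto
    then show ?thesis using bounds Suc by simp
  qed
  note B = conjunct1[OF this] conjunct2[OF this]
  have sub: "?A \<subseteq> {0..1}" by (auto simp: space_unit_measure)
  show "?A \<in> sets unit_measure" by (rule borel_sets_unit[OF B(1) sub])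
  show "measure unit_measure ?A = w r a" unfolding measure_unit[OF B(1) sub] by (rule B(2))
qed

lemma colour_measurable [measurable]: "colour r \<in> unit_measure \<rightarrow>\<^sub>M count_space UNIV"
proof (rule measurable_count_space_eq2_countable[THEN iffD2], safe)
  fix a :: nat
  show "colour r -` {a} \<inter> space unit_measure \<in> sets unit_measure"
  proof (cases "a < 4 ^ r")
    case True
    have "colour r -` {a} \<inter> space unit_measure = colour_set r a" by auto
    then show ?thesis using colour_class(1)[OF True] by simp
  next
    case False
    then have "colour r -` {a} \<inter> space unit_measure = {}" using colour_less[of r] by auto
    then show ?thesis by simp
  qed
qed auto

text \<open>The descendants of a point form a block of consecutive points of the finer level with
  the same total weight, so every coarse endpoint is a fine endpoint.\<close>

lemma cum_refine:
  assumes r: "r \<le> r'" and a: "a \<le> 4 ^ r"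
  shows "cum r a = cum r' (a * 4 ^ (r' - r))"
proof -
  let ?D = "(4::nat) ^ (r' - r)"
  have D: "0 < ?D" by simp
  have e: "(4::nat) ^ r' = 4 ^ r * ?D" using r by (simp flip: power_add)
  have "cum r a = (\<Sum>b<a. \<Sum>x\<in>{x\<in>{..<a * ?D}. x div ?D = b}. w r' x)" unfolding cum_def
  proof (rule sum.cong[OF refl])
    fix b assume b: "b \<in> {..<a}"
    have "w r b = quot_w (level r') (w r') (\<lambda>x. x div ?D) b" using b a by (intro w_quot r) auto
    also have "{x\<in>level r'. x div ?D = b} = {x\<in>{..<a * ?D}. x div ?D = b}"
      using b a D by (auto simp: e div_less_iff_less_mult[OF D, symmetric])
    then have "quot_w (level r') (w r') (\<lambda>x. x div ?D) b = (\<Sum>x\<in>{x\<in>{..<a * ?D}. x div ?D = b}. w r' x)"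
      by (simp add: quot_w_def)
    finally show "w r b = (\<Sum>x\<in>{x\<in>{..<a * ?D}. x div ?D = b}. w r' x)" .
  qed
  also have "\<dots> = cum r' (a * ?D)"
    unfolding cum_def by (rule sum.group) (auto simp: div_less_iff_less_mult)
  finally show ?thesis .
qed

text \<open>Both sides pass the value \<open>a\<close> at the same place, since the coarse endpoint
  \<open>a\<close> is the fine endpoint \<open>a * 4 ^ (r' - r)\<close>.\<close>

lemma colour_refine:
  assumes r: "r \<le> r'"
  shows "colour r x = colour r' x div 4 ^ (r' - r)"
proof -
  let ?D = "(4::nat) ^ (r' - r)"
  have D: "0 < ?D" by simp
  have e: "(4::nat) ^ r' = 4 ^ r * ?D" using r by (simp flip: power_add)
  have iff: "a \<le> colour r x \<longleftrightarrow> a \<le> colour r' x div ?D" if a: "1 \<le> a" "a < 4 ^ r" for a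
  proof -
    have "a \<le> colour r x \<longleftrightarrow> cum r' (a * ?D) \<le> x"
      using le_colour_iff[OF a] cum_refine[OF r, of a] a by simp
    also have "\<dots> \<longleftrightarrow> a * ?D \<le> colour r' x"
    proof (rule le_colour_iff[symmetric])
      show "1 \<le> a * ?D" using a D by (simp add: Suc_le_eq)
      show "a * ?D < 4 ^ r'" using a D by (simp add: e)
    qed
    also have "\<dots> \<longleftrightarrow> a \<le> colour r' x div ?D" using D by (simp add: less_eq_div_iff_mult_less_eq)
    finally show ?thesis .
  qed
  have "colour r' x div ?D < 4 ^ r" using colour_less[of r' x] D by (simp add: div_less_iff_less_mult e)
  moreover note colour_less[of r x]
  ultimately show ?thesis using iff[of "colour r x"] iff[of "colour r' x div ?D"]
    by (cases "colour r x = 0"; cases "colour r' x div ?D = 0") auto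
qed

lemma level_graphon_bounds: "0 \<le> level_graphon r x y" "level_graphon r x y \<le> 1"
  unfolding level_graphon_def using kernel_dens[OF kern] colour_less by auto

lemma level_graphon_measurable: "case_prod (level_graphon r) \<in> borel_measurable unit2"
proof (rule step_function_measurable)
  show "step_function unit_measure (case_prod (level_graphon r))"
    unfolding step_function_def level_graphon_def
    by (intro exI[of _ "4 ^ r"] exI[of _ "colour r"] exI[of _ "dens (w r) (e r)"])
      (auto simp: colour_less colour_measurable)
qed

lemma graphon_level: "graphon (level_graphon r)"
  unfolding graphon_def using level_graphon_measurable level_graphon_bounds
  by (auto simp: level_graphon_def dens_def e_sym mult.commute)

text \<open>The integrand is constant on the boxes of points with given colours, and these boxes
  have product measure.\<close>

lemma integral_cube_colour:
  assumes V: "finite V"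
  shows "(\<integral>X. G (\<lambda>v\<in>V. colour r (X v)) \<partial>cube V) = (\<Sum>a\<in>V \<rightarrow>\<^sub>E level r. (\<Prod>v\<in>V. w r (a v)) * (G a :: real))"
proof -
  interpret C: prob_space "cube V" by (rule prob_space_cube)
  let ?A = "\<lambda>a. \<Pi>\<^sub>E v\<in>V. colour_set r (a v)"
  let ?J = "V \<rightarrow>\<^sub>E level r"
  have fin: "finite ?J" using V by (simp add: finite_PiE)
  have sets: "?A a \<in> sets (cube V)" if "a \<in> ?J" for a
    using that V by (intro sets_PiM_I_finite colour_class(1)) auto
  have measure: "measure (cube V) (?A a) = (\<Prod>v\<in>V. w r (a v))" if a: "a \<in> ?J" for a
  proof -
    have "emeasure (cube V) (?A a) = (\<Prod>v\<in>V. emeasure unit_measure (colour_set r (a v)))"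
      using a V by (intro unit_prod.emeasure_PiM colour_class(1)) auto
    also have "\<dots> = (\<Prod>v\<in>V. ennreal (w r (a v)))"
    proof (rule prod.cong[OF refl])
      fix v assume "v \<in> V"
      then have "a v < 4 ^ r" using a by auto
      then show "emeasure unit_measure (colour_set r (a v)) = ennreal (w r (a v))"
        by (simp add: unit.emeasure_eq_measure colour_class(2))
    qed
    also have "\<dots> = ennreal (\<Prod>v\<in>V. w r (a v))" using a kernelD(2)[OF kern] by (intro prod_ennreal) auto
    finally show ?thesis
      using prod_nonneg[of V "\<lambda>v. w r (a v)"] kernelD(2)[OF kern PiE_mem[OF a]] by (simp add: measure_def)
  qed
  have "(\<integral>X. G (\<lambda>v\<in>V. colour r (X v)) \<partial>cube V) = (\<integral>X. (\<Sum>a\<in>?J. G a * indicator (?A a) X) \<partial>cube V)"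
  proof (rule Bochner_Integration.integral_cong[OF refl])
    fix X assume X: "X \<in> space (cube V)"
    define c where "c = (\<lambda>v\<in>V. colour r (X v))"
    have c: "c \<in> ?J" by (auto simp: c_def colour_less)
    have "indicator (?A a) X = (if a = c then 1 else 0 :: real)" if a: "a \<in> ?J" for a
    proof -
      have "X \<in> ?A a \<longleftrightarrow> a = c"
      proof
        assume "X \<in> ?A a"
        then show "a = c" using a by (intro PiE_ext[OF a c]) (auto simp: c_def PiE_iff)
      next
        assume "a = c"
        then show "X \<in> ?A a" using X by (auto simp: c_def space_PiM PiE_iff)
      qed
      then show ?thesis by (simp add: indicator_def)
    qed
    then have "(\<Sum>a\<in>?J. G a * indicator (?A a) X) = (\<Sum>a\<in>?J. if a = c then G a else 0)"
      by (intro sum.cong) auto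
    also have "\<dots> = G c" using fin c by simp
    finally show "G (\<lambda>v\<in>V. colour r (X v)) = (\<Sum>a\<in>?J. G a * indicator (?A a) X)" by (simp add: c_def)
  qed
  also have "\<dots> = (\<Sum>a\<in>?J. \<integral>X. G a * indicator (?A a) X \<partial>cube V)"
  proof (rule Bochner_Integration.integral_sum)
    fix a assume a: "a \<in> ?J"
    show "integrable (cube V) (\<lambda>X. G a * indicator (?A a) X)"
    proof (rule integrable_cube_bounded[where B = "\<bar>G a\<bar>"])
      show "(\<lambda>X. G a * indicator (?A a) X) \<in> borel_measurable (cube V)"
        by (intro borel_measurable_times borel_measurable_const borel_measurable_indicator sets[OF a])
    qed (simp add: indicator_def)
  qed
  also have "\<dots> = (\<Sum>a\<in>?J. (\<Prod>v\<in>V. w r (a v)) * G a)"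
    using sets measure sets.sets_into_space[OF sets] by (intro sum.cong refl) (simp add: Int_absorb2)
  finally show ?thesis .
qed

lemma lgraphon_density_level:
  assumes E: "E \<subseteq> pairs k"
  shows "sample_dens k E (level_graphon r) = level_dens r k E"
proof -
  have "sample_dens k E (level_graphon r)
      = (\<integral>X. bern (pairs k) E (pair_val (dens (w r) (e r)) (\<lambda>v\<in>{..<k}. colour r (X v))) \<partial>cube {..<k})"
    unfolding lgraphon_density_eq using vpairs_Min_Max
    by (intro Bochner_Integration.integral_cong refl bern_cong[OF E]) (auto simp: pair_val_def level_graphon_def)
  also have "\<dots> = level_dens r k E" by (subst integral_cube_colour) (simp_all add: hom_dens_def)
  finally show ?thesis .
qed

lemma integral_unit2_colour:
  assumes f: "(\<lambda>z. f (colour r (fst z)) (colour r (snd z))) \<in> borel_measurable unit2"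
  shows "(\<integral>z. f (colour r (fst z)) (colour r (snd z)) \<partial>unit2)
    = (\<Sum>a<4 ^ r. \<Sum>b<4 ^ r. w r a * w r b * (f a b :: real))"
proof -
  let ?J = "level r"
  have "(\<integral>z. f (colour r (fst z)) (colour r (snd z)) \<partial>unit2)
      = (\<integral>X. f (colour r (X 0)) (colour r (X 1)) \<partial>cube {0, 1})"
    using integral_cube_pair[of "{0, 1}" 0 1, OF _ _ _ _ f] by simp
  also have "\<dots> = (\<integral>X. (\<lambda>a. f (a 0) (a 1)) (\<lambda>v\<in>{0, 1}. colour r (X v)) \<partial>cube {0, 1})" by simp
  also have "\<dots> = (\<Sum>a\<in>{0, 1 :: nat} \<rightarrow>\<^sub>E ?J. (\<Prod>v\<in>{0, 1}. w r (a v)) * f (a 0) (a 1))"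
    by (rule integral_cube_colour[where G = "\<lambda>a. f (a 0) (a 1)"]) simp
  also have "\<dots> = (\<Sum>a\<in>?J. \<Sum>b\<in>?J. w r a * w r b * f a b)" by (simp add: sum_PiE_insert PiE_empty_domain)
  finally show ?thesis .
qed

section \<open>Energies of the levels and the limiting graphon\<close>

definition en :: "nat \<Rightarrow> real" where
  "en r = energy (level r) (w r) (e r)"

text \<open>Pythagoras for the quotient of the finer level by ancestors, with the identity as finer
  quotient, makes the squared L2 distance the energy gain. Cauchy-Schwarz bounds the L1 distance by
  the L2 distance.\<close>

lemma level_diff:
  assumes r: "r \<le> r'"
  shows "en r \<le> en r'"
    and "(\<integral>z. \<bar>case_prod (level_graphon r') z - case_prod (level_graphon r) z\<bar> \<partial>unit2) \<le> sqrt (en r' - en r)"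
proof -
  let ?J = "level r'" and ?I = "level r"
  let ?\<tau> = "\<lambda>x::nat. x div 4 ^ (r' - r)"
  have e4: "(4::nat) ^ r' = 4 ^ r * 4 ^ (r' - r)" using r by (simp flip: power_add)
  have \<tau>: "?\<tau> x \<in> ?I" if "x \<in> ?J" for x
  proof -
    have "x < 4 ^ r * 4 ^ (r' - r)" using that by (simp add: e4)
    then show ?thesis using div_less_iff_less_mult[of "4 ^ (r' - r)" x "4 ^ r"] by simp
  qed
  define d where "d a b = dens (w r') (e r') a b - dens (w r) (e r) (?\<tau> a) (?\<tau> b)" for a b
  note K = kern[of r']
  have "(\<Sum>a\<in>?J. \<Sum>b\<in>?J. w r' a * w r' b * (quot_dens ?J (w r') (e r') id a b - quot_dens ?J (w r') (e r') ?\<tau> a b)\<^sup>2)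
      = quot_energy ?J ?J (w r') (e r') id - quot_energy ?I ?J (w r') (e r') ?\<tau>"
    using \<tau> by (intro energy_pythagoras[OF K, where \<tau> = ?\<tau>]) auto
  moreover have w_id: "quot_w ?J (w r') id a = w r' a" if "a \<in> ?J" for a
  proof -
    have "{x\<in>?J. id x = a} = {a}" using that by auto
    then show ?thesis by (simp add: quot_w_def)
  qed
  moreover have e_id: "quot_e ?J (e r') id a b = e r' a b" if "a \<in> ?J" "b \<in> ?J" for a b
  proof -
    have "{x\<in>?J. id x = a} = {a}" "{x\<in>?J. id x = b} = {b}" using that by auto
    then show ?thesis by (simp add: quot_e_def)
  qed
  moreover have "quot_e ?J (e r') ?\<tau> a b = e r a b" if "a \<in> ?I" "b \<in> ?I" for a b
    using that e_quot[OF r] by simp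
  moreover have "quot_w ?J (w r') ?\<tau> a = w r a" if "a \<in> ?I" for a using that w_quot[OF r] by simp
  ultimately have pyth: "(\<Sum>a\<in>?J. \<Sum>b\<in>?J. w r' a * w r' b * (d a b)\<^sup>2) = en r' - en r"
    using \<tau> by (simp add: energy_def en_def d_def dens_def)
  have w0: "0 \<le> w r' a" if "a \<in> ?J" for a using kernelD(2)[OF K that] .
  have "0 \<le> (\<Sum>a\<in>?J. \<Sum>b\<in>?J. w r' a * w r' b * (d a b)\<^sup>2)"
    using w0 by (intro sum_nonneg mult_nonneg_nonneg) auto
  with pyth show le: "en r \<le> en r'" by simp
  have eq: "\<bar>case_prod (level_graphon r') z - case_prod (level_graphon r) z\<bar> = \<bar>d (colour r' (fst z)) (colour r' (snd z))\<bar>" for z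
    by (simp add: level_graphon_def d_def case_prod_unfold colour_refine[OF r, symmetric])
  have "(\<integral>z. \<bar>case_prod (level_graphon r') z - case_prod (level_graphon r) z\<bar> \<partial>unit2)
      = (\<Sum>a\<in>?J. \<Sum>b\<in>?J. w r' a * w r' b * \<bar>d a b\<bar>)" unfolding eq using level_graphon_measurable
    by (intro integral_unit2_colour) (simp flip: eq)
  also have "\<dots> = (\<Sum>z\<in>?J \<times> ?J. w r' (fst z) * w r' (snd z) * (\<bar>d (fst z) (snd z)\<bar> * 1))"
    by (simp add: sum.cartesian_product case_prod_unfold)
  also have "\<dots> \<le> sqrt (en r' - en r)"
  proof (rule real_le_rsqrt)
    have "(\<Sum>z\<in>?J \<times> ?J. w r' (fst z) * w r' (snd z) * (\<bar>d (fst z) (snd z)\<bar> * 1))\<^sup>2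
      \<le> (\<Sum>z\<in>?J \<times> ?J. w r' (fst z) * w r' (snd z) * \<bar>d (fst z) (snd z)\<bar>\<^sup>2) * (\<Sum>z\<in>?J \<times> ?J. w r' (fst z) * w r' (snd z) * 1\<^sup>2)"
      using w0 by (intro weighted_cauchy_schwarz) auto
    also have "(\<Sum>z\<in>?J \<times> ?J. w r' (fst z) * w r' (snd z) * \<bar>d (fst z) (snd z)\<bar>\<^sup>2) = en r' - en r"
      by (simp add: pyth[symmetric] sum.cartesian_product case_prod_unfold)
    also have "(\<Sum>z\<in>?J \<times> ?J. w r' (fst z) * w r' (snd z) * 1\<^sup>2) = (\<Sum>a\<in>?J. \<Sum>b\<in>?J. w r' a * w r' b)"
      by (simp add: sum.cartesian_product case_prod_unfold)
    also have "\<dots> = 1" using kernelD(3)[OF K] by (simp add: sum_product[symmetric])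
    finally show "(\<Sum>z\<in>?J \<times> ?J. w r' (fst z) * w r' (snd z) * (\<bar>d (fst z) (snd z)\<bar> * 1))\<^sup>2 \<le> en r' - en r" by simp
  qed
  finally show "(\<integral>z. \<bar>case_prod (level_graphon r') z - case_prod (level_graphon r) z\<bar> \<partial>unit2) \<le> sqrt (en r' - en r)" .
qed

text \<open>The energies increase to a limit. Gaps of \<open>(1/4) ^ j\<close> become L1 distances
  of at most \<open>(1/2) ^ j\<close> after taking roots, which are summable.\<close>

lemma rapid_subsequence:
  obtains \<rho> :: "nat \<Rightarrow> nat" where "strict_mono \<rho>" "\<And>j. en (\<rho> (Suc j)) - en (\<rho> j) \<le> (1/4) ^ j"
proof -
  have inc: "incseq en" using level_diff(1) by (rule incseq_SucI) simp
  have "en r \<le> 1" for r unfolding en_def by (rule energy_bounds(2)[OF kern])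
  then obtain l where l: "en \<longlonglongrightarrow> l" "\<And>r. en r \<le> l" using incseq_convergent[OF inc] by blast
  have "\<exists>\<rho>. \<forall>j. l - en (\<rho> j) \<le> (1/4) ^ j \<and> \<rho> j < \<rho> (Suc j)"
  proof (rule dependent_nat_choice)
    have ex: "\<exists>y>x. l - en y \<le> (1/4) ^ n" for n x :: nat
    proof -
      have "\<forall>\<^sub>F r in sequentially. l - (1/4) ^ n < en r" using l(1) by (intro order_tendstoD(1)) auto
      then obtain R where R: "\<And>r. R \<le> r \<Longrightarrow> l - (1/4) ^ n < en r" by (auto simp: eventually_sequentially)
      show ?thesis using R[of "R + Suc x"] by (intro exI[of _ "R + Suc x"]) auto
    qed
    show "\<exists>x. l - en x \<le> (1/4) ^ 0" using ex[of 0 0] by blast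
    show "\<exists>y. l - en y \<le> (1/4) ^ Suc n \<and> x < y" for x n using ex[of x "Suc n"] by blast
  qed
  then obtain \<rho> where \<rho>: "\<And>j. l - en (\<rho> j) \<le> (1/4) ^ j" "\<And>j. \<rho> j < \<rho> (Suc j)" by blast
  show ?thesis
  proof (rule that)
    show "strict_mono \<rho>" using \<rho>(2) by (simp add: strict_mono_Suc_iff)
    show "en (\<rho> (Suc j)) - en (\<rho> j) \<le> (1/4) ^ j" for j using \<rho>(1)[of j] l(2)[of "\<rho> (Suc j)"] by linarith
  qed
qed

text \<open>The level graphons form a martingale that is bounded in \<open>L\<^sup>2\<close>; along a rapidly converging
  subsequence it converges almost everywhere.\<close>

lemma limit_graphon:
  obtains W \<rho> where "graphon W" "strict_mono (\<rho> :: nat \<Rightarrow> nat)"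
    "\<And>k E. E \<subseteq> pairs k \<Longrightarrow> (\<lambda>j. level_dens (\<rho> j) k E) \<longlonglongrightarrow> sample_dens k E W"
proof -
  obtain \<rho> where \<rho>: "strict_mono \<rho>" "\<And>j. en (\<rho> (Suc j)) - en (\<rho> j) \<le> (1/4) ^ j"
    using rapid_subsequence by blast
  define U where "U j = level_graphon (\<rho> j)" for j
  have U_meas: "case_prod (U j) \<in> borel_measurable unit2" for j unfolding U_def by (rule level_graphon_measurable)
  have U01: "0 \<le> U j x y" "U j x y \<le> 1" for j x y unfolding U_def by (rule level_graphon_bounds)+
  define D where "D j z = \<bar>case_prod (U (Suc j)) z - case_prod (U j) z\<bar>" for j z
  have D_meas [measurable]: "D j \<in> borel_measurable unit2" for j
    unfolding D_def using U_meas by measurable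
  have D_int: "integrable unit2 (D j)" for j
  proof (rule integrable_unit2_bounded[OF D_meas])
    show "\<bar>D j z\<bar> \<le> 1" for z using U01[of "Suc j" "fst z" "snd z"] U01[of j "fst z" "snd z"]
      by (simp add: D_def case_prod_unfold abs_le_iff)
  qed
  have D_le: "(\<integral>z. D j z \<partial>unit2) \<le> (1/2) ^ j" for j
  proof -
    have "\<rho> j \<le> \<rho> (Suc j)" using \<rho>(1) by (simp add: strict_mono_less_eq)
    then have "(\<integral>z. D j z \<partial>unit2) \<le> sqrt (en (\<rho> (Suc j)) - en (\<rho> j))"
      unfolding D_def U_def by (rule level_diff(2))
    also have "\<dots> \<le> sqrt ((1/4) ^ j)" using \<rho>(2) by (rule real_sqrt_le_mono)
    also have "(1/4 :: real) ^ j = ((1/2) ^ j)\<^sup>2" by (simp add: power2_eq_square flip: power_mult_distrib)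
    also have "sqrt (((1/2) ^ j)\<^sup>2) = (1/2 :: real) ^ j" by simp
    finally show ?thesis .
  qed
  \<comment> \<open>Summable L1 increments have an almost everywhere finite sum, which gives
    pointwise convergence.\<close>
  have "(\<integral>\<^sup>+z. (\<Sum>j. ennreal (D j z)) \<partial>unit2) = (\<Sum>j. \<integral>\<^sup>+z. ennreal (D j z) \<partial>unit2)"
    by (rule nn_integral_suminf) measurable
  also have "\<dots> = (\<Sum>j. ennreal (\<integral>z. D j z \<partial>unit2))"
  proof (intro suminf_cong nn_integral_eq_integral D_int)
    show "AE z in unit2. 0 \<le> D j z" for j by (simp add: D_def)
  qed
  also have "\<dots> \<le> (\<Sum>j. ennreal ((1/2) ^ j))" using D_le by (intro suminf_le ennreal_leI) auto
  also have "\<dots> = ennreal (\<Sum>j. (1/2) ^ j)" by (intro suminf_ennreal2 summable_geometric) auto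
  also have "\<dots> < \<infinity>" by simp
  finally have "(\<integral>\<^sup>+z. (\<Sum>j. ennreal (D j z)) \<partial>unit2) \<noteq> \<infinity>" by simp
  then have "AE z in unit2. (\<Sum>j. ennreal (D j z)) \<noteq> \<infinity>" by (intro nn_integral_PInf_AE) measurable
  then have conv: "AE z in unit2. convergent (\<lambda>j. case_prod (U j) z)"
  proof eventually_elim
    case (elim z)
    then have "summable (\<lambda>j. D j z)" by (intro summable_suminf_not_top) (auto simp: D_def)
    then have "summable (\<lambda>j. case_prod (U (Suc j)) z - case_prod (U j) z)"
      unfolding D_def by (rule summable_rabs_cancel)
    then have "convergent (\<lambda>m. \<Sum>j<m. case_prod (U (Suc j)) z - case_prod (U j) z)"
      by (simp add: summable_iff_convergent)
    then have "convergent (\<lambda>m. case_prod (U m) z - case_prod (U 0) z)"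
      using sum_lessThan_telescope[of "\<lambda>m. case_prod (U m) z"] by simp
    from convergent_add[OF this convergent_const[of "case_prod (U 0) z"]] show ?case by (simp add: case_prod_unfold)
  qed
  \<comment> \<open>Where the sequence diverges \<open>lim\<close> is an unspecified value; clamping
    makes \<open>W\<close> a graphon there too, and changes nothing where the limit exists.\<close>
  define W where "W x y = max 0 (min 1 (lim (\<lambda>j. U j x y)))" for x y
  have W: "graphon W" unfolding graphon_def
  proof (intro conjI ballI)
    have "case_prod W = (\<lambda>z. max 0 (min 1 (lim (\<lambda>j. case_prod (U j) z))))"
      by (auto simp: W_def fun_eq_iff)
    then show "case_prod W \<in> borel_measurable unit2" using U_meas by simp
    fix x y
    have "U j x y = U j y x" if "x \<in> {0..1}" "y \<in> {0..1}" for j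
      using graphon_level[of "\<rho> j"] that unfolding U_def graphon_def by blast
    then show "W x y = W y x" if "x \<in> {0..1}" "y \<in> {0..1}" using that by (simp add: W_def)
  qed (auto simp: W_def)
  have UW: "AE z in unit2. (\<lambda>j. case_prod (U j) z) \<longlonglongrightarrow> case_prod W z" using conv
  proof eventually_elim
    case (elim z)
    then have l: "(\<lambda>j. case_prod (U j) z) \<longlonglongrightarrow> lim (\<lambda>j. case_prod (U j) z)" by (simp add: convergent_LIMSEQ_iff)
    have "0 \<le> lim (\<lambda>j. case_prod (U j) z)"
      by (rule LIMSEQ_le_const[OF l]) (simp add: case_prod_unfold U01)
    moreover have "lim (\<lambda>j. case_prod (U j) z) \<le> 1"
      by (rule LIMSEQ_le_const2[OF l]) (simp add: case_prod_unfold U01)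
    ultimately have "case_prod W z = lim (\<lambda>j. case_prod (U j) z)" by (simp add: W_def case_prod_unfold)
    then show ?case using l by simp
  qed
  show ?thesis
  proof (rule that[OF W \<rho>(1)])
    fix k :: nat and E assume E: "E \<subseteq> pairs k"
    let ?P = "pairs k"
    have "AE X in cube {..<k}. \<forall>e\<in>?P. (\<lambda>j. pair_val (U j) X e) \<longlonglongrightarrow> pair_val W X e"
    proof (intro AE_finite_allI)
      fix e assume "e \<in> ?P"
      from AE_cube_pair[OF _ vpairs_Min_Max[OF this] UW]
      show "AE X in cube {..<k}. (\<lambda>j. pair_val (U j) X e) \<longlonglongrightarrow> pair_val W X e" by (simp add: pair_val_def)
    qed simp
    then have lim: "AE X in cube {..<k}. (\<lambda>j. bern ?P E (pair_val (U j) X)) \<longlonglongrightarrow> bern ?P E (pair_val W X)"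
      by eventually_elim (use E in \<open>auto simp: bern_def intro!: tendsto_mult tendsto_prod tendsto_diff\<close>)
    have "(\<lambda>j. sample_dens k E (U j)) \<longlonglongrightarrow> sample_dens k E W" unfolding lgraphon_density_eq
    proof (rule integral_dominated_convergence[where w = "\<lambda>_. 1"])
      show "integrable (cube {..<k}) (\<lambda>_. 1 :: real)"
        by (rule integrable_cube_bounded[where B = 1]) auto
      have Ug: "graphon (U j)" for j unfolding U_def by (rule graphon_level)
      show "AE X in cube {..<k}. norm (bern ?P E (pair_val (U j) X)) \<le> 1" for j
        using bern_bounds[OF Ug E] by (intro AE_I2) auto
      show "(\<lambda>X. bern ?P E (pair_val (U j) X)) \<in> borel_measurable (cube {..<k})" for j
        by (rule bern_measurable[OF Ug E])
      show "(\<lambda>X. bern ?P E (pair_val W X)) \<in> borel_measurable (cube {..<k})"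
        by (rule bern_measurable[OF W E])
    qed (rule lim)
    then show "(\<lambda>j. level_dens (\<rho> j) k E) \<longlonglongrightarrow> sample_dens k E W"
      by (simp add: U_def lgraphon_density_level[OF E])
  qed
qed

end

section \<open>Limits of graph classes\<close>

text \<open>The level is fixed before the graphs grow: it is chosen so that its density is close to
  that of \<open>W\<close> and its cut bound is small, and only then is \<open>approx\<close>
  applied, whose threshold depends on the level.\<close>

lemma graph_limit_compactness:
  fixes G :: "nat \<Rightarrow> ugraph"
  assumes lim: "filterlim (\<lambda>i. graph_order (G i)) at_top sequentially"
  obtains \<sigma> :: "nat \<Rightarrow> nat" and \<Gamma> where "strict_mono \<sigma>" "converges_to (G \<circ> \<sigma>) \<Gamma>"
proof -
  define n where "n i = graph_order (G i)" for i
  have "\<exists>F. F \<subseteq> vpairs {..<n i} \<and> 0 < n i \<and> G i = std_graph (n i) F" for i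
    unfolding n_def using ugraph_standard[of "G i"] by metis
  then obtain F where F: "\<And>i. F i \<subseteq> vpairs {..<n i}" "\<And>i. 0 < n i" "\<And>i. G i = std_graph (n i) (F i)"
    by metis
  have n_lim: "filterlim n at_top sequentially" using lim by (simp add: n_def[abs_def])
  obtain \<sigma> :: "nat \<Rightarrow> nat" and w e and \<kappa> :: "nat \<Rightarrow> real" where \<sigma>: "strict_mono \<sigma>" and tower: "kernel_tower w e"
    and \<kappa>: "\<kappa> \<longlonglongrightarrow> 0"
    and approx: "\<And>r k E (\<delta> :: real). E \<subseteq> pairs k \<Longrightarrow> 0 < \<delta> \<Longrightarrow> \<forall>\<^sub>F i in sequentially.
      \<bar>std_dens k E (n (\<sigma> i)) (F (\<sigma> i))
        - hom_dens (level r) (w r) {..<k} E (dens (w r) (e r))\<bar> \<le> (k choose 2) * \<kappa> r + \<delta>"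
    using graphs_kernel_tower[OF F(2) n_lim, of F] by blast
  interpret kernel_tower w e by (rule tower)
  obtain W \<rho> where W: "graphon W" and \<rho>: "strict_mono (\<rho> :: nat \<Rightarrow> nat)"
    and conv: "\<And>k E. E \<subseteq> pairs k \<Longrightarrow> (\<lambda>j. level_dens (\<rho> j) k E) \<longlonglongrightarrow> sample_dens k E W"
    using limit_graphon by blast
  have main: "(\<lambda>i. std_dens k E (n (\<sigma> i)) (F (\<sigma> i))) \<longlonglongrightarrow> sample_dens k E W" if E: "E \<subseteq> pairs k" for k E
  proof (rule LIMSEQ_I)
    fix \<delta> :: real assume \<delta>: "0 < \<delta>"
    have "(\<lambda>j. \<bar>level_dens (\<rho> j) k E - sample_dens k E W\<bar> + (k choose 2) * \<kappa> (\<rho> j)) \<longlonglongrightarrow> 0 + real (k choose 2) * 0"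
      using LIMSEQ_subseq_LIMSEQ[OF \<kappa> \<rho>] conv[OF E]
      by (intro tendsto_add tendsto_mult tendsto_const) (auto simp: comp_def LIM_zero_iff tendsto_rabs_zero_iff)
    then have "\<forall>\<^sub>F j in sequentially. \<bar>level_dens (\<rho> j) k E - sample_dens k E W\<bar> + (k choose 2) * \<kappa> (\<rho> j) < \<delta> / 2"
      using \<delta> by (intro order_tendstoD(2)) auto
    then obtain j where j: "\<bar>level_dens (\<rho> j) k E - sample_dens k E W\<bar> + (k choose 2) * \<kappa> (\<rho> j) < \<delta> / 2"
      by (auto simp: eventually_sequentially)
    have "\<forall>\<^sub>F i in sequentially. \<bar>std_dens k E (n (\<sigma> i)) (F (\<sigma> i)) - level_dens (\<rho> j) k E\<bar>
        \<le> (k choose 2) * \<kappa> (\<rho> j) + \<delta> / 2" using \<delta> by (intro approx E) simp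
    then have "\<forall>\<^sub>F i in sequentially. norm (std_dens k E (n (\<sigma> i)) (F (\<sigma> i)) - sample_dens k E W) < \<delta>"
    proof eventually_elim
      case (elim i)
      then show ?case using j unfolding real_norm_def by linarith
    qed
    then show "\<exists>N. \<forall>i\<ge>N. norm (std_dens k E (n (\<sigma> i)) (F (\<sigma> i)) - sample_dens k E W) < \<delta>"
      by (simp add: eventually_sequentially)
  qed
  show ?thesis
  proof (rule that[OF \<sigma>])
    show "converges_to (G \<circ> \<sigma>) (abs_graph_limit W)" unfolding converges_to_def
    proof (intro conjI allI)
      show "filterlim (\<lambda>i. graph_order ((G \<circ> \<sigma>) i)) at_top sequentially"
        unfolding comp_def using lim filterlim_subseq[OF \<sigma>] by (rule filterlim_compose)
      fix H :: ugraph
      obtain E where E: "E \<subseteq> vpairs {..<graph_order H}" "0 < graph_order H" "H = std_graph (graph_order H) E"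
        by (rule ugraph_standard)
      define k where "k = graph_order H"
      have H: "E \<subseteq> pairs k" "0 < k" "H = std_graph k E" using E by (simp_all add: k_def)
      have "ind_density H (G (\<sigma> i)) = std_dens k E (n (\<sigma> i)) (F (\<sigma> i))" for i
        using ind_density_std[OF H(2,1) F(2) F(1), of "\<sigma> i"] H(3) F(3)[of "\<sigma> i"] by simp
      moreover have "limit_density H (abs_graph_limit W) = sample_dens k E W"
        using H W by (simp add: limit_density_abs is_graph_std)
      ultimately show "(\<lambda>i. ind_density H ((G \<circ> \<sigma>) i)) \<longlonglongrightarrow> limit_density H (abs_graph_limit W)"
        using main[OF H(1)] by simp
    qed
  qed
qed

lemma converges_to_ind_ent:
  assumes "converges_to G \<Gamma>"
  shows "(\<lambda>i. ind_ent k (G i)) \<longlonglongrightarrow> limit_ent k \<Gamma>"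
  unfolding ind_ent_def limit_ent_def
proof (intro tendsto_sum tendsto_eta)
  fix E
  show lim: "(\<lambda>i. ind_density (std_graph k E) (G i)) \<longlonglongrightarrow> limit_density (std_graph k E) \<Gamma>"
    using assms by (simp add: converges_to_def)
  show "0 \<le> limit_density (std_graph k E) \<Gamma>"
    by (rule LIMSEQ_le_const[OF lim]) (auto simp: ind_density_bounds)
qed (rule ind_density_bounds)

text \<open>A sequence of graphs whose samples of more and more sizes have large entropy has a limit
  point, and by \<open>le_Ent\<close> this limit has large entropy.\<close>

lemma exists_limit_Ent_ge:
  assumes Q: "\<And>k \<epsilon>. 0 < \<epsilon> \<Longrightarrow> \<exists>G\<in>Q. k \<le> graph_order G \<and>
      (\<forall>j\<in>{2..k}. real (j choose 2) * (L - \<epsilon>) \<le> ind_ent j G)"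
  shows "\<exists>\<Gamma>\<in>class_limits Q. L \<le> Ent \<Gamma>"
proof -
  \<comment> \<open>Diagonal choice: the i-th graph serves all sample sizes up to i, so every fixed
    size is eventually covered, with slack tending to 0.\<close>
  have "\<forall>i. \<exists>G. G \<in> Q \<and> i \<le> graph_order G \<and>
      (\<forall>j\<in>{2..i}. real (j choose 2) * (L - 1 / Suc i) \<le> ind_ent j G)"
    using Q[of "1 / Suc i" i for i] by (auto simp: Bex_def)
  from choice[OF this] obtain G where G: "\<And>i. G i \<in> Q" "\<And>i. i \<le> graph_order (G i)"
    "\<And>i j. j \<in> {2..i} \<Longrightarrow> real (j choose 2) * (L - 1 / Suc i) \<le> ind_ent j (G i)" by blast
  have "filterlim (\<lambda>i. graph_order (G i)) at_top sequentially"
    by (rule filterlim_at_top_mono[OF filterlim_ident]) (use G(2) in auto)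
  then obtain \<sigma> :: "nat \<Rightarrow> nat" and \<Gamma> where \<sigma>: "strict_mono \<sigma>" and conv: "converges_to (G \<circ> \<sigma>) \<Gamma>"
    by (rule graph_limit_compactness)
  have "\<Gamma> \<in> class_limits Q"
    unfolding class_limits_def using conv G(1) by (auto intro!: exI[of _ "G \<circ> \<sigma>"])
  moreover have "L \<le> Ent \<Gamma>"
  proof (rule le_Ent)
    fix k :: nat assume k: "2 \<le> k"
    have "(\<lambda>i. real (k choose 2) * (L - 1 / Suc (\<sigma> i))) \<longlonglongrightarrow> real (k choose 2) * (L - 0)"
      using LIMSEQ_subseq_LIMSEQ[OF lim_1_over_n[THEN LIMSEQ_Suc] \<sigma>]
      by (intro tendsto_mult tendsto_diff tendsto_const) (simp add: comp_def)
    moreover have "\<forall>\<^sub>F i in sequentially. real (k choose 2) * (L - 1 / Suc (\<sigma> i)) \<le> ind_ent k ((G \<circ> \<sigma>) i)"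
      using eventually_ge_at_top[of k]
    proof eventually_elim
      case (elim i)
      then have "k \<in> {2..\<sigma> i}" using k seq_suble[OF \<sigma>, of i] by simp
      then show ?case using G(3) by simp
    qed
    ultimately have "real (k choose 2) * (L - 0) \<le> limit_ent k \<Gamma>"
      using converges_to_ind_ent[OF conv] by (intro tendsto_le[OF sequentially_bot]) auto
    then show "real (k choose 2) * L \<le> limit_ent k \<Gamma>" by simp
  qed
  ultimately show ?thesis by blast
qed

lemma exists_limit_Ent_ge_limsup:
  assumes L: "ereal L < limsup (\<lambda>n. elog2 (card (class_of_order Q n)) / ereal (real (n choose 2)))"
  shows "\<exists>\<Gamma>\<in>class_limits Q. L \<le> Ent \<Gamma>"
proof (rule exists_limit_Ent_ge)
  fix k :: nat and \<epsilon> :: real assume \<epsilon>: "0 < \<epsilon>"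
  obtain K :: nat where K: "0 < K" "\<And>n \<X>. k \<le> n \<Longrightarrow> \<X> \<subseteq> {G. graph_order G = n} \<Longrightarrow> \<X> \<noteq> {} \<Longrightarrow>
      \<exists>G\<in>\<X>. \<forall>j\<in>{2..k}. real (j choose 2) * log 2 (card \<X>)
        \<le> real (n choose 2) * (ind_ent j G + \<epsilon> / 2) + real (j choose 2) * log 2 K"
    using exists_graph_large_ind_ent[of "\<epsilon> / 2" k] \<epsilon> by auto
  \<comment> \<open>\<open>K\<close> is fixed before \<open>n\<close>, so its logarithm can be
    absorbed into half of \<epsilon> once \<open>n choose 2\<close> is at least
    \<open>m\<close>.\<close>
  obtain m :: nat where m: "2 * log 2 K / \<epsilon> \<le> real m" using real_arch_simple by blast
  have "\<exists>\<^sub>F n in sequentially. ereal L < elog2 (card (class_of_order Q n)) / ereal (real (n choose 2))"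
  proof (rule ccontr)
    assume "\<not> ?thesis"
    then have "\<forall>\<^sub>F n in sequentially. elog2 (card (class_of_order Q n)) / ereal (real (n choose 2)) \<le> ereal L"
      by (simp add: frequently_def not_less)
    then have "limsup (\<lambda>n. elog2 (card (class_of_order Q n)) / ereal (real (n choose 2))) \<le> ereal L"
      by (rule Limsup_bounded)
    then show False using L by simp
  qed
  \<comment> \<open>The summand 3 ensures that \<open>n choose 2\<close> is at least
    \<open>n\<close>, hence at least \<open>m\<close>.\<close>
  then obtain n where n: "k + m + 3 \<le> n" "ereal L < elog2 (card (class_of_order Q n)) / ereal (real (n choose 2))"
    by (metis (no_types, lifting) frequently_sequentially)
  let ?X = "class_of_order Q n"
  have c0: "0 < real (n choose 2)" using n by (simp add: zero_less_binomial)
  have X: "card ?X \<noteq> 0"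
  proof
    assume "card ?X = 0"
    then show False using n(2) c0 by (simp add: elog2_def)
  qed
  then have Xl: "L * real (n choose 2) < log 2 (card ?X)"
    using n(2) c0 by (simp add: elog2_def pos_less_divide_eq)
  have "?X \<noteq> {}" using X by auto
  then obtain G where G: "G \<in> ?X" "\<And>j. j \<in> {2..k} \<Longrightarrow> real (j choose 2) * log 2 (card ?X)
        \<le> real (n choose 2) * (ind_ent j G + \<epsilon> / 2) + real (j choose 2) * log 2 K"
  proof -
    have "k \<le> n" "?X \<subseteq> {G. graph_order G = n}" using n(1) by (auto simp: class_of_order_def)
    from K(2)[OF this \<open>?X \<noteq> {}\<close>] show ?thesis using that by blast
  qed
  show "\<exists>G\<in>Q. k \<le> graph_order G \<and> (\<forall>j\<in>{2..k}. real (j choose 2) * (L - \<epsilon>) \<le> ind_ent j G)"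
  proof (intro bexI[of _ G] conjI ballI)
    show "G \<in> Q" "k \<le> graph_order G" using G(1) n(1) by (auto simp: class_of_order_def)
    fix j assume j: "j \<in> {2..k}"
    have j1: "1 \<le> real (j choose 2)" using j by (simp add: Suc_le_eq zero_less_binomial)
    have "log 2 K \<le> real (n choose 2) * (\<epsilon> / 2)"
    proof -
      have "2 * log 2 K \<le> real m * \<epsilon>" using m \<epsilon> by (simp add: field_simps)
      also have "real m \<le> real (n choose 2)"
      proof -
        have "real m * 2 \<le> real n * 2" using n(1) by simp
        also have "\<dots> \<le> real n * (real n - 1)" using n(1) by (intro mult_left_mono) auto
        finally show ?thesis by (simp add: real_choose_two)
      qed
      then have "real m * \<epsilon> \<le> real (n choose 2) * \<epsilon>" using \<epsilon> by (intro mult_right_mono) auto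
      finally show ?thesis by simp
    qed
    then have "real (j choose 2) * log 2 K \<le> real (j choose 2) * (real (n choose 2) * (\<epsilon> / 2))"
      by (rule mult_left_mono) simp
    moreover have "real (j choose 2) * (L * real (n choose 2)) \<le> real (j choose 2) * log 2 (card ?X)"
      using Xl by (intro mult_left_mono) auto
    ultimately have "real (j choose 2) * (L * real (n choose 2))
        \<le> real (n choose 2) * (ind_ent j G + \<epsilon> / 2) + real (j choose 2) * (real (n choose 2) * (\<epsilon> / 2))"
      using G(2)[OF j] by linarith
    then have "real (n choose 2) * (real (j choose 2) * L)
        \<le> real (n choose 2) * (ind_ent j G + \<epsilon> / 2 + real (j choose 2) * (\<epsilon> / 2))"
      by (simp add: algebra_simps)
    then have "real (j choose 2) * L \<le> ind_ent j G + \<epsilon> / 2 + real (j choose 2) * (\<epsilon> / 2)" using c0 by simp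
    moreover have "1 * (\<epsilon> / 2) \<le> real (j choose 2) * (\<epsilon> / 2)" using j1 \<epsilon> by (intro mult_right_mono) auto
    ultimately show "real (j choose 2) * (L - \<epsilon>) \<le> ind_ent j G" by (simp add: right_diff_distrib)
  qed
qed

text \<open>Graphs near limits of almost maximal entropy have large sample entropies, so they
  accumulate at a limit whose entropy reaches the supremum.\<close>

lemma exists_max_Ent:
  assumes "class_limits Q \<noteq> {}"
  shows "\<exists>\<Gamma>\<in>class_limits Q. \<forall>\<Gamma>'\<in>class_limits Q. Ent \<Gamma>' \<le> Ent \<Gamma>"
proof -
  define L where "L = Sup (Ent ` class_limits Q)"
  have bdd: "bdd_above (Ent ` class_limits Q)" using Ent_le_1 by (auto intro: bdd_aboveI[of _ 1])
  have "\<exists>\<Gamma>\<in>class_limits Q. L \<le> Ent \<Gamma>"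
  proof (rule exists_limit_Ent_ge)
    fix k :: nat and \<epsilon> :: real assume \<epsilon>: "0 < \<epsilon>"
    then have "L - \<epsilon> < L" by simp
    then obtain \<Gamma> where \<Gamma>: "\<Gamma> \<in> class_limits Q" "L - \<epsilon> < Ent \<Gamma>"
      unfolding L_def using less_cSup_iff[of "Ent ` class_limits Q"] bdd assms by auto
    obtain G where G: "\<And>i. G i \<in> Q" "converges_to G \<Gamma>" using \<Gamma>(1) by (auto simp: class_limits_def)
    have "\<forall>\<^sub>F i in sequentially. real (j choose 2) * (L - \<epsilon>) < ind_ent j (G i)" if j: "j \<in> {2..k}" for j
    proof (rule order_tendstoD(1)[OF converges_to_ind_ent[OF G(2)]])
      have "0 < real (j choose 2)" using j by (simp add: zero_less_binomial)
      then have "real (j choose 2) * (L - \<epsilon>) < real (j choose 2) * Ent \<Gamma>" using \<Gamma>(2) by simp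
      also have "\<dots> \<le> limit_ent j \<Gamma>" using j by (intro Ent_le_limit_ent) auto
      finally show "real (j choose 2) * (L - \<epsilon>) < limit_ent j \<Gamma>" .
    qed
    then have "\<forall>\<^sub>F i in sequentially. \<forall>j\<in>{2..k}. real (j choose 2) * (L - \<epsilon>) < ind_ent j (G i)"
      by (intro eventually_ball_finite) auto
    moreover have "\<forall>\<^sub>F i in sequentially. k \<le> graph_order (G i)"
      using G(2) by (simp add: converges_to_def filterlim_at_top)
    ultimately have "\<forall>\<^sub>F i in sequentially. k \<le> graph_order (G i) \<and> (\<forall>j\<in>{2..k}. real (j choose 2) * (L - \<epsilon>) < ind_ent j (G i))"
      by eventually_elim simp
    then obtain i where "k \<le> graph_order (G i)" "\<forall>j\<in>{2..k}. real (j choose 2) * (L - \<epsilon>) < ind_ent j (G i)"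
      by (auto simp: eventually_sequentially)
    then show "\<exists>G\<in>Q. k \<le> graph_order G \<and> (\<forall>j\<in>{2..k}. real (j choose 2) * (L - \<epsilon>) \<le> ind_ent j G)"
      using G(1) by (intro bexI[of _ "G i"]) (auto intro: less_imp_le)
  qed
  then obtain \<Gamma> where \<Gamma>: "\<Gamma> \<in> class_limits Q" "L \<le> Ent \<Gamma>" by blast
  have "Ent \<Gamma>' \<le> Ent \<Gamma>" if "\<Gamma>' \<in> class_limits Q" for \<Gamma>'
    using cSup_upper[OF imageI[OF that] bdd] \<Gamma>(2) by (simp add: L_def)
  then show ?thesis using \<Gamma>(1) by blast
qed

theorem theorem1p1:
  fixes Q :: "ugraph set"
  shows "limsup (\<lambda>n. elog2 (card (class_of_order Q n)) / ereal (real (n choose 2)))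
           \<le> (SUP \<Gamma>\<in>class_limits Q. ereal (Ent \<Gamma>))
       \<and> (class_limits Q \<noteq> {} \<longrightarrow>
           (\<exists>\<Gamma>\<in>class_limits Q. \<forall>\<Gamma>'\<in>class_limits Q. Ent \<Gamma>' \<le> Ent \<Gamma>))"
proof (intro conjI impI exists_max_Ent)
  show "limsup (\<lambda>n. elog2 (card (class_of_order Q n)) / ereal (real (n choose 2)))
           \<le> (SUP \<Gamma>\<in>class_limits Q. ereal (Ent \<Gamma>))" (is "?l \<le> ?s")
  proof (rule ccontr)
    assume "\<not> ?l \<le> ?s"
    then obtain L where L: "?s < ereal L" "ereal L < ?l" using ereal_dense2[of ?s ?l] by (auto simp: not_le)
    obtain \<Gamma> where "\<Gamma> \<in> class_limits Q" "L \<le> Ent \<Gamma>" using exists_limit_Ent_ge_limsup[OF L(2)] by blast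
    then have "ereal L \<le> ?s" by (intro SUP_upper2[of \<Gamma>]) auto
    then show False using L(1) by simp
  qed
qed

end
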